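(* Let $p\geq 2$ and let $G$ be a finite simple $\{pK_2, K_2+P_4\}$-free graph. Then $\chi(G)\leq f_p(\omega(G))$, where $f_p:\mathbb{N}\to\mathbb{N}$ ($p\geq 2$) is defined as follows. First let $g_p$ ($p\geq2$) be given by $g_t(1)=1$ ($t\geq2$), $g_2(2)=3$, $g_2(m)=m$ ($m\geq3$), $g_p(2)=2p-2$ ($p\geq3$), $g_p(m)=g_{p-1}(m)+2m-2$ ($p,m\geq3$). Then $f_t(1)=1$ for $t\geq 2$; $f_2(2)=3$; $f_2(3)=4$; $f_2(s)=s+2$ for $s\geq 4$; $f_p(2)=2p-2$ and $f_p(3)=2p^2-3p+4$ for $p\geq 3$; and $f_p(m)=f_{p-1}(m)+2g_{p-1}(m-1)+3m-6$ for $p\geq 3$, $m\geq 4$.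
   Context: $\chi(G)$ is the chromatic number and $\omega(G)$ the clique number of $G$. $pK_2$ is the disjoint union of $p$ edges; $P_4$ is the path on four vertices; $K_2+P_4$ is the join of an edge and a $P_4$ (disjoint union plus all edges between the two parts). A graph is $\mathcal{F}$-free if it has no induced subgraph isomorphic to a member of $\mathcal{F}$. *)

theory Defs
  imports "HOL-Library.Ramsey"
begin

record 'a ugraph =
  verts :: "'a set"
  edges :: "'a set set"

definition finite_simple_graph :: "'a ugraph \<Rightarrow> bool" where
  "finite_simple_graph G \<longleftrightarrow> finite (verts G) \<and> edges G \<subseteq> [verts G]\<^bsup>2\<^esup>"

definition complete_graph :: "nat \<Rightarrow> nat ugraph" where
  "complete_graph n = \<lparr>verts = {..<n}, edges = [{..<n}]\<^bsup>2\<^esup>\<rparr>"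

definition path_graph :: "nat \<Rightarrow> nat ugraph" where
  "path_graph n = \<lparr>verts = {..<n}, edges = {{i, Suc i} | i. Suc i < n}\<rparr>"

definition graph_copies :: "nat \<Rightarrow> 'a ugraph \<Rightarrow> (nat \<times> 'a) ugraph" where
  "graph_copies p H =
     \<lparr>verts = {..<p} \<times> verts H,
      edges = {Pair i ` e | i e. i < p \<and> e \<in> edges H}\<rparr>"

definition graph_join :: "'a ugraph \<Rightarrow> 'b ugraph \<Rightarrow> ('a + 'b) ugraph" where
  "graph_join G H =
     \<lparr>verts = verts G <+> verts H,
      edges = image Inl ` edges G \<union> image Inr ` edges H
        \<union> {{Inl u, Inr v} | u v. u \<in> verts G \<and> v \<in> verts H}\<rparr>"

definition graph_isomorphic :: "'a ugraph \<Rightarrow> 'b ugraph \<Rightarrow> bool" where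
  "graph_isomorphic G H \<longleftrightarrow>
     (\<exists>\<phi>. bij_betw \<phi> (verts G) (verts H) \<and>
       (\<forall>u\<in>verts G. \<forall>v\<in>verts G. {u, v} \<in> edges G \<longleftrightarrow> {\<phi> u, \<phi> v} \<in> edges H))"

definition induced_on :: "'a ugraph \<Rightarrow> 'a set \<Rightarrow> 'a ugraph" where
  "induced_on G S = \<lparr>verts = S, edges = {e \<in> edges G. e \<subseteq> S}\<rparr>"

definition induced_free :: "'b ugraph \<Rightarrow> 'a ugraph \<Rightarrow> bool" where
  "induced_free H G \<longleftrightarrow>
     \<not> (\<exists>S \<subseteq> verts G. graph_isomorphic (induced_on G S) H)"

definition proper_colouring :: "'a ugraph \<Rightarrow> nat \<Rightarrow> ('a \<Rightarrow> nat) \<Rightarrow> bool" where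
  "proper_colouring G k c \<longleftrightarrow>
     c ` verts G \<subseteq> {..<k} \<and> (\<forall>u v. {u, v} \<in> edges G \<longrightarrow> c u \<noteq> c v)"

definition chromatic_number :: "'a ugraph \<Rightarrow> nat" where
  "chromatic_number G = (LEAST k. \<exists>c. proper_colouring G k c)"

definition clique_number :: "'a ugraph \<Rightarrow> nat" where
  "clique_number G = Max (card ` {K. K \<subseteq> verts G \<and> clique K (edges G)})"

text \<open>
  The functions $g_p(m)$ and $f_p(m)$ are meant for $p \geq 2$ and $m \geq 1$ only.
  The value at $m = 0$ (the clique number of the graph without vertices) is set to $0$;
  the values for $p < 2$ are never used by the recursion started at $p \geq 2$.
\<close>

fun g_bound :: "nat \<Rightarrow> nat \<Rightarrow> nat" where
  "g_bound p m =
     (if m = 0 then 0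
      else if m = 1 then 1
      else if p \<le> 2 then (if m = 2 then 3 else m)
      else if m = 2 then 2 * p - 2
      else g_bound (p - 1) m + 2 * m - 2)"

fun f_bound :: "nat \<Rightarrow> nat \<Rightarrow> nat" where
  "f_bound p m =
     (if m = 0 then 0
      else if m = 1 then 1
      else if p \<le> 2 then (if m = 2 then 3 else if m = 3 then 4 else m + 2)
      else if m = 2 then 2 * p - 2
      else if m = 3 then 2 * p\<^sup>2 - 3 * p + 4
      else f_bound (p - 1) m + 2 * g_bound (p - 1) (m - 1) + 3 * m - 6)"

declare g_bound.simps [simp del] f_bound.simps [simp del]

lemma g_bound_equations:
  "t \<ge> 2 \<Longrightarrow> g_bound t 1 = 1"
  "g_bound 2 2 = 3"
  "m \<ge> 3 \<Longrightarrow> g_bound 2 m = m"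
  "p \<ge> 3 \<Longrightarrow> g_bound p 2 = 2 * p - 2"
  "p \<ge> 3 \<Longrightarrow> m \<ge> 3 \<Longrightarrow> g_bound p m = g_bound (p - 1) m + 2 * m - 2"
  by (subst g_bound.simps; simp)+

lemma f_bound_equations:
  "t \<ge> 2 \<Longrightarrow> f_bound t 1 = 1"
  "f_bound 2 2 = 3"
  "f_bound 2 3 = 4"
  "s \<ge> 4 \<Longrightarrow> f_bound 2 s = s + 2"
  "p \<ge> 3 \<Longrightarrow> f_bound p 2 = 2 * p - 2"
  "p \<ge> 3 \<Longrightarrow> int (f_bound p 3) = 2 * int p ^ 2 - 3 * int p + 4"
  "p \<ge> 3 \<Longrightarrow> m \<ge> 4 \<Longrightarrow>
     f_bound p m = f_bound (p - 1) m + 2 * g_bound (p - 1) (m - 1) + 3 * m - 6"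
proof -
  assume "p \<ge> 3"
  moreover from this have "3 * p \<le> 2 * p\<^sup>2"
    using mult_le_mono1[of 3 "2 * p" p] by (simp add: power2_eq_square)
  ultimately show "int (f_bound p 3) = 2 * int p ^ 2 - 3 * int p + 4"
    by (subst f_bound.simps) (simp add: of_nat_diff)
qed (subst f_bound.simps; simp)+

end

theory Submission
  imports Defs
begin

text \<open>
  Let \<open>G\<close> be a graph with clique number \<open>m\<close>. For \<open>m, p \<ge> 3\<close> take a triangle \<open>xyz\<close>. Each of the three
  common neighbourhoods of two of its vertices is \<open>P\<^sub>4\<close>-free, hence perfect, and takes \<open>m - 2\<close> colours.
  The vertices adjacent only to \<open>x\<close>, and those adjacent only to \<open>y\<close>, induce gem-free graphs without
  \<open>(p - 1)K\<^sub>2\<close>, and the remaining ones a graph without \<open>(p - 1)K\<^sub>2\<close>. This gives the recursion for \<open>f\<close>;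
  the one for \<open>g\<close>, which bounds gem-free graphs, comes from an edge \<open>xy\<close> in the same way.

  For \<open>p = 2\<close> and large \<open>m\<close> all but at most two colour classes are indexed by a maximum clique \<open>K\<close>: each
  vertex receives the colour of a suitable non-neighbour in \<open>K\<close>. Two base cases remain: \<open>{2K\<^sub>2, K\<^sub>4}\<close>-free
  graphs and triangle-free \<open>3K\<^sub>2\<close>-free graphs are \<open>4\<close>-colourable. In both, a minimal counterexample is
  vertex-critical, so no vertex neighbourhood contains that of a non-adjacent vertex. This excludes a list
  of small induced subgraphs one after the other, by a finite case analysis over the possible
  neighbourhoods of one further vertex; it is carried out by a verified checker on explicit certificates.
  What is left is coloured directly.
\<close>

section \<open>Colourings and vertex-critical graphs\<close>

text \<open>The values at \<open>p = 2\<close> and \<open>m = 2\<close> break the pattern of the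
  recursions, and this shapes the proof. A five-cycle has no two independent edges and needs 3
  colours. In a triangle-free graph an edge costs two more colours, one for each stable
  neighbourhood; from \<open>p = 2\<close> to \<open>p = 3\<close> this would give 5 where 4 is
  claimed. Likewise the colouring along a maximum clique spends two extra colours and relies on four
  clique vertices, while clique number 3 allows only 4 colours in all. Hence the two special base
  cases. From there on, \<open>f_p(3) = 2p^2 - 3p + 4\<close> is just what the general recursion
  yields at \<open>m = 3\<close>. In the step with the triangle \<open>xyz\<close>, the vertices
  adjacent only to \<open>x\<close> contain no \<open>(p - 1)K2\<close> because no edge joins them
  to \<open>yz\<close>; they induce a gem-free graph because the centre of a gem among them,
  together with \<open>x\<close>, would be the \<open>K2\<close> of a \<open>K2 + P4\<close>. An
  edge or triangle has to be present, so each induction works with the exact clique number and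
  returns to an upper bound \<open>m\<close> by monotonicity of the bounds.\<close>

definition colourable :: "('a \<Rightarrow> 'a \<Rightarrow> bool) \<Rightarrow> nat \<Rightarrow> 'a set \<Rightarrow> bool" where
  "colourable E k W \<longleftrightarrow> (\<exists>c. (\<forall>u\<in>W. c u < k) \<and> (\<forall>u\<in>W. \<forall>v\<in>W. E u v \<longrightarrow> c u \<noteq> (c v :: nat)))"

lemma colourableI:
  "(\<And>u. u \<in> W \<Longrightarrow> c u < k) \<Longrightarrow> (\<And>u v. u \<in> W \<Longrightarrow> v \<in> W \<Longrightarrow> E u v \<Longrightarrow> c u \<noteq> c v) \<Longrightarrow> colourable E k W"
  unfolding colourable_def by blast

lemma colourable_subset: "colourable E k W \<Longrightarrow> W' \<subseteq> W \<Longrightarrow> colourable E k W'"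
  unfolding colourable_def by (meson subsetD)

lemma colourable_mono: "colourable E k W \<Longrightarrow> k \<le> k' \<Longrightarrow> colourable E k' W"
  unfolding colourable_def by (meson less_le_trans)

lemma colourable_Un:
  assumes "colourable E k A" "colourable E l B"
  shows "colourable E (k + l) (A \<union> B)"
proof -
  obtain c d where c: "\<forall>u\<in>A. c u < k" "\<forall>u\<in>A. \<forall>v\<in>A. E u v \<longrightarrow> c u \<noteq> (c v :: nat)"
    and d: "\<forall>u\<in>B. d u < l" "\<forall>u\<in>B. \<forall>v\<in>B. E u v \<longrightarrow> d u \<noteq> (d v :: nat)"
    using assms unfolding colourable_def by (elim exE conjE) blast
  show ?thesis
  proof (rule colourableI[of _ "\<lambda>u. if u \<in> A then c u else k + d u"])
    fix u v assume "u \<in> A \<union> B" "v \<in> A \<union> B" "E u v"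
    then show "(if u \<in> A then c u else k + d u) \<noteq> (if v \<in> A then c v else k + d v)"
      using c d by (auto dest: bspec)
  qed (use c d in auto)
qed

locale sgraph =
  fixes E :: "'a \<Rightarrow> 'a \<Rightarrow> bool"
  assumes sym: "E u v \<Longrightarrow> E v u" and irrefl: "\<not> E u u"
begin

lemma commute: "E u v \<longleftrightarrow> E v u"
  using sym by blast

definition critical :: "nat \<Rightarrow> 'a set \<Rightarrow> bool" where
  "critical k W \<longleftrightarrow> \<not> colourable E k W \<and> (\<forall>w\<in>W. colourable E k (W - {w}))"

lemma ex_critical:
  assumes "finite W" "\<not> colourable E k W"
  obtains W' where "W' \<subseteq> W" "critical k W'"
proof -
  have "\<exists>W'\<subseteq>W. critical k W'"
    using assms
  proof (induction W rule: finite_psubset_induct)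
    case (psubset W)
    show ?case
    proof (cases "critical k W")
      case False
      then obtain w where "w \<in> W" "\<not> colourable E k (W - {w})"
        using psubset.prems unfolding critical_def by blast
      then show ?thesis
        using psubset.IH[of "W - {w}"] by blast
    qed blast
  qed
  then show ?thesis using that by blast
qed

text \<open>If every neighbour of \<open>u\<close> were a neighbour of \<open>v\<close>, a colouring
  of \<open>W - {u}\<close> would extend to \<open>W\<close> by giving \<open>u\<close> the colour
  of \<open>v\<close>.\<close>

lemma critical_not_dominated:
  assumes "critical k W" "u \<in> W" "v \<in> W" "u \<noteq> v" "\<not> E u v"
  obtains w where "w \<in> W" "E w u" "\<not> E w v"
proof -
  have "\<exists>w\<in>W. E w u \<and> \<not> E w v"
  proof (rule ccontr)
    assume neg: "\<not> ?thesis"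
    obtain c where c: "\<forall>x\<in>W - {u}. c x < k" "\<forall>x\<in>W - {u}. \<forall>y\<in>W - {u}. E x y \<longrightarrow> c x \<noteq> (c y :: nat)"
      using assms unfolding critical_def colourable_def by blast
    have "colourable E k W"
    proof (rule colourableI[of _ "c(u := c v)"])
      fix x y assume xy: "x \<in> W" "y \<in> W" "E x y"
      have "x \<noteq> y" using xy irrefl by blast
      moreover have "E y v" if "x = u" using neg xy that commute by blast
      moreover have "E x v" if "y = u" using neg xy that by blast
      ultimately show "(c(u := c v)) x \<noteq> (c(u := c v)) y"
        using c xy assms by (auto simp: commute)
    qed (use c assms in auto)
    then show False using assms(1) unfolding critical_def by blast
  qed
  then show ?thesis using that by blast
qed

text \<open>Without an edge leaving \<open>A\<close>, a colouring of \<open>A\<close> and one of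
  \<open>W - A\<close> combine. The latter exists because deleting a single vertex of
  \<open>A\<close> already makes \<open>W\<close> colourable.\<close>

lemma critical_ex_neighbour:
  assumes "critical k W" "A \<subseteq> W" "A \<noteq> {}" "colourable E k A"
  obtains w a where "w \<in> W - A" "a \<in> A" "E w a"
proof -
  have "\<exists>w\<in>W - A. \<exists>a\<in>A. E w a"
  proof (rule ccontr)
    assume neg: "\<not> ?thesis"
    obtain c where c: "\<forall>x\<in>A. c x < k" "\<forall>x\<in>A. \<forall>y\<in>A. E x y \<longrightarrow> c x \<noteq> (c y :: nat)"
      using assms unfolding colourable_def by blast
    obtain a where "a \<in> A" using assms by blast
    then have "colourable E k (W - {a})" using assms unfolding critical_def by blast
    then have "colourable E k (W - A)" by (rule colourable_subset) (use \<open>a \<in> A\<close> in blast)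
    then obtain d where d: "\<forall>x\<in>W - A. d x < k" "\<forall>x\<in>W - A. \<forall>y\<in>W - A. E x y \<longrightarrow> d x \<noteq> (d y :: nat)"
      unfolding colourable_def by blast
    have "colourable E k W"
    proof (rule colourableI[of _ "\<lambda>x. if x \<in> A then c x else d x"])
      fix x y assume xy: "x \<in> W" "y \<in> W" "E x y"
      then have "x \<in> A \<longleftrightarrow> y \<in> A" using neg commute by blast
      then show "(if x \<in> A then c x else d x) \<noteq> (if y \<in> A then c y else d y)"
        using c d xy by auto
    qed (use c d in auto)
    then show False using assms unfolding critical_def by blast
  qed
  then show ?thesis using that by blast
qed

end

section \<open>Certificates that a graph does not occur\<close>

text \<open>
  A graph on \<open>{..<n}\<close> is given by its lower triangle: the \<open>i\<close>-th row lists the adjacency of \<open>i\<close> with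
  \<open>0, \<dots>, i - 1\<close>, where \<open>None\<close> means that the adjacency is unknown.
\<close>

type_synonym pgraph = "bool option list list"

text \<open>Positions outside a list read as unknown, so an out-of-range reference in a certificate
  never asserts anything about an adjacency.\<close>

fun entry :: "bool option list \<Rightarrow> nat \<Rightarrow> bool option" where
  "entry [] n = None"
| "entry (x # xs) 0 = x"
| "entry (x # xs) (Suc n) = entry xs n"

fun row :: "pgraph \<Rightarrow> nat \<Rightarrow> bool option list" where
  "row [] n = []"
| "row (x # xs) 0 = x"
| "row (x # xs) (Suc n) = row xs n"

definition look :: "pgraph \<Rightarrow> nat \<Rightarrow> nat \<Rightarrow> bool option" where
  "look P i j = (if j < i then entry (row P i) j else if i < j then entry (row P j) i else None)"

lemma entry_nth: "n < length xs \<Longrightarrow> entry xs n = xs ! n"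
  by (induction xs n rule: entry.induct) auto

lemma row_nth: "n < length P \<Longrightarrow> row P n = P ! n"
  by (induction P n rule: row.induct) auto

lemma row_append: "row (P @ Q) n = (if n < length P then row P n else row Q (n - length P))"
  by (induction P n rule: row.induct) auto

lemma look_commute: "look P i j = look P j i"
  by (simp add: look_def)

text \<open>Here \<open>rs\<close> are the remaining rows of the graph to be found,
  \<open>es\<close> the images of their vertices in \<open>P\<close>, and \<open>acc\<close> the
  images chosen before. The excluded graphs used below have no unknown entries, so the equality of
  entries asks for an induced copy in the known part of \<open>P\<close>.\<close>

fun embeds :: "pgraph \<Rightarrow> nat list \<Rightarrow> pgraph \<Rightarrow> nat list \<Rightarrow> bool" where
  "embeds P acc [] [] \<longleftrightarrow> True"
| "embeds P acc (r # rs) (e # es) \<longleftrightarrow> e < length P \<and> e \<notin> set acc \<and> list_all2 (\<lambda>b a. look P e a = b) r acc \<and> embeds P (acc @ [e]) rs es"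
| "embeds P acc _ _ \<longleftrightarrow> False"

lemma embedsD:
  assumes "embeds P acc rs es" "distinct acc"
  shows "length es = length rs \<and> distinct (acc @ es) \<and> set es \<subseteq> {..<length P} \<and>
    (\<forall>i<length rs. length (rs ! i) = length acc + i \<and>
      (\<forall>j<length acc + i. look P (es ! i) ((acc @ es) ! j) = rs ! i ! j))"
  using assms
proof (induction P acc rs es rule: embeds.induct)
  case (2 P acc r rs e es)
  have IH: "length es = length rs" "distinct ((acc @ [e]) @ es)" "set es \<subseteq> {..<length P}"
    "\<And>i. i < length rs \<Longrightarrow> length (rs ! i) = length (acc @ [e]) + i"
    "\<And>i j. i < length rs \<Longrightarrow> j < length (acc @ [e]) + i \<Longrightarrow> look P (es ! i) (((acc @ [e]) @ es) ! j) = rs ! i ! j"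
    using 2 by auto
  have r: "length r = length acc" "\<And>j. j < length acc \<Longrightarrow> look P e (acc ! j) = r ! j"
    using "2.prems" by (auto simp: list_all2_conv_all_nth)
  have "length ((r # rs) ! i) = length acc + i \<and>
      (\<forall>j<length acc + i. look P ((e # es) ! i) ((acc @ e # es) ! j) = (r # rs) ! i ! j)"
    if "i < length (r # rs)" for i
    using that IH(4,5) r by (cases i) (auto simp: nth_append)
  then show ?case using IH(1-3) "2.prems" by auto
qed auto

text \<open>
  A decision tree classifies a vertex \<open>w\<close> outside a copy of \<open>H\<close> by its adjacency to the vertices of \<open>H\<close>.
  \<open>Bad l es\<close> refutes a branch: the partial information on \<open>w\<close> already yields a copy of the \<open>l\<close>-th graph
  known not to occur, with vertices \<open>es\<close>, where \<open>w\<close> has index \<open>length H\<close>.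
\<close>

datatype tree = Split nat tree tree | Bad nat "nat list" | Isolated | Col nat

text \<open>The flags \<open>i\<close> and \<open>c\<close> say which leaves besides
  \<open>Bad\<close> are admissible: \<open>Isolated\<close> when the classified vertex is known to
  have a neighbour in the copy, \<open>Col\<close> when it is to be coloured.\<close>

fun tree_ok :: "bool \<Rightarrow> bool \<Rightarrow> pgraph list \<Rightarrow> pgraph \<Rightarrow> bool option list \<Rightarrow> tree \<Rightarrow> bool" where
  "tree_ok i c Fs H r (Split n s t) \<longleftrightarrow>
     tree_ok i c Fs H (r[n := Some True]) s \<and> tree_ok i c Fs H (r[n := Some False]) t"
| "tree_ok i c Fs H r (Bad l es) \<longleftrightarrow> l < length Fs \<and> embeds (H @ [r]) [] (Fs ! l) es"
| "tree_ok i c Fs H r Isolated \<longleftrightarrow> i \<and> list_all (\<lambda>b. b = Some False) r"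
| "tree_ok i c Fs H r (Col n) \<longleftrightarrow> c"

fun leaves :: "bool option list \<Rightarrow> tree \<Rightarrow> (bool option list \<times> nat) list" where
  "leaves r (Split n s t) = leaves (r[n := Some True]) s @ leaves (r[n := Some False]) t"
| "leaves r (Col n) = [(r, n)]"
| "leaves r _ = []"

text \<open>Each leaf is also paired with itself, since two different vertices may reach the same
  leaf. One order of each pair is enough because adjacency is symmetric.\<close>

fun mono_pairs :: "(bool option list \<times> nat) list \<Rightarrow> (bool option list \<times> bool option list) list" where
  "mono_pairs [] = []"
| "mono_pairs (x # xs) = map (\<lambda>y. (fst x, fst y)) (filter (\<lambda>y. snd y = snd x) (x # xs)) @ mono_pairs xs"

text \<open>
  Three ways to show that \<open>H\<close> does not occur in a vertex-critical graph: a neighbourhood inclusion in \<open>H\<close>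
  must be destroyed by a new vertex; a colourable \<open>H\<close> has a new neighbour; or all further vertices are
  coloured by the leaf they reach, where for each two leaves of equal colour an embedding shows that
  vertices reaching them are not adjacent.
\<close>

datatype step =
    Dominated nat nat tree
  | Extend "nat list" tree
  | Colour "nat list" tree "(nat \<times> nat list) list"

definition blank :: "pgraph \<Rightarrow> bool option list" where
  "blank H = map (\<lambda>_. None) H"

text \<open>An unknown adjacency counts as an edge: the colour \<open>n\<close> of a leaf may be
  repeated only at vertices of the copy that are known to be non-adjacent.\<close>

fun proper_row :: "nat list \<Rightarrow> bool option list \<Rightarrow> nat \<Rightarrow> bool" where
  "proper_row (c # cs) (b # bs) n \<longleftrightarrow> (c \<noteq> n \<or> b = Some False) \<and> proper_row cs bs n"
| "proper_row _ [] n \<longleftrightarrow> True"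
| "proper_row _ _ n \<longleftrightarrow> False"

definition colours_ok :: "nat \<Rightarrow> pgraph \<Rightarrow> nat list \<Rightarrow> bool" where
  "colours_ok k H cs \<longleftrightarrow> length cs = length H \<and> list_all (\<lambda>c. c < k) cs \<and>
     list_all (\<lambda>i. list_all (\<lambda>j. look H i j = Some False \<or> cs ! i \<noteq> cs ! j) [0..<i]) [0..<length H]"

definition dominated :: "pgraph \<Rightarrow> nat \<Rightarrow> nat \<Rightarrow> bool" where
  "dominated H u v \<longleftrightarrow> u < length H \<and> v < length H \<and> u \<noteq> v \<and> look H u v = Some False \<and>
     list_all (\<lambda>i. i = u \<or> i = v \<or> look H i u = Some False \<or> look H i v = Some True) [0..<length H]"

fun step_ok :: "nat \<Rightarrow> pgraph list \<Rightarrow> pgraph \<Rightarrow> step \<Rightarrow> bool" where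
  "step_ok k Fs H (Dominated u v t) \<longleftrightarrow>
     dominated H u v \<and> tree_ok False False Fs H ((blank H)[u := Some True, v := Some False]) t"
| "step_ok k Fs H (Extend cs t) \<longleftrightarrow> H \<noteq> [] \<and> colours_ok k H cs \<and> tree_ok True False Fs H (blank H) t"
| "step_ok k Fs H (Colour cs t ps) \<longleftrightarrow>
     colours_ok k H cs \<and> tree_ok False True Fs H (blank H) t \<and>
     list_all (\<lambda>(r, c). c < k \<and> proper_row cs r c) (leaves (blank H) t) \<and>
     list_all2 (\<lambda>(r, r') (l, es). l < length Fs \<and> embeds (H @ [r, r' @ [Some True]]) [] (Fs ! l) es)
       (mono_pairs (leaves (blank H) t)) ps"

definition graph_of :: "nat list list \<Rightarrow> pgraph" where
  "graph_of Ns = map2 (\<lambda>k N. map (\<lambda>j. Some (j \<in> set N)) [0..<k]) [0..<length Ns] Ns"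

text \<open>A graph that has been excluded joins the list and may be used by all later certificates.
  The number in a \<open>Bad\<close> leaf thus counts the graphs forbidden from the start and after
  them the earlier graphs of the same list.\<close>

fun steps_ok :: "nat \<Rightarrow> pgraph list \<Rightarrow> (pgraph \<times> step) list \<Rightarrow> bool" where
  "steps_ok k Fs [] \<longleftrightarrow> True"
| "steps_ok k Fs ((H, s) # xs) \<longleftrightarrow> step_ok k Fs H s \<and> steps_ok k (Fs @ [H]) xs"

context sgraph
begin

definition realizes :: "'a set \<Rightarrow> (nat \<Rightarrow> 'a) \<Rightarrow> pgraph \<Rightarrow> bool" where
  "realizes W f P \<longleftrightarrow> f ` {..<length P} \<subseteq> W \<and> inj_on f {..<length P} \<and>
     (\<forall>i<length P. \<forall>j<length P. \<forall>b. look P i j = Some b \<longrightarrow> E (f i) (f j) = b)"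

definition occurs :: "'a set \<Rightarrow> pgraph \<Rightarrow> bool" where
  "occurs W P \<longleftrightarrow> (\<exists>f. realizes W f P)"

lemma occurs_subset: "occurs W P \<Longrightarrow> W \<subseteq> W' \<Longrightarrow> occurs W' P"
  unfolding occurs_def realizes_def by (meson order_trans)

lemma realizesI:
  assumes "\<And>i. i < length P \<Longrightarrow> f i \<in> W" "inj_on f {..<length P}"
    "\<And>i j b. i < length P \<Longrightarrow> j < i \<Longrightarrow> look P i j = Some b \<Longrightarrow> E (f i) (f j) = b"
  shows "realizes W f P"
  unfolding realizes_def
proof (intro conjI allI impI)
  fix i j b assume ij: "i < length P" "j < length P" "look P i j = Some b"
  consider "i = j" | "j < i" | "i < j" by linarith
  then show "E (f i) (f j) = b"
  proof cases
    case 1 then show ?thesis using ij by (simp add: look_def)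
  next
    case 2 then show ?thesis using ij assms(3) by blast
  next
    case 3 then show ?thesis using ij assms(3)[of j i b] by (simp add: look_commute commute)
  qed
qed (use assms in auto)

lemma embeds_occurs:
  assumes "realizes W f P" "embeds P [] F es"
  shows "occurs W F"
proof -
  note e = embedsD[OF assms(2) distinct.simps(1)[THEN iffD2, OF TrueI]]
  have "realizes W (\<lambda>i. f (es ! i)) F"
  proof (rule realizesI)
    show "f (es ! i) \<in> W" if "i < length F" for i
      using that e assms(1) unfolding realizes_def by (auto simp: subset_iff)
    show "inj_on (\<lambda>i. f (es ! i)) {..<length F}"
    proof (rule inj_onI)
      fix i j assume ij: "i \<in> {..<length F}" "j \<in> {..<length F}" "f (es ! i) = f (es ! j)"
      then have "es ! i \<in> {..<length P}" "es ! j \<in> {..<length P}"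
        using e by (auto simp: subset_iff)
      then have "es ! i = es ! j"
        using assms(1) ij unfolding realizes_def inj_on_def by blast
      then show "i = j" using e ij by (auto simp: nth_eq_iff_index_eq)
    qed
    show "E (f (es ! i)) (f (es ! j)) = b" if "i < length F" "j < i" "look F i j = Some b" for i j b
    proof -
      have "look F i j = F ! i ! j" using that e by (auto simp: look_def row_nth entry_nth)
      moreover have "look P (es ! i) (es ! j) = F ! i ! j" using that e by auto
      moreover have "es ! i < length P" "es ! j < length P"
        using e that by (auto simp: subset_iff)
      ultimately show ?thesis using assms(1) that unfolding realizes_def by auto
    qed
  qed
  then show ?thesis unfolding occurs_def by blast
qed

definition matches :: "(nat \<Rightarrow> 'a) \<Rightarrow> nat \<Rightarrow> 'a \<Rightarrow> bool option list \<Rightarrow> bool" where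
  "matches f n w r \<longleftrightarrow> length r = n \<and> (\<forall>i<n. \<forall>b. r ! i = Some b \<longrightarrow> E w (f i) = b)"

lemma matches_update: "matches f n w r \<Longrightarrow> E w (f i) = b \<Longrightarrow> matches f n w (r[i := Some b])"
  unfolding matches_def length_list_update
proof (intro conjI allI impI)
  fix j b'
  assume *: "length r = n \<and> (\<forall>i<n. \<forall>b. r ! i = Some b \<longrightarrow> E w (f i) = b)"
    "E w (f i) = b" "j < n" "r[i := Some b] ! j = Some b'"
  show "E w (f j) = b'"
  proof (cases "i = j")
    case False
    then have "r ! j = Some b'" using *(4) by simp
    then show ?thesis using *(1,3) by blast
  qed (use * in simp)
qed simp

lemma matches_blank: "matches f (length H) w (blank H)"
  unfolding matches_def blank_def by auto

lemma realizes_extend: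
  assumes "realizes W f H" "w \<in> W" "w \<notin> f ` {..<length H}" "matches f (length H) w r"
  shows "realizes W (f(length H := w)) (H @ [r])"
proof (rule realizesI)
  let ?n = "length H"
  show "(f(?n := w)) i \<in> W" if "i < length (H @ [r])" for i
    using that assms(1,2) unfolding realizes_def by (auto simp: less_Suc_eq)
  show "inj_on (f(?n := w)) {..<length (H @ [r])}"
    using assms(1,3) unfolding realizes_def by (auto simp: lessThan_Suc inj_on_def)
  show "E ((f(?n := w)) i) ((f(?n := w)) j) = b"
    if "i < length (H @ [r])" "j < i" "look (H @ [r]) i j = Some b" for i j b
  proof (cases "i = ?n")
    case True
    then show ?thesis
      using that assms(4) unfolding matches_def by (auto simp: look_def row_append entry_nth)
  next
    case False
    then have "look H i j = Some b" "i < ?n" using that by (auto simp: look_def row_append)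
    then show ?thesis using that assms(1) unfolding realizes_def by auto
  qed
qed

text \<open>Descending according to the true adjacencies of \<open>w\<close> keeps the row
  compatible with \<open>w\<close>. The descent cannot end in \<open>Bad\<close>, because the copy
  of \<open>H\<close> extended by \<open>w\<close> would then contain an excluded graph.\<close>

lemma tree_ok_sound:
  assumes "tree_ok i c Fs H r t" "\<And>F. F \<in> set Fs \<Longrightarrow> \<not> occurs W F"
    and "realizes W f H" "w \<in> W" "w \<notin> f ` {..<length H}" "matches f (length H) w r"
  shows "(i \<and> (\<forall>j<length H. \<not> E w (f j))) \<or> (c \<and> (\<exists>(r', n)\<in>set (leaves r t). matches f (length H) w r'))"
  using assms(1,6)
proof (induction t arbitrary: r)
  case (Split n s t)
  show ?case
  proof (cases "E w (f n)")
    case True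
    then show ?thesis
      using Split.IH(1)[of "r[n := Some True]"] Split.prems matches_update[of f _ w r n True] by auto
  next
    case False
    then show ?thesis
      using Split.IH(2)[of "r[n := Some False]"] Split.prems matches_update[of f _ w r n False] by auto
  qed
next
  case (Bad l es)
  have "occurs W (Fs ! l)"
    using embeds_occurs[OF realizes_extend[OF assms(3-5) Bad.prems(2)]] Bad.prems(1) unfolding tree_ok.simps by blast
  then show ?case using Bad.prems(1) assms(2) by auto
next
  case Isolated
  then show ?case unfolding matches_def by (auto simp: list_all_length)
next
  case (Col n)
  then show ?case by auto
qed

lemma proper_row_entry:
  "proper_row cs r c \<Longrightarrow> i < length r \<Longrightarrow> i < length cs \<and> (cs ! i = c \<longrightarrow> r ! i = Some False)"
proof (induction cs r c arbitrary: i rule: proper_row.induct)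
  case (1 c cs b bs n)
  then show ?case by (cases i) auto
qed auto

lemma colours_ok_proper:
  assumes "colours_ok k H cs" "realizes W f H"
  shows "length cs = length H" "\<And>i. i < length H \<Longrightarrow> cs ! i < k"
    "\<And>i j. i < length H \<Longrightarrow> j < length H \<Longrightarrow> E (f i) (f j) \<Longrightarrow> cs ! i \<noteq> cs ! j"
proof -
  have *: "length cs = length H" "\<And>i. i < length H \<Longrightarrow> cs ! i < k"
    "\<And>i j. i < length H \<Longrightarrow> j < i \<Longrightarrow> look H i j = Some False \<or> cs ! i \<noteq> cs ! j"
    using assms(1) unfolding colours_ok_def list_all_length by auto
  show "length cs = length H" "\<And>i. i < length H \<Longrightarrow> cs ! i < k" by (fact *)+
  have **: "cs ! i \<noteq> cs ! j" if "i < length H" "j < i" "E (f i) (f j)" for i j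
  proof -
    have "E (f i) (f j) = False" if "look H i j = Some False"
      using assms(2) that \<open>i < length H\<close> \<open>j < i\<close> less_trans unfolding realizes_def by blast
    then show ?thesis using *(3) that by blast
  qed
  show "cs ! i \<noteq> cs ! j" if "i < length H" "j < length H" "E (f i) (f j)" for i j
    using **[of i j] **[of j i] that irrefl sym by (metis linorder_neqE_nat)
qed

lemma mono_pairs_mem:
  "x \<in> set xs \<Longrightarrow> y \<in> set xs \<Longrightarrow> snd x = snd y \<Longrightarrow>
   (fst x, fst y) \<in> set (mono_pairs xs) \<or> (fst y, fst x) \<in> set (mono_pairs xs)"
proof (induction xs)
  case (Cons a xs)
  then consider "x = a" | "y = a" | "x \<in> set xs" "y \<in> set xs" by auto
  then show ?case
  proof cases
    case 1
    then have "y \<in> set (filter (\<lambda>y. snd y = snd a) (a # xs))" using Cons.prems by auto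
    then show ?thesis using 1 by (simp only: mono_pairs.simps set_append set_map) blast
  next
    case 2
    then have "x \<in> set (filter (\<lambda>y. snd y = snd a) (a # xs))" using Cons.prems by auto
    then show ?thesis using 2 by (simp only: mono_pairs.simps set_append set_map) blast
  next
    case 3
    then show ?thesis using Cons by (simp only: mono_pairs.simps set_append) blast
  qed
qed simp

lemma realizes_extend2:
  assumes "realizes W f H" "w \<in> W" "w \<notin> f ` {..<length H}" "matches f (length H) w r"
    and "w' \<in> W" "w' \<notin> f ` {..<length H}" "matches f (length H) w' r'" "E w w'"
  shows "realizes W (f(length H := w, Suc (length H) := w')) (H @ [r, r' @ [Some True]])"
proof -
  have "w' \<noteq> w" using assms(8) irrefl by blast
  moreover have "matches (f(length H := w)) (length (H @ [r])) w' (r' @ [Some True])"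
    using assms(7,8) commute unfolding matches_def by (auto simp: nth_append less_Suc_eq)
  moreover have "w' \<notin> (f(length H := w)) ` {..<length (H @ [r])}"
    using \<open>w' \<noteq> w\<close> assms(6) by (auto simp: less_Suc_eq)
  ultimately show ?thesis
    using realizes_extend[OF realizes_extend[OF assms(1-4)] assms(5), of "r' @ [Some True]"] by simp
qed

lemma step_ok_sound:
  assumes "step_ok k Fs H s" "\<And>F. F \<in> set Fs \<Longrightarrow> \<not> occurs W F" "critical k W"
  shows "\<not> occurs W H"
proof
  assume "occurs W H"
  then obtain f where f: "realizes W f H" unfolding occurs_def by blast
  let ?n = "length H" and ?A = "f ` {..<length H}"
  have fW: "\<And>i. i < ?n \<Longrightarrow> f i \<in> W" using f unfolding realizes_def by blast
  have inj: "inj_on f {..<?n}" using f unfolding realizes_def by blast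
  have look: "\<And>i j b. i < ?n \<Longrightarrow> j < ?n \<Longrightarrow> look H i j = Some b \<Longrightarrow> E (f i) (f j) = b"
    using f unfolding realizes_def by blast
  show False
  proof (cases s)
    case (Dominated u v t)
    have uv: "u < ?n" "v < ?n" "u \<noteq> v" "\<not> E (f u) (f v)" "f u \<noteq> f v"
      using assms(1) Dominated look inj unfolding inj_on_def by (auto simp: dominated_def)
    obtain w where w: "w \<in> W" "E w (f u)" "\<not> E w (f v)"
      using critical_not_dominated[OF assms(3) fW[OF uv(1)] fW[OF uv(2)] uv(5,4)] by blast
    \<comment> \<open>The check \<open>dominated\<close> says that inside the copy every neighbour
      of \<open>u\<close> is a neighbour of \<open>v\<close>, so the vertex supplied by criticality
      must be new.\<close>
    have "w \<notin> ?A"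
    proof
      assume "w \<in> ?A"
      then obtain i where i: "i < ?n" "w = f i" by blast
      then have "i = u \<or> i = v \<or> look H i u = Some False \<or> look H i v = Some True"
        using assms(1) Dominated by (auto simp: dominated_def list_all_length)
      then show False using w i look uv irrefl commute by blast
    qed
    moreover have "matches f ?n w ((blank H)[u := Some True, v := Some False])"
      using w by (intro matches_update matches_blank) auto
    ultimately show False
      using tree_ok_sound[of False False Fs H _ t W f w] assms(1,2) Dominated f w by auto
  next
    case (Extend cs t)
    note cs = colours_ok_proper[of k H cs W f]
    have "colourable E k ?A"
    proof (rule colourableI[of _ "\<lambda>x. cs ! the_inv_into {..<?n} f x"])
      show "cs ! the_inv_into {..<?n} f x < k" if "x \<in> ?A" for x
        using that cs assms(1) Extend f inj by (auto simp: the_inv_into_f_f)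
      show "cs ! the_inv_into {..<?n} f x \<noteq> cs ! the_inv_into {..<?n} f y"
        if "x \<in> ?A" "y \<in> ?A" "E x y" for x y
        using that cs assms(1) Extend f inj by (auto simp: the_inv_into_f_f)
    qed
    moreover have "?A \<noteq> {}" using assms(1) Extend by auto
    ultimately obtain w a where wa: "w \<in> W - ?A" "a \<in> ?A" "E w a"
      using critical_ex_neighbour[OF assms(3), of ?A] fW by blast
    then show False
      using tree_ok_sound[of True False Fs H "blank H" t W f w] assms(1,2) Extend f matches_blank[of f H w]
      by auto
  next
    case (Colour cs t ps)
    note cs = colours_ok_proper[of k H cs W f]
    have ok: "colours_ok k H cs" "tree_ok False True Fs H (blank H) t" using assms(1) Colour by auto
    have lv: "c < k" "proper_row cs r c" if "(r, c) \<in> set (leaves (blank H) t)" for r c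
      using assms(1) Colour that by (auto simp: list_all_iff)
    have "\<exists>x\<in>set (leaves (blank H) t). matches f ?n w (fst x)" if "w \<in> W - ?A" for w
      using tree_ok_sound[of False True Fs H "blank H" t W f w] ok assms(2) f matches_blank that by force
    then obtain leaf where leaf: "\<And>w. w \<in> W - ?A \<Longrightarrow> leaf w \<in> set (leaves (blank H) t)"
      "\<And>w. w \<in> W - ?A \<Longrightarrow> matches f ?n w (fst (leaf w))" by metis
    have leafpr: "snd (leaf w) < k" "proper_row cs (fst (leaf w)) (snd (leaf w))" if "w \<in> W - ?A" for w
      using lv[of "fst (leaf w)" "snd (leaf w)"] leaf(1)[OF that] by auto
    \<comment> \<open>Vertices of the copy keep their prescribed colours, all others take the colour
      of their leaf. Edges into the copy are covered by \<open>proper_row\<close>, edges between two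
      outside vertices by the listed embeddings.\<close>
    define c where "c w = (if w \<in> ?A then cs ! the_inv_into {..<?n} f w else snd (leaf w))" for w
    have cf: "c (f i) = cs ! i" if "i < ?n" for i
      using that inj by (auto simp: c_def the_inv_into_f_f)
    have out_in: "c w \<noteq> c (f i)" if "w \<in> W - ?A" "i < ?n" "E w (f i)" for w i
    proof
      assume "c w = c (f i)"
      then have "cs ! i = snd (leaf w)" using cf that by (auto simp: c_def)
      moreover have "length (fst (leaf w)) = ?n" using leaf(2)[OF that(1)] unfolding matches_def by blast
      ultimately have "fst (leaf w) ! i = Some False"
        using proper_row_entry[OF leafpr(2)[OF that(1)], of i] that by auto
      then show False using leaf(2)[OF that(1)] that unfolding matches_def by auto
    qed
    have out_out: "c w \<noteq> c w'" if ww: "w \<in> W - ?A" "w' \<in> W - ?A" "E w w'" for w w'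
    proof
      assume "c w = c w'"
      then have "snd (leaf w) = snd (leaf w')" using ww by (auto simp: c_def)
      then have "(fst (leaf w), fst (leaf w')) \<in> set (mono_pairs (leaves (blank H) t)) \<or>
        (fst (leaf w'), fst (leaf w)) \<in> set (mono_pairs (leaves (blank H) t))"
        using mono_pairs_mem[OF leaf(1)[OF ww(1)] leaf(1)[OF ww(2)]] by blast
      \<comment> \<open>The edge \<open>w w'\<close> is read in the direction in which its pair of
        leaves is listed.\<close>
      then obtain x y where xy: "(fst (leaf x), fst (leaf y)) \<in> set (mono_pairs (leaves (blank H) t))"
        "x \<in> W - ?A" "y \<in> W - ?A" "E x y" using ww sym by blast
      from xy(1) obtain m where m: "m < length (mono_pairs (leaves (blank H) t))"
        "mono_pairs (leaves (blank H) t) ! m = (fst (leaf x), fst (leaf y))"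
        by (metis in_set_conv_nth)
      obtain l es where les: "ps ! m = (l, es)" by fastforce
      have "list_all2 (\<lambda>(r, r') (l, es). l < length Fs \<and> embeds (H @ [r, r' @ [Some True]]) [] (Fs ! l) es)
       (mono_pairs (leaves (blank H) t)) ps" using assms(1) Colour by simp
      from list_all2_nthD[OF this m(1)]
      have "l < length Fs" "embeds (H @ [fst (leaf x), fst (leaf y) @ [Some True]]) [] (Fs ! l) es"
        using m(2) les by auto
      moreover have "realizes W (f(?n := x, Suc ?n := y)) (H @ [fst (leaf x), fst (leaf y) @ [Some True]])"
        using realizes_extend2[OF f, of x "fst (leaf x)" y "fst (leaf y)"] xy leaf(2) by blast
      ultimately show False using embeds_occurs assms(2)[of "Fs ! l"] by auto
    qed
    have "colourable E k W"
    proof (rule colourableI[of _ c])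
      show "c u < k" if "u \<in> W" for u
      proof (cases "u \<in> ?A")
        case True
        then show ?thesis using cf cs[OF ok(1) f] by auto
      next
        case False
        then show ?thesis using leafpr that by (auto simp: c_def)
      qed
      show "c u \<noteq> c v" if uv: "u \<in> W" "v \<in> W" "E u v" for u v
      proof (cases "u \<in> ?A"; cases "v \<in> ?A")
        assume "u \<in> ?A" "v \<in> ?A"
        then obtain i j where "i < ?n" "j < ?n" "u = f i" "v = f j" by blast
        then show ?thesis using cf cs(3)[OF ok(1) f] uv by auto
      next
        assume "u \<in> ?A" "v \<notin> ?A"
        then show ?thesis using out_in[of v] uv commute by fastforce
      next
        assume "u \<notin> ?A" "v \<in> ?A"
        then show ?thesis using out_in[of u] uv by blast
      next
        assume "u \<notin> ?A" "v \<notin> ?A"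
        then show ?thesis using out_out uv by blast
      qed
    qed
    then show False using assms(3) unfolding critical_def by blast
  qed
qed

lemma steps_ok_sound:
  assumes "steps_ok k Fs xs" "critical k W" "\<And>F. F \<in> set Fs \<Longrightarrow> \<not> occurs W F" "H \<in> fst ` set xs"
  shows "\<not> occurs W H"
  using assms
proof (induction k Fs xs rule: steps_ok.induct)
  case (2 k' Fs H' s xs)
  have ok: "step_ok k' Fs H' s" "steps_ok k' (Fs @ [H']) xs" using "2.prems"(1) by simp_all
  have H': "\<not> occurs W H'" by (rule step_ok_sound[OF ok(1) "2.prems"(3,2)])
  show ?case
  proof (cases "H = H'")
    case False
    then have "H \<in> fst ` set xs" using "2.prems"(4) by simp
    then show ?thesis using "2.IH"[OF ok(2) "2.prems"(2)] "2.prems"(3) H' by auto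
  qed (use H' in simp)
qed auto

end

section \<open>Named small graphs, and the passage between occurrences and concrete vertices\<close>

definition two_K2 :: pgraph where "two_K2 = graph_of [[], [0], [], [2]]"

definition three_K2 :: pgraph where "three_K2 = graph_of [[], [0], [], [2], [], [4]]"

definition triangle :: pgraph where "triangle = graph_of [[], [0], [0,1]]"

definition K4 :: pgraph where "K4 = graph_of [[], [0], [0,1], [0,1,2]]"

definition C5 :: pgraph where "C5 = graph_of [[], [0], [1], [2], [0,3]]"

lemma length_graph_of [simp]: "length (graph_of Ns) = length Ns"
  by (simp add: graph_of_def)

lemma look_graph_of: "j < i \<Longrightarrow> i < length Ns \<Longrightarrow> look (graph_of Ns) i j = Some (j \<in> set (Ns ! i))"
  by (simp add: look_def row_nth graph_of_def entry_nth)

context sgraph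
begin

fun agrees :: "'a \<Rightarrow> 'a list \<Rightarrow> nat \<Rightarrow> nat list \<Rightarrow> bool" where
  "agrees v [] k N \<longleftrightarrow> True"
| "agrees v (u # us) k N \<longleftrightarrow> (E v u \<longleftrightarrow> k \<in> set N) \<and> agrees v us (Suc k) N"

text \<open>A recursive test on a list of concrete vertices, so that simplification turns the
  occurrence of a fixed small graph into finitely many adjacency goals.\<close>

fun fits :: "'a list \<Rightarrow> 'a list \<Rightarrow> nat list list \<Rightarrow> bool" where
  "fits us [] [] \<longleftrightarrow> True"
| "fits us (v # vs) (N # Ns) \<longleftrightarrow> agrees v us 0 N \<and> fits (us @ [v]) vs Ns"
| "fits us _ _ \<longleftrightarrow> False"

lemma agrees_nth: "agrees v us k N \<Longrightarrow> j < length us \<Longrightarrow> E v (us ! j) \<longleftrightarrow> k + j \<in> set N"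
proof (induction us arbitrary: k j)
  case (Cons u us)
  then show ?case by (cases j) auto
qed simp

lemma fits_nth:
  "fits us vs Ns \<Longrightarrow> length vs = length Ns \<and>
    (\<forall>i<length Ns. \<forall>j<length us + i. E (vs ! i) ((us @ vs) ! j) \<longleftrightarrow> j \<in> set (Ns ! i))"
proof (induction us vs Ns rule: fits.induct)
  case (2 us v vs N Ns)
  have "E ((v # vs) ! i) ((us @ v # vs) ! j) \<longleftrightarrow> j \<in> set ((N # Ns) ! i)"
    if "i < length (N # Ns)" "j < length us + i" for i j
  proof (cases i)
    case 0
    then show ?thesis using 2 that agrees_nth[of v us 0 N j] by (simp add: nth_append)
  next
    case (Suc i')
    then show ?thesis using 2 that by simp
  qed
  then show ?case using 2 by simp
qed auto

lemma fits_realizes: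
  assumes "fits [] vs Ns" "distinct vs" "set vs \<subseteq> W"
  shows "realizes W (nth vs) (graph_of Ns)"
proof (rule realizesI)
  note f = fits_nth[OF assms(1)]
  show "vs ! i \<in> W" if "i < length (graph_of Ns)" for i
    using f that assms(3) nth_mem[of i vs] by auto
  show "inj_on (nth vs) {..<length (graph_of Ns)}"
    using f assms(2) by (auto simp: inj_on_nth)
  show "E (vs ! i) (vs ! j) = b" if "i < length (graph_of Ns)" "j < i" "look (graph_of Ns) i j = Some b" for i j b
    using f that by (simp add: look_graph_of)
qed

lemma occursI: "fits [] vs Ns \<Longrightarrow> distinct vs \<Longrightarrow> set vs \<subseteq> W \<Longrightarrow> occurs W (graph_of Ns)"
  using fits_realizes unfolding occurs_def by blast

lemma occursD:
  assumes "occurs W (graph_of Ns)"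
  obtains f where "\<And>i. i < length Ns \<Longrightarrow> f i \<in> W" "inj_on f {..<length Ns}"
    "\<And>i j. i < length Ns \<Longrightarrow> j < i \<Longrightarrow> E (f i) (f j) \<longleftrightarrow> j \<in> set (Ns ! i)"
proof -
  obtain f where f: "realizes W f (graph_of Ns)" using assms unfolding occurs_def by blast
  show ?thesis
  proof (rule that)
    show "f i \<in> W" if "i < length Ns" for i using f that unfolding realizes_def by auto
    show "inj_on f {..<length Ns}" using f unfolding realizes_def by auto
    show "E (f i) (f j) \<longleftrightarrow> j \<in> set (Ns ! i)" if "i < length Ns" "j < i" for i j
      using f that look_graph_of[OF that(2,1)] unfolding realizes_def by (metis less_trans length_graph_of)
  qed
qed

lemma triangle_freeD:
  assumes "\<not> occurs W triangle" "a \<in> W" "b \<in> W" "c \<in> W" "E a b" "E b c" "E a c"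
  shows False
proof -
  have "occurs W (graph_of [[], [0], [0,1]])"
    by (rule occursI[of "[a, b, c]"]) (use assms irrefl sym in auto)
  then show False using assms(1) by (simp add: triangle_def)
qed

lemma two_K2_freeD:
  assumes "\<not> occurs W two_K2" "a \<in> W" "b \<in> W" "c \<in> W" "d \<in> W" "E a b" "E c d"
    "\<not> E a c" "\<not> E a d" "\<not> E b c" "\<not> E b d"
  shows False
proof -
  have "occurs W (graph_of [[], [0], [], [2]])"
    by (rule occursI[of "[a, b, c, d]"]) (use assms irrefl sym in \<open>auto simp: commute\<close>)
  then show False using assms(1) by (simp add: two_K2_def)
qed

text \<open>The graphs excluded in turn are the path on four vertices, the path on three vertices
  and the edge. An end of each path is dominated by another vertex of the path, and the vertex
  destroying this leads to a graph excluded before.\<close>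

lemma steps_bipartite_ok:
  "steps_ok 2 [two_K2, triangle, C5] (map (map_prod graph_of id)
    [([[], [0], [0], [1]], Dominated 2 1 (Split 0 (Bad 1 [4,0,2]) (Split 3 (Bad 2 [4,2,0,1,3]) (Bad 0 [4,2,1,3])))),
     ([[], [0], [0]], Dominated 1 2 (Split 0 (Bad 1 [3,0,1]) (Bad 3 [1,0,3,2]))),
     ([[], [0]], Extend [0,1] (Split 0 (Split 1 (Bad 1 [2,0,1]) (Bad 4 [0,2,1])) (Split 1 (Bad 4 [1,2,0]) Isolated)))])"
  unfolding two_K2_def C5_def by code_simp

text \<open>By the certificates a critical subgraph for two colours has no edge, but then it is
  colourable with a single colour.\<close>

lemma bipartite:
  assumes "finite W" "\<not> occurs W two_K2" "\<not> occurs W triangle" "\<not> occurs W C5"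
  shows "colourable E 2 W"
proof (rule ccontr)
  assume "\<not> colourable E 2 W"
  then obtain W' where W': "W' \<subseteq> W" "critical 2 W'" using ex_critical[OF assms(1)] by blast
  have "\<not> occurs W' (graph_of [[], [0]])"
    by (rule steps_ok_sound[OF steps_bipartite_ok W'(2)]) (use assms W'(1) occurs_subset in force)+
  have "\<not> E u v" if "u \<in> W'" "v \<in> W'" for u v
  proof
    assume "E u v"
    have "occurs W' (graph_of [[], [0]])"
      by (rule occursI[of "[u, v]"]) (use \<open>E u v\<close> that irrefl sym in auto)
    then show False using \<open>\<not> occurs W' (graph_of [[], [0]])\<close> by blast
  qed
  then have "colourable E 2 W'" by (intro colourableI[of _ "\<lambda>_. 0"]) auto
  then show False using W'(2) unfolding critical_def by blast
qed

end

section \<open>Triangle-free graphs without three independent edges\<close>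

text \<open>
  The five graphs consist of two disjoint five-cycles \<open>0, \<dots>, 4\<close> and \<open>5, 6, 9, 7, 8\<close>, joined only by edges
  at \<open>8\<close> and \<open>9\<close>, which have no common neighbour on the first cycle.
\<close>

definition steps_3K2 :: "(pgraph \<times> step) list" where
  "steps_3K2 = map (map_prod graph_of id) [
  ([[], [0], [1], [2], [0,3], [], [5], [], [0,5,7], [2,6,7]], Colour [2,1,3,2,1,0,1,3,1,0] (Split 6 (Split 5
  (Bad 0 [10,5,6]) (Split 9 (Bad 0 [10,6,9]) (Col 0))) (Split 4 (Split 0 (Bad 0 [10,0,4]) (Split 3 (Bad 0
  [10,3,4]) (Split 1 (Split 2 (Bad 0 [10,1,2]) (Split 9 (Split 7 (Bad 0 [10,7,9]) (Split 8 (Split 5 (Bad 0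
  [10,5,8]) (Col 2)) (Split 5 (Col 2) (Col 2)))) (Split 5 (Split 8 (Bad 0 [10,5,8]) (Split 7 (Col 2) (Col 2)))
  (Col 2)))) (Split 9 (Split 2 (Bad 0 [10,2,9]) (Split 5 (Split 8 (Bad 0 [10,5,8]) (Split 7 (Bad 0 [10,7,9])
  (Bad 1 [10,4,1,2,7,8]))) (Bad 1 [10,4,1,2,5,6]))) (Col 2))))) (Split 1 (Split 0 (Bad 0 [10,0,1]) (Split 2
  (Bad 0 [10,1,2]) (Split 3 (Split 7 (Split 9 (Bad 0 [10,7,9]) (Split 8 (Bad 0 [10,7,8]) (Bad 1
  [10,3,0,8,6,9]))) (Split 9 (Split 8 (Split 5 (Bad 0 [10,5,8]) (Col 3)) (Split 5 (Col 3) (Col 3))) (Split 8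
  (Split 5 (Bad 0 [10,5,8]) (Col 3)) (Bad 1 [10,3,0,8,6,9])))) (Split 9 (Split 5 (Split 8 (Bad 0 [10,5,8])
  (Split 7 (Bad 0 [10,7,9]) (Bad 1 [10,1,3,4,7,8]))) (Bad 1 [10,1,3,4,5,6])) (Bad 1 [10,1,3,4,6,9]))))) (Split
  2 (Split 3 (Bad 0 [10,2,3]) (Split 9 (Bad 0 [10,2,9]) (Split 8 (Bad 1 [10,8,3,4,6,9]) (Split 0 (Split 5 (Col
  1) (Split 7 (Bad 1 [10,7,3,4,5,6]) (Col 1))) (Split 5 (Col 1) (Bad 1 [10,2,0,4,5,6])))))) (Split 5 (Split 8
  (Bad 0 [10,5,8]) (Split 0 (Split 3 (Col 1) (Col 1)) (Split 9 (Split 7 (Bad 0 [10,7,9]) (Split 3 (Col 3) (Col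
  1))) (Bad 1 [10,5,0,4,2,9])))) (Split 7 (Bad 1 [10,7,1,2,5,6]) (Split 9 (Split 0 (Split 8 (Bad 0 [10,0,8])
  (Split 3 (Col 3) (Bad 1 [10,0,2,3,5,6]))) (Split 3 (Bad 1 [10,3,0,1,5,6]) (Col 3))) (Split 0 (Split 8 (Bad 0
  [10,0,8]) (Split 3 (Col 3) (Bad 1 [10,0,2,3,5,6]))) (Split 3 (Bad 1 [10,3,0,1,5,6]) (Split 8 (Bad 1
  [10,8,3,4,6,9]) (Col 2))))))))))) [(0,[10,11,6]), (0,[10,11,1]), (0,[10,11,1]), (0,[10,11,1]),
  (0,[10,11,1]), (0,[10,11,1]), (0,[10,11,1]), (0,[10,11,4]), (1,[10,11,2,3,5,6]), (0,[10,11,1]),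
  (0,[10,11,1]), (0,[10,11,1]), (0,[10,11,1]), (0,[10,11,1]), (0,[10,11,4]), (1,[10,11,0,8,2,3]),
  (0,[10,11,1]), (0,[10,11,1]), (0,[10,11,1]), (0,[10,11,1]), (0,[10,11,4]), (1,[10,11,0,8,2,3]),
  (0,[10,11,1]), (0,[10,11,1]), (0,[10,11,1]), (0,[10,11,4]), (1,[10,11,0,8,2,3]), (0,[10,11,1]),
  (0,[10,11,1]), (0,[10,11,4]), (1,[10,11,0,8,2,3]), (0,[10,11,1]), (0,[10,11,4]), (1,[10,11,2,3,5,6]),
  (0,[10,11,4]), (1,[10,11,0,1,6,9]), (0,[10,11,1]), (0,[10,11,1]), (0,[10,11,1]), (0,[10,11,1]),
  (0,[10,11,3]), (0,[10,11,3]), (0,[10,11,9]), (0,[10,11,3]), (0,[10,11,1]), (0,[10,11,1]), (0,[10,11,1]),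
  (0,[10,11,3]), (0,[10,11,3]), (0,[10,11,9]), (0,[10,11,3]), (0,[10,11,1]), (0,[10,11,1]), (0,[10,11,3]),
  (0,[10,11,3]), (0,[10,11,9]), (0,[10,11,3]), (0,[10,11,1]), (0,[10,11,3]), (0,[10,11,3]),
  (1,[10,11,0,4,5,6]), (0,[10,11,3]), (0,[10,11,0]), (0,[10,11,0]), (0,[10,11,2]), (0,[10,11,0]),
  (0,[10,11,0]), (0,[10,11,5]), (0,[10,11,0]), (0,[10,11,2]), (0,[10,11,0]), (0,[10,11,0]),
  (1,[10,11,3,4,7,8]), (0,[10,11,2]), (0,[10,11,5]), (0,[10,11,5]), (0,[10,11,5]), (0,[10,11,0]),
  (0,[10,11,0]), (0,[10,11,5]), (0,[10,11,0]), (0,[10,11,5]), (0,[10,11,3]), (0,[10,11,3]), (0,[10,11,9]),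
  (0,[10,11,3]), (0,[10,11,5]), (0,[10,11,0]), (0,[10,11,9]), (0,[10,11,0]), (0,[10,11,9]),
  (1,[10,11,1,2,5,6]), (0,[10,11,0]), (1,[10,11,0,1,5,6])]),
  ([[], [0], [1], [2], [0,3], [], [5], [], [5,7], [0,2,6,7]], Colour [2,3,0,1,0,1,2,1,2,3] (Split 3 (Split 2
  (Bad 0 [10,2,3]) (Split 4 (Bad 0 [10,3,4]) (Col 0))) (Split 8 (Split 5 (Bad 0 [10,5,8]) (Split 7 (Bad 0
  [10,7,8]) (Col 1))) (Split 0 (Split 4 (Bad 0 [10,0,4]) (Split 1 (Bad 0 [10,0,1]) (Split 9 (Bad 0 [10,0,9])
  (Split 2 (Split 7 (Split 5 (Split 6 (Bad 0 [10,5,6]) (Col 3)) (Col 3)) (Split 5 (Bad 1 [10,5,3,4,7,9])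
  (Split 6 (Bad 1 [10,6,3,4,7,8]) (Col 3)))) (Split 7 (Split 5 (Split 6 (Bad 0 [10,5,6]) (Col 3)) (Bad 1
  [10,0,2,3,5,8])) (Bad 1 [10,0,2,3,7,8])))))) (Split 1 (Split 2 (Bad 0 [10,1,2]) (Split 4 (Split 6 (Split 9
  (Bad 0 [10,6,9]) (Split 5 (Bad 0 [10,5,6]) (Bad 1 [10,4,2,9,5,8]))) (Split 9 (Col 2) (Split 5 (Col 2) (Bad 1
  [10,4,2,9,5,8])))) (Split 5 (Split 6 (Bad 0 [10,5,6]) (Split 9 (Split 7 (Bad 0 [10,7,9]) (Bad 1
  [10,1,3,4,7,8])) (Bad 1 [10,1,3,4,6,9]))) (Bad 1 [10,1,3,4,5,8])))) (Split 9 (Split 2 (Bad 0 [10,2,9])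
  (Split 7 (Bad 0 [10,7,9]) (Split 4 (Bad 1 [10,4,1,2,7,8]) (Split 5 (Split 6 (Bad 0 [10,5,6]) (Col 2)) (Bad 1
  [10,9,3,4,5,8]))))) (Split 4 (Split 6 (Split 5 (Bad 0 [10,5,6]) (Split 2 (Split 7 (Col 3) (Bad 1
  [10,6,0,1,7,8])) (Bad 1 [10,4,1,2,5,8]))) (Split 2 (Split 5 (Col 2) (Split 7 (Bad 1 [10,7,0,1,5,6]) (Col
  2))) (Split 5 (Col 2) (Bad 1 [10,4,1,2,5,6])))) (Split 2 (Split 7 (Split 5 (Split 6 (Bad 0 [10,5,6]) (Col
  3)) (Bad 1 [10,2,0,4,5,8])) (Bad 1 [10,2,0,4,7,8])) (Split 7 (Split 5 (Split 6 (Bad 0 [10,5,6]) (Col 3))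
  (Col 3)) (Split 5 (Bad 1 [10,5,3,4,7,9]) (Split 6 (Bad 1 [10,6,0,1,7,8]) (Col 3))))))))))) [(0,[10,11,3]),
  (0,[10,11,8]), (0,[10,11,0]), (0,[10,11,0]), (0,[10,11,0]), (0,[10,11,0]), (0,[10,11,2]), (0,[10,11,2]),
  (0,[10,11,5]), (0,[10,11,7]), (1,[10,11,3,4,6,9]), (0,[10,11,0]), (0,[10,11,0]), (0,[10,11,0]),
  (0,[10,11,2]), (0,[10,11,2]), (0,[10,11,7]), (0,[10,11,7]), (1,[10,11,3,4,5,8]), (0,[10,11,0]),
  (0,[10,11,0]), (0,[10,11,2]), (0,[10,11,2]), (1,[10,11,3,4,6,9]), (1,[10,11,3,4,5,8]), (1,[10,11,3,4,5,6]),
  (0,[10,11,0]), (0,[10,11,7]), (0,[10,11,5]), (0,[10,11,5]), (0,[10,11,7]), (1,[10,11,3,4,6,9]),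
  (0,[10,11,1]), (0,[10,11,1]), (0,[10,11,9]), (0,[10,11,4]), (0,[10,11,4]), (0,[10,11,4]), (0,[10,11,1]),
  (0,[10,11,5]), (0,[10,11,4]), (0,[10,11,4]), (0,[10,11,4]), (0,[10,11,5]), (0,[10,11,5]),
  (1,[10,11,0,1,7,8]), (0,[10,11,5]), (0,[10,11,2]), (0,[10,11,2]), (0,[10,11,7]), (0,[10,11,7]),
  (1,[10,11,0,1,5,8]), (0,[10,11,2]), (0,[10,11,2]), (0,[10,11,4]), (0,[10,11,2]), (0,[10,11,4]),
  (0,[10,11,4]), (0,[10,11,2]), (0,[10,11,5]), (0,[10,11,7]), (1,[10,11,3,4,6,9]), (0,[10,11,5]),
  (0,[10,11,7]), (1,[10,11,3,4,6,9]), (0,[10,11,7]), (1,[10,11,0,1,5,8]), (1,[10,11,0,1,5,6])]),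
  ([[], [0], [1], [2], [0,3], [], [5], [], [0,5,7], [1,3,6,7]], Colour [1,3,0,1,0,1,2,1,2,0] (Split 3 (Split 2
  (Bad 0 [10,2,3]) (Split 4 (Bad 0 [10,3,4]) (Split 9 (Bad 0 [10,3,9]) (Col 0)))) (Split 5 (Split 6 (Bad 0
  [10,5,6]) (Split 8 (Bad 0 [10,5,8]) (Col 2))) (Split 8 (Split 0 (Bad 0 [10,0,8]) (Split 7 (Bad 0 [10,7,8])
  (Col 1))) (Split 1 (Split 0 (Bad 0 [10,0,1]) (Split 2 (Bad 0 [10,1,2]) (Split 4 (Split 9 (Bad 0 [10,1,9])
  (Split 6 (Bad 1 [10,6,0,8,2,3]) (Split 7 (Bad 1 [10,7,2,3,5,6]) (Bad 3 [3,2,1,10,4,5,6,7,8,9])))) (Bad 1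
  [10,1,3,4,5,8])))) (Split 0 (Split 4 (Bad 0 [10,0,4]) (Split 2 (Split 9 (Split 6 (Bad 0 [10,6,9]) (Split 7
  (Bad 0 [10,7,9]) (Col 3))) (Split 6 (Split 7 (Col 3) (Bad 1 [10,6,3,4,7,8])) (Split 7 (Bad 1 [10,7,3,4,5,6])
  (Bad 2 [3,4,0,10,2,6,5,7,9,8])))) (Split 6 (Split 7 (Bad 3 [10,7,8,5,6,2,1,4,3,0]) (Bad 1 [10,6,1,2,7,8]))
  (Bad 1 [10,0,2,3,5,6])))) (Split 6 (Split 9 (Bad 0 [10,6,9]) (Split 2 (Split 4 (Bad 1 [10,4,1,9,5,8]) (Split
  7 (Bad 2 [10,7,8,5,6,3,4,1,2,0]) (Bad 1 [10,2,0,4,7,9]))) (Bad 1 [10,6,0,8,2,3]))) (Split 7 (Bad 1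
  [10,7,0,1,5,6]) (Split 9 (Split 2 (Col 3) (Split 4 (Bad 1 [10,4,1,2,5,6]) (Col 3))) (Split 2 (Bad 1
  [10,2,0,8,6,9]) (Split 4 (Bad 1 [10,4,1,2,5,6]) (Col 3))))))))))) [(0,[10,11,3]), (0,[10,11,5]),
  (0,[10,11,8]), (0,[10,11,0]), (0,[10,11,0]), (0,[10,11,2]), (0,[10,11,9]), (1,[10,11,3,4,5,6]),
  (0,[10,11,0]), (0,[10,11,2]), (1,[10,11,3,4,5,8]), (1,[10,11,1,9,5,8]), (0,[10,11,2]), (0,[10,11,9]),
  (1,[10,11,0,1,5,6]), (0,[10,11,9]), (1,[10,11,0,1,5,6]), (1,[10,11,0,1,5,6])]),
  ([[], [0], [1], [2], [0,3], [], [5], [], [0,2,5,7], [1,3,6,7]], Colour [1,2,1,2,3,1,0,2,0,1] (Split 5 (Split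
  6 (Bad 0 [10,5,6]) (Split 8 (Bad 0 [10,5,8]) (Col 0))) (Split 1 (Split 0 (Bad 0 [10,0,1]) (Split 2 (Bad 0
  [10,1,2]) (Split 9 (Bad 0 [10,1,9]) (Split 8 (Col 1) (Split 6 (Col 1) (Split 4 (Bad 1 [10,4,2,8,6,9]) (Split
  3 (Split 7 (Bad 1 [10,7,0,4,5,6]) (Bad 4 [0,1,10,3,4,5,6,7,8,9])) (Bad 1 [10,1,3,4,5,6])))))))) (Split 6
  (Split 9 (Bad 0 [10,6,9]) (Split 8 (Split 0 (Bad 0 [10,0,8]) (Split 2 (Bad 0 [10,2,8]) (Col 1))) (Split 4
  (Bad 1 [10,4,1,9,5,8]) (Col 3)))) (Split 3 (Split 9 (Bad 0 [10,3,9]) (Split 2 (Bad 0 [10,2,3]) (Split 0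
  (Split 8 (Bad 0 [10,0,8]) (Split 4 (Bad 0 [10,0,4]) (Col 3))) (Bad 1 [10,3,0,1,5,6])))) (Split 7 (Split 9
  (Bad 0 [10,7,9]) (Split 2 (Split 8 (Bad 0 [10,2,8]) (Split 4 (Bad 1 [10,4,1,9,5,8]) (Bad 1 [10,7,3,4,5,6])))
  (Bad 1 [10,7,1,2,5,6]))) (Split 9 (Split 2 (Split 8 (Bad 0 [10,2,8]) (Split 0 (Split 4 (Bad 0 [10,0,4]) (Col
  2)) (Col 2))) (Col 2)) (Split 2 (Split 8 (Bad 0 [10,2,8]) (Split 4 (Bad 1 [10,4,1,9,5,8]) (Split 0 (Bad 4
  [3,2,10,0,4,6,5,7,9,8]) (Bad 1 [10,2,0,4,5,6])))) (Split 0 (Bad 1 [10,0,2,3,5,6]) (Split 4 (Bad 1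
  [10,4,1,2,5,6]) (Col 2)))))))))) [(0,[10,11,5]), (0,[10,11,1]), (0,[10,11,1]), (0,[10,11,8]), (0,[10,11,1]),
  (0,[10,11,6]), (0,[10,11,6]), (0,[10,11,6]), (1,[10,11,1,9,5,8]), (0,[10,11,0]), (0,[10,11,0]),
  (0,[10,11,2]), (0,[10,11,9]), (1,[10,11,3,4,5,6]), (0,[10,11,2]), (0,[10,11,9]), (1,[10,11,0,1,5,6]),
  (0,[10,11,9]), (1,[10,11,1,2,5,6]), (1,[10,11,0,1,5,6])]),
  ([[], [0], [1], [2], [0,3], [], [5], [], [5,7], [6,7]], Colour [0,2,1,0,1,0,1,2,1,0] (Split 3 (Split 2 (Bad
  0 [10,2,3]) (Split 4 (Bad 0 [10,3,4]) (Split 5 (Split 6 (Bad 0 [10,5,6]) (Split 8 (Bad 0 [10,5,8]) (Split 0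
  (Split 1 (Bad 0 [10,0,1]) (Split 7 (Split 9 (Bad 0 [10,7,9]) (Bad 3 [0,4,3,2,1,6,5,7,9,10])) (Split 9 (Bad 3
  [0,4,3,2,1,8,5,9,7,10]) (Bad 1 [10,5,1,2,7,9])))) (Split 1 (Split 7 (Split 9 (Bad 0 [10,7,9]) (Bad 3
  [1,2,3,4,0,6,5,7,9,10])) (Split 9 (Bad 3 [1,2,3,4,0,8,5,9,7,10]) (Bad 1 [10,5,0,4,7,9]))) (Split 7 (Split 9
  (Bad 0 [10,7,9]) (Bad 1 [10,3,0,1,6,9])) (Bad 1 [10,3,0,1,7,8])))))) (Split 6 (Split 9 (Bad 0 [10,6,9])
  (Split 0 (Split 1 (Bad 0 [10,0,1]) (Split 7 (Split 8 (Bad 0 [10,7,8]) (Bad 3 [0,4,3,2,1,5,6,7,8,10])) (Split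
  8 (Bad 3 [0,4,3,2,1,9,6,8,7,10]) (Bad 1 [10,6,1,2,7,8])))) (Split 1 (Split 7 (Split 8 (Bad 0 [10,7,8]) (Bad
  3 [1,2,3,4,0,5,6,7,8,10])) (Split 8 (Bad 3 [1,2,3,4,0,9,6,8,7,10]) (Bad 1 [10,6,0,4,7,8]))) (Split 7 (Split
  8 (Bad 0 [10,7,8]) (Bad 1 [10,3,0,1,5,8])) (Bad 1 [10,3,0,1,7,9]))))) (Split 8 (Split 7 (Bad 0 [10,7,8])
  (Split 9 (Split 0 (Split 1 (Bad 0 [10,0,1]) (Bad 3 [0,4,3,2,1,5,8,9,6,10])) (Split 1 (Bad 3
  [1,2,3,4,0,5,8,9,6,10]) (Bad 1 [10,3,0,1,5,6]))) (Split 0 (Split 1 (Bad 0 [10,0,1]) (Bad 1 [10,8,1,2,6,9]))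
  (Bad 1 [10,8,0,4,6,9])))) (Split 7 (Split 9 (Bad 0 [10,7,9]) (Split 0 (Split 1 (Bad 0 [10,0,1]) (Bad 1
  [10,7,1,2,5,6])) (Bad 1 [10,7,0,4,5,6]))) (Split 9 (Split 0 (Split 1 (Bad 0 [10,0,1]) (Bad 1
  [10,9,1,2,5,8])) (Bad 1 [10,9,0,4,5,8])) (Split 0 (Split 1 (Bad 0 [10,0,1]) (Col 1)) (Split 1 (Col 1) (Bad 1
  [10,3,0,1,5,6])))))))))) (Split 5 (Split 6 (Bad 0 [10,5,6]) (Split 8 (Bad 0 [10,5,8]) (Split 2 (Split 1 (Bad
  0 [10,1,2]) (Split 0 (Split 4 (Bad 0 [10,0,4]) (Split 7 (Split 9 (Bad 0 [10,7,9]) (Bad 3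
  [0,1,2,3,4,6,5,7,9,10])) (Split 9 (Bad 3 [0,1,2,3,4,8,5,9,7,10]) (Bad 1 [10,5,3,4,7,9])))) (Split 4 (Split 7
  (Split 9 (Bad 0 [10,7,9]) (Bad 3 [2,3,4,0,1,6,5,7,9,10])) (Split 9 (Bad 3 [2,3,4,0,1,8,5,9,7,10]) (Bad 1
  [10,5,0,1,7,9]))) (Split 7 (Split 9 (Bad 0 [10,7,9]) (Bad 1 [10,2,0,4,6,9])) (Bad 1 [10,2,0,4,7,8])))))
  (Split 1 (Split 0 (Bad 0 [10,0,1]) (Split 4 (Split 7 (Split 9 (Bad 0 [10,7,9]) (Bad 3
  [1,0,4,3,2,6,5,7,9,10])) (Split 9 (Bad 3 [1,0,4,3,2,8,5,9,7,10]) (Bad 1 [10,5,2,3,7,9]))) (Split 7 (Split 9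
  (Bad 0 [10,7,9]) (Bad 1 [10,1,3,4,6,9])) (Bad 1 [10,1,3,4,7,8])))) (Split 0 (Split 4 (Bad 0 [10,0,4]) (Split
  7 (Split 9 (Bad 0 [10,7,9]) (Bad 1 [10,0,2,3,6,9])) (Bad 1 [10,0,2,3,7,8]))) (Split 4 (Split 7 (Split 9 (Bad
  0 [10,7,9]) (Bad 1 [10,4,1,2,6,9])) (Bad 1 [10,4,1,2,7,8])) (Split 7 (Split 9 (Bad 0 [10,7,9]) (Col 1)) (Col
  1)))))))) (Split 4 (Split 0 (Bad 0 [10,0,4]) (Split 6 (Split 9 (Bad 0 [10,6,9]) (Split 1 (Split 2 (Bad 0
  [10,1,2]) (Split 7 (Split 8 (Bad 0 [10,7,8]) (Bad 3 [1,0,4,3,2,5,6,7,8,10])) (Split 8 (Bad 3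
  [1,0,4,3,2,9,6,8,7,10]) (Bad 1 [10,6,2,3,7,8])))) (Split 2 (Split 7 (Split 8 (Bad 0 [10,7,8]) (Bad 3
  [2,3,4,0,1,5,6,7,8,10])) (Split 8 (Bad 3 [2,3,4,0,1,9,6,8,7,10]) (Bad 1 [10,6,0,1,7,8]))) (Split 7 (Split 8
  (Bad 0 [10,7,8]) (Bad 1 [10,4,1,2,5,8])) (Bad 1 [10,4,1,2,7,9]))))) (Split 8 (Split 7 (Bad 0 [10,7,8])
  (Split 9 (Split 1 (Split 2 (Bad 0 [10,1,2]) (Bad 3 [1,0,4,3,2,5,8,9,6,10])) (Split 2 (Bad 3
  [2,3,4,0,1,5,8,9,6,10]) (Bad 1 [10,4,1,2,5,6]))) (Split 1 (Split 2 (Bad 0 [10,1,2]) (Bad 1 [10,8,2,3,6,9]))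
  (Bad 1 [10,8,0,1,6,9])))) (Split 7 (Split 9 (Bad 0 [10,7,9]) (Split 1 (Split 2 (Bad 0 [10,1,2]) (Bad 1
  [10,7,2,3,5,6])) (Bad 1 [10,7,0,1,5,6]))) (Split 9 (Split 1 (Split 2 (Bad 0 [10,1,2]) (Bad 1
  [10,9,2,3,5,8])) (Bad 1 [10,9,0,1,5,8])) (Split 1 (Split 2 (Bad 0 [10,1,2]) (Col 0)) (Split 2 (Col 0) (Bad 1
  [10,4,1,2,5,6])))))))) (Split 1 (Split 0 (Bad 0 [10,0,1]) (Split 2 (Bad 0 [10,1,2]) (Split 6 (Split 8 (Split
  7 (Bad 0 [10,7,8]) (Split 9 (Bad 0 [10,6,9]) (Bad 1 [10,1,3,4,7,9]))) (Bad 1 [10,1,3,4,5,8])) (Bad 1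
  [10,1,3,4,5,6])))) (Split 0 (Split 2 (Split 6 (Split 9 (Bad 0 [10,6,9]) (Split 7 (Split 8 (Bad 0 [10,7,8])
  (Bad 3 [0,1,2,3,4,5,6,7,8,10])) (Split 8 (Bad 3 [0,1,2,3,4,9,6,8,7,10]) (Bad 1 [10,6,3,4,7,8])))) (Split 7
  (Bad 1 [10,7,3,4,5,6]) (Col 2))) (Split 6 (Split 8 (Split 7 (Bad 0 [10,7,8]) (Split 9 (Bad 0 [10,6,9]) (Bad
  1 [10,0,2,3,7,9]))) (Bad 1 [10,0,2,3,5,8])) (Bad 1 [10,0,2,3,5,6]))) (Split 2 (Split 6 (Split 8 (Split 7
  (Bad 0 [10,7,8]) (Split 9 (Bad 0 [10,6,9]) (Bad 1 [10,2,0,4,7,9]))) (Bad 1 [10,2,0,4,5,8])) (Bad 1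
  [10,2,0,4,5,6])) (Split 9 (Split 6 (Bad 0 [10,6,9]) (Split 7 (Bad 0 [10,7,9]) (Col 2))) (Split 6 (Split 7
  (Split 8 (Bad 0 [10,7,8]) (Col 0)) (Col 0)) (Split 7 (Bad 1 [10,7,0,1,5,6]) (Split 8 (Bad 1 [10,8,0,1,6,9])
  (Col 0))))))))))) [(0,[10,11,0]), (0,[10,11,3]), (1,[10,11,1,2,6,9]), (1,[10,11,1,2,7,8]), (0,[10,11,1]),
  (1,[10,11,0,4,6,9]), (1,[10,11,0,4,7,8]), (0,[10,11,5]), (0,[10,11,5]), (0,[10,11,5]), (0,[10,11,1]),
  (0,[10,11,4]), (1,[10,11,2,3,5,8]), (1,[10,11,2,3,7,9]), (1,[10,11,2,3,5,6]), (0,[10,11,2]),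
  (1,[10,11,0,1,5,8]), (1,[10,11,0,1,7,9]), (1,[10,11,0,1,5,6]), (0,[10,11,0]), (1,[10,11,3,4,5,6]),
  (0,[10,11,9]), (0,[10,11,6]), (0,[10,11,6]), (1,[10,11,0,1,5,8]), (0,[10,11,6]), (1,[10,11,0,1,7,9]),
  (1,[10,11,0,1,5,6])])]"

lemma steps_3K2_ok: "steps_ok 4 [triangle, three_K2] steps_3K2"
  by code_simp

text \<open>Vertices \<open>0, ..., 4\<close> are a five-cycle and \<open>5, 6, 7, 8\<close> play
  the parts of \<open>x, y, j, s\<close> in \<open>common_neighbour_on_cycle\<close>. The classified
  vertex is \<open>t\<close>, whose adjacencies to the last four are fixed because
  \<open>x, y, t, j, s\<close> form a second five-cycle. Here \<open>s\<close> has no neighbour on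
  the first cycle.\<close>

lemma no_extension_none:
  "tree_ok False False ([triangle, three_K2] @ map fst steps_3K2) (graph_of [[],[0],[1],[2],[0,3],[],[5],[],[5,7]])
   [None,None,None,None,None,Some False,Some True,Some True,Some False]
   (Split 0 (Split 1 (Bad 0 [9,0,1]) (Split 4 (Bad 0 [9,0,4]) (Split 2 (Split 3 (Bad 0 [9,2,3]) (Bad 3
  [0,1,2,3,4,5,6,7,8,9])) (Split 3 (Bad 3 [0,4,3,2,1,5,6,7,8,9]) (Bad 1 [9,0,2,3,5,8]))))) (Split 1 (Split 2
  (Bad 0 [9,1,2]) (Split 3 (Split 4 (Bad 0 [9,3,4]) (Bad 3 [1,2,3,4,0,5,6,7,8,9])) (Split 4 (Bad 3
  [1,0,4,3,2,5,6,7,8,9]) (Bad 1 [9,1,3,4,5,8])))) (Split 3 (Bad 1 [9,3,0,1,5,8]) (Split 2 (Split 4 (Bad 3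
  [2,3,4,0,1,5,6,7,8,9]) (Bad 1 [9,2,0,4,5,8])) (Split 4 (Bad 1 [9,4,1,2,5,8]) (Bad 6
  [9,6,5,8,7,0,1,3,4,2]))))))"
  by code_simp

text \<open>The case in which \<open>s\<close> sees only vertex \<open>0\<close> of the first cycle.
  The entry \<open>Some False\<close> there records that \<open>t\<close> does not share this
  neighbour.\<close>

lemma no_extension_one:
  "tree_ok False False ([triangle, three_K2] @ map fst steps_3K2) (graph_of [[],[0],[1],[2],[0,3],[],[5],[],[0,5,7]])
   [Some False,None,None,None,None,Some False,Some True,Some True,Some False]
   (Split 2 (Split 1 (Bad 0 [9,1,2]) (Split 3 (Bad 0 [9,2,3]) (Split 4 (Bad 4 [0,4,3,2,1,5,6,7,8,9]) (Bad 2
  [9,7,8,5,6,3,4,1,2,0])))) (Split 3 (Split 4 (Bad 0 [9,3,4]) (Split 1 (Bad 4 [0,1,2,3,4,5,6,7,8,9]) (Bad 2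
  [9,7,8,5,6,2,1,4,3,0]))) (Bad 1 [9,6,0,8,2,3])))"
  by code_simp

text \<open>The case in which \<open>s\<close> sees two vertices of the first cycle. As there are no
  triangles they are at distance two, here \<open>0\<close> and \<open>2\<close>, and neither is
  shared by \<open>t\<close>.\<close>

lemma no_extension_two:
  "tree_ok False False ([triangle, three_K2] @ map fst steps_3K2) (graph_of [[],[0],[1],[2],[0,3],[],[5],[],[0,2,5,7]])
   [Some False,None,Some False,None,None,Some False,Some True,Some True,Some False]
   (Split 3 (Split 4 (Bad 0 [9,3,4]) (Split 1 (Bad 5 [3,2,1,0,4,6,5,7,9,8]) (Bad 4 [3,2,1,0,4,6,5,7,9,8])))
  (Split 1 (Split 4 (Bad 5 [4,0,1,2,3,6,5,7,9,8]) (Bad 1 [9,1,3,4,5,8])) (Split 4 (Bad 4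
  [4,0,1,2,3,6,5,7,9,8]) (Bad 3 [0,1,2,3,4,9,7,5,6,8]))))"
  by code_simp

context sgraph
begin

definition five_cycle :: "'a \<Rightarrow> 'a \<Rightarrow> 'a \<Rightarrow> 'a \<Rightarrow> 'a \<Rightarrow> bool" where
  "five_cycle a b c d e \<longleftrightarrow> E a b \<and> E b c \<and> E c d \<and> E d e \<and> E e a \<and>
     \<not> E a c \<and> \<not> E b d \<and> \<not> E c e \<and> \<not> E d a \<and> \<not> E e b"

lemma five_cycle_rotate: "five_cycle a b c d e \<Longrightarrow> five_cycle b c d e a"
  unfolding five_cycle_def by auto

lemma five_cycle_distinct: "five_cycle a b c d e \<Longrightarrow> distinct [a, b, c, d, e]"
  unfolding five_cycle_def using irrefl sym by auto

lemma C5_cycle: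
  assumes "occurs W C5"
  obtains a b c d e where "{a, b, c, d, e} \<subseteq> W" "five_cycle a b c d e"
proof -
  let ?Ns = "[[], [0], [1], [2], [0,3]] :: nat list list"
  obtain f where f: "\<And>i. i < length ?Ns \<Longrightarrow> f i \<in> W" "inj_on f {..<length ?Ns}"
    "\<And>i j. i < length ?Ns \<Longrightarrow> j < i \<Longrightarrow> E (f i) (f j) \<longleftrightarrow> j \<in> set (?Ns ! i)"
    by (rule occursD[OF assms[unfolded C5_def]]) (rule that)
  show ?thesis
  proof (rule that)
    show "{f 0, f 1, f 2, f 3, f 4} \<subseteq> W" using f(1) by auto
    show "five_cycle (f 0) (f 1) (f 2) (f 3) (f 4)"
      unfolding five_cycle_def
      using f(3)[of 1 0] f(3)[of 2 1] f(3)[of 3 2] f(3)[of 4 3] f(3)[of 4 0] f(3)[of 2 0] f(3)[of 3 1]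
        f(3)[of 4 2] f(3)[of 3 0] f(3)[of 4 1]
      by (auto simp: commute)
  qed
qed

text \<open>The five-cycle \<open>x, y, t, j, s\<close> is joined to the given one only at
  \<open>s\<close> and \<open>t\<close>. If these had no common neighbour there, the ten vertices
  would contain a triangle, three independent edges or one of the five excluded graphs.\<close>

lemma common_neighbour_on_cycle:
  assumes crit: "critical 4 W" and tri: "\<not> occurs W triangle" and mat: "\<not> occurs W three_K2"
    and cyc: "five_cycle a b c d e"
    and W: "{a, b, c, d, e, x, y, j, s, t} \<subseteq> W"
    and xyj: "\<forall>v\<in>{a, b, c, d, e}. \<not> E x v \<and> \<not> E y v \<and> \<not> E j v"
    and st: "E x y" "E s x" "\<not> E s y" "E t y" "\<not> E t x" "E j s" "E j t" "\<not> E j x" "\<not> E j y" "\<not> E s t"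
  shows "\<exists>v\<in>{a, b, c, d, e}. E s v \<and> E t v"
proof (rule ccontr)
  assume neg: "\<not> ?thesis"
  let ?Fs = "[triangle, three_K2] @ map fst steps_3K2"
  have Fs: "\<not> occurs W F" if "F \<in> set ?Fs" for F
  proof -
    have "\<not> occurs W F'" if "F' \<in> set [triangle, three_K2]" for F' using that tri mat by auto
    then show ?thesis
      using that steps_ok_sound[OF steps_3K2_ok crit] by auto
  qed
  have noadj: "\<not> (E s u \<and> E s v)" if "E u v" "u \<in> W" "v \<in> W" for u v
    using triangle_freeD[OF tri, of s u v] that W by auto
  have key: False
    if cyc': "five_cycle a' b' c' d' e'" and in': "{a', b', c', d', e'} = {a, b, c, d, e}"
      and ty: "\<not> E s b'" "\<not> E s d'" "\<not> E s e'" and ac: "E s c' \<Longrightarrow> E s a'"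
    for a' b' c' d' e'
  proof -
    have W': "{a', b', c', d', e'} \<subseteq> W" unfolding in' using W by simp
    have neg': "\<forall>v\<in>{a', b', c', d', e'}. \<not> (E s v \<and> E t v)" unfolding in' using neg by blast
    have "\<forall>v\<in>{a', b', c', d', e'}. \<not> E x v \<and> \<not> E y v \<and> \<not> E j v" unfolding in' by (rule xyj)
    then have adj: "\<forall>v\<in>{a', b', c', d', e'}. \<not> E x v \<and> \<not> E y v \<and> \<not> E j v \<and> \<not> E v x \<and> \<not> E v y \<and> \<not> E v j"
      using sym by blast
    have e: "E a' b'" "E b' a'" "E b' c'" "E c' b'" "E c' d'" "E d' c'" "E d' e'" "E e' d'" "E e' a'" "E a' e'"
      "\<not> E a' c'" "\<not> E c' a'" "\<not> E b' d'" "\<not> E d' b'" "\<not> E c' e'" "\<not> E e' c'" "\<not> E d' a'" "\<not> E a' d'"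
      "\<not> E e' b'" "\<not> E b' e'"
      using cyc' sym unfolding five_cycle_def by blast+
    have st': "E y x" "\<not> E x j" "\<not> E y j" "\<not> E y s" "E s j" "\<not> E t s" "E t j" using st sym by blast+
    let ?vs = "[a', b', c', d', e', x, y, j, s]"
    have dist: "distinct ?vs" "t \<notin> set ?vs"
      using five_cycle_distinct[OF cyc'] adj e st st' ty irrefl by auto
    have contra: False
      if "fits [] ?vs Ns" "length Ns = 9" "tree_ok False False ?Fs (graph_of Ns) r T" "matches (nth ?vs) 9 t r" for Ns r T
      using tree_ok_sound[OF that(3) Fs fits_realizes[OF that(1) dist(1), of W], of t] that W' W dist(2)
      by (auto simp: nth_image lessThan_atLeast0)
    consider "\<not> E s a'" | "E s a'" "\<not> E s c'" | "E s a'" "E s c'" by blast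
    then show False
    proof cases
      case 1
      then have "\<not> E s c'" using ac by blast
      show False
        by (rule contra[OF _ _ no_extension_none])
          (use 1 \<open>\<not> E s c'\<close> ty adj e st st' in \<open>auto simp: matches_def less_Suc_eq numeral_eq_Suc\<close>)
    next
      case 2
      then have "\<not> E t a'" using neg' by auto
      show False
        by (rule contra[OF _ _ no_extension_one])
          (use 2 \<open>\<not> E t a'\<close> ty adj e st st' in \<open>auto simp: matches_def less_Suc_eq numeral_eq_Suc\<close>)
    next
      case 3
      then have "\<not> E t a'" "\<not> E t c'" using neg' by auto
      show False
        by (rule contra[OF _ _ no_extension_two])
          (use 3 \<open>\<not> E t a'\<close> \<open>\<not> E t c'\<close> ty adj e st st' in \<open>auto simp: matches_def less_Suc_eq numeral_eq_Suc\<close>)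
    qed
  qed
  note c1 = five_cycle_rotate[OF cyc] note c2 = five_cycle_rotate[OF c1]
  note c3 = five_cycle_rotate[OF c2] note c4 = five_cycle_rotate[OF c3]
  have adj: "E a b" "E b c" "E c d" "E d e" "E e a" using cyc unfolding five_cycle_def by auto
  note na = noadj[OF adj(1)] noadj[OF adj(2)] noadj[OF adj(3)] noadj[OF adj(4)] noadj[OF adj(5)]
  have *: "\<not> (E s a \<and> E s b)" "\<not> (E s b \<and> E s c)" "\<not> (E s c \<and> E s d)" "\<not> (E s d \<and> E s e)" "\<not> (E s e \<and> E s a)"
    using na W by auto
  \<comment> \<open>The neighbours of \<open>s\<close> form a stable set of the five-cycle, so there
    are none, one, or two at distance two. A rotation puts them into the positions of
    \<open>a'\<close> and \<open>c'\<close>, with a single one at \<open>a'\<close>.\<close>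
  have "(\<not> E s b \<and> \<not> E s d \<and> \<not> E s e \<and> (E s c \<longrightarrow> E s a)) \<or> (\<not> E s c \<and> \<not> E s e \<and> \<not> E s a \<and> (E s d \<longrightarrow> E s b)) \<or>
    (\<not> E s d \<and> \<not> E s a \<and> \<not> E s b \<and> (E s e \<longrightarrow> E s c)) \<or> (\<not> E s e \<and> \<not> E s b \<and> \<not> E s c \<and> (E s a \<longrightarrow> E s d)) \<or>
    (\<not> E s a \<and> \<not> E s c \<and> \<not> E s d \<and> (E s b \<longrightarrow> E s e))"
    using * by blast
  then show False
    using key[OF cyc] key[OF c1] key[OF c2] key[OF c3] key[OF c4] by (simp add: insert_commute) blast
qed

text \<open>
  For an edge \<open>xy\<close>, the vertices \<open>R\<close> adjacent to neither end form a blow-up \<open>V0, \<dots>, V4\<close> of a five-cycle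
  and a set \<open>J\<close> of vertices isolated in \<open>R\<close>. The neighbours of \<open>x\<close> meeting \<open>V0\<close> and the neighbours of
  \<open>y\<close> complete to \<open>V0\<close> are moved to the two colours of \<open>V1, \<dots>, V4\<close>, which frees a colour for \<open>V0\<close>;
  the fact \<open>full\<close> then leaves a free colour for each vertex of \<open>J\<close>.
\<close>

lemma colourable_3K2:
  assumes fin: "finite W" and tri: "\<not> occurs W triangle" and mat: "\<not> occurs W three_K2"
  shows "colourable E 4 W"
proof (rule ccontr)
  assume "\<not> colourable E 4 W"
  then obtain U where U: "U \<subseteq> W" and crit: "critical 4 U" using ex_critical[OF fin] by blast
  have finU: "finite U" and tri: "\<not> occurs U triangle" and mat: "\<not> occurs U three_K2"
    using fin tri mat occurs_subset U finite_subset by blast+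
  have ncol: "\<not> colourable E 4 U" using crit unfolding critical_def by blast
  note triD = triangle_freeD[OF tri]
  obtain x y where xy: "x \<in> U" "y \<in> U" "E x y"
  proof -
    have "\<exists>x\<in>U. \<exists>y\<in>U. E x y"
      using ncol colourableI[of U "\<lambda>_. 0" 4 E] by auto
    then show ?thesis using that by blast
  qed
  define S where "S = {s \<in> U. E s x}"
  define T where "T = {t \<in> U. E t y}"
  define R where "R = {r \<in> U. \<not> E r x \<and> \<not> E r y}"
  have RU: "R \<subseteq> U" and SU: "S \<subseteq> U" and TU: "T \<subseteq> U" and U_eq: "U = S \<union> T \<union> R"
    unfolding R_def S_def T_def by auto
  have S_ind: "\<not> E s s'" if "s \<in> S" "s' \<in> S" for s s'
    using triD[of s s' x] that xy unfolding S_def by auto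
  have T_ind: "\<not> E s s'" if "s \<in> T" "s' \<in> T" for s s'
    using triD[of s s' y] that xy unfolding T_def by auto
  have S_notT: "\<not> E s y" if "s \<in> S" for s
    using triD[of s x y] that xy unfolding S_def by auto
  have T_notS: "\<not> E t x" if "t \<in> T" for t
    using triD[of t y x] that xy sym unfolding T_def by auto
  have R_tri: "\<not> occurs R triangle" using tri occurs_subset RU by blast
  have R_2K2: "\<not> occurs R two_K2"
  proof
    assume "occurs R two_K2"
    let ?Ns = "[[], [0], [], [2]] :: nat list list"
    obtain f where f: "\<And>i. i < length ?Ns \<Longrightarrow> f i \<in> R" "inj_on f {..<length ?Ns}"
      "\<And>i j. i < length ?Ns \<Longrightarrow> j < i \<Longrightarrow> E (f i) (f j) \<longleftrightarrow> j \<in> set (?Ns ! i)"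
      by (rule occursD[OF \<open>occurs R two_K2\<close>[unfolded two_K2_def]]) (rule that)
    have fR: "f 0 \<in> R" "f 1 \<in> R" "f 2 \<in> R" "f 3 \<in> R" using f(1) by simp_all
    have fE: "E (f 1) (f 0)" "\<not> E (f 2) (f 0)" "\<not> E (f 2) (f 1)" "E (f 3) (f 2)" "\<not> E (f 3) (f 0)" "\<not> E (f 3) (f 1)"
      using f(3)[of 1 0] f(3)[of 2 0] f(3)[of 2 1] f(3)[of 3 2] f(3)[of 3 0] f(3)[of 3 1] by simp_all
    have "occurs U (graph_of [[], [0], [], [2], [], [4]])"
    proof (rule occursI[of "[x, y, f 0, f 1, f 2, f 3]"])
      show "distinct [x, y, f 0, f 1, f 2, f 3]"
        using fE fR xy irrefl sym unfolding R_def by auto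
    qed (use fE fR xy sym in \<open>auto simp: R_def\<close>)
    then show False using mat by (simp add: three_K2_def)
  qed
  note twoD = two_K2_freeD[OF R_2K2]
  \<comment> \<open>Otherwise \<open>R\<close> is bipartite, and with one colour for each of the
    stable sets \<open>S\<close> and \<open>T\<close> four colours suffice.\<close>
  have "occurs R C5"
  proof (rule ccontr)
    assume "\<not> occurs R C5"
    then have "colourable E 2 R" using bipartite R_tri R_2K2 finU RU finite_subset by blast
    moreover have "colourable E 1 S" "colourable E 1 T"
      using S_ind T_ind by (auto intro!: colourableI[of _ "\<lambda>_. 0"])
    ultimately have "colourable E (1 + 1 + 2) (S \<union> T \<union> R)" by (intro colourable_Un)
    then show False using ncol U_eq by (simp add: numeral_eq_Suc)
  qed
  then obtain a b c d e where cR: "{a, b, c, d, e} \<subseteq> R" and cyc: "five_cycle a b c d e"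
    by (rule C5_cycle)
  define V where "V u v = {w \<in> R. E w u \<and> E w v}" for u v
  have V_comm: "V u v = V v u" for u v unfolding V_def by auto
  have VR: "V u v \<subseteq> R" for u v unfolding V_def by auto
  have triR: False if "u \<in> R" "v \<in> R" "w \<in> R" "E u v" "E v w" "E u w" for u v w
    using triangle_freeD[OF R_tri that] .

  \<comment> \<open>Consecutive classes of the blow-up are completely joined: otherwise
    \<open>ue\<close> and \<open>vc\<close> are independent edges, since \<open>uc\<close> would
    close a triangle with \<open>b\<close> and \<open>ve\<close> one with \<open>a\<close>.\<close>
  have complete: "E u v"
    if "five_cycle a b c d e" "{a, b, c, d, e} \<subseteq> R" "u \<in> V e b" "v \<in> V a c" for a b c d e u v
  proof (rule ccontr)
    assume "\<not> E u v"
    have *: "E u e" "E u b" "E v a" "E v c" "u \<in> R" "v \<in> R" using that unfolding V_def by auto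
    have "\<not> E u c" using triR[of u b c] * that unfolding five_cycle_def by auto
    moreover have "\<not> E v e" using triR[of v a e] * that sym unfolding five_cycle_def by auto
    ultimately show False
      using twoD[of u e v c] * \<open>\<not> E u v\<close> that sym unfolding five_cycle_def by auto
  qed
  have anti: "\<not> E u v" if "b \<in> R" "u \<in> V a b" "v \<in> V b c" for a b c u v
    using triR[of u v b] that sym unfolding V_def by auto
  \<comment> \<open>A neighbour of \<open>a\<close> must see \<open>c\<close> or \<open>d\<close>,
    because the edges \<open>ua\<close> and \<open>cd\<close> are not independent. Rotating this,
    each vertex of \<open>R\<close> with a neighbour on the cycle sees two cycle vertices at
    distance two.\<close>
  have type: "E u c \<and> E u e \<or> E u c \<and> E u a \<or> E u a \<and> E u d \<or> E u b \<and> E u d \<or> E u b \<and> E u e"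
    if "u \<in> R" "E u a \<or> E u b \<or> E u c \<or> E u d \<or> E u e" for u
  proof -
    have one: "E u c \<or> E u d" if cyc: "five_cycle a b c d e" and "{a, b, c, d, e} \<subseteq> R" and "E u a" for a b c d e
    proof (rule ccontr)
      assume "\<not> ?thesis"
      then show False
        using twoD[of u a c d] that \<open>u \<in> R\<close> sym unfolding five_cycle_def by auto
    qed
    show ?thesis
      using that(2) one[OF cyc cR] one[OF five_cycle_rotate[OF cyc]] 
        one[OF five_cycle_rotate[OF five_cycle_rotate[OF cyc]]]
        one[OF five_cycle_rotate[OF five_cycle_rotate[OF five_cycle_rotate[OF cyc]]]]
        one[OF five_cycle_rotate[OF five_cycle_rotate[OF five_cycle_rotate[OF five_cycle_rotate[OF cyc]]]]] cR
      by auto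
  qed
  \<comment> \<open>\<open>V0\<close> collects the vertices that can replace \<open>a\<close> on the
    cycle, namely those seeing its two cycle neighbours \<open>e\<close> and \<open>b\<close>; the
    other classes do the same for \<open>b, c, d, e\<close>.\<close>
  define V0 V1 V2 V3 V4 where Vs: "V0 = V e b" "V1 = V a c" "V2 = V b d" "V3 = V c e" "V4 = V d a"
  define J where "J = {r \<in> R. \<forall>v\<in>{a, b, c, d, e}. \<not> E r v}"
  have R_eq: "R = V0 \<union> V1 \<union> V2 \<union> V3 \<union> V4 \<union> J"
    using type VR unfolding J_def Vs V_def by auto
  note c1 = five_cycle_rotate[OF cyc] note c2 = five_cycle_rotate[OF c1]
  note c3 = five_cycle_rotate[OF c2] note c4 = five_cycle_rotate[OF c3]
  have cR': "{b, c, d, e, a} \<subseteq> R" "{c, d, e, a, b} \<subseteq> R" "{d, e, a, b, c} \<subseteq> R" "{e, a, b, c, d} \<subseteq> R"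
    using cR by auto
  have mem: "a \<in> V0" "b \<in> V1" "c \<in> V2" "d \<in> V3" "e \<in> V4"
    using cR cyc sym unfolding Vs V_def five_cycle_def by auto
  have comp: "\<And>u v. u \<in> V0 \<Longrightarrow> v \<in> V1 \<Longrightarrow> E u v" "\<And>u v. u \<in> V1 \<Longrightarrow> v \<in> V2 \<Longrightarrow> E u v"
    "\<And>u v. u \<in> V2 \<Longrightarrow> v \<in> V3 \<Longrightarrow> E u v" "\<And>u v. u \<in> V3 \<Longrightarrow> v \<in> V4 \<Longrightarrow> E u v"
    "\<And>u v. u \<in> V4 \<Longrightarrow> v \<in> V0 \<Longrightarrow> E u v"
    unfolding Vs using complete[OF cyc cR] complete[OF c1 cR'(1)] complete[OF c2 cR'(2)]
      complete[OF c3 cR'(3)] complete[OF c4 cR'(4)] by blast+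
  have anti2: "\<And>u v. u \<in> V0 \<Longrightarrow> v \<in> V2 \<Longrightarrow> \<not> E u v" "\<And>u v. u \<in> V1 \<Longrightarrow> v \<in> V3 \<Longrightarrow> \<not> E u v"
    "\<And>u v. u \<in> V2 \<Longrightarrow> v \<in> V4 \<Longrightarrow> \<not> E u v" "\<And>u v. u \<in> V3 \<Longrightarrow> v \<in> V0 \<Longrightarrow> \<not> E u v"
    "\<And>u v. u \<in> V4 \<Longrightarrow> v \<in> V1 \<Longrightarrow> \<not> E u v"
    unfolding Vs using anti[of b _ e _ d] anti[of c _ a _ e] anti[of d _ b _ a] anti[of e _ c _ b] anti[of a _ d _ c]
      cR by auto
  have V_ind: "\<not> E u v" if "w \<in> R" "u \<in> V z w" "v \<in> V z w" for u v w z
    using anti[of w u z v z] that V_comm by auto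
  have anti0: "\<And>u v. u \<in> V0 \<Longrightarrow> v \<in> V0 \<Longrightarrow> \<not> E u v" "\<And>u v. u \<in> V1 \<Longrightarrow> v \<in> V1 \<Longrightarrow> \<not> E u v"
    "\<And>u v. u \<in> V2 \<Longrightarrow> v \<in> V2 \<Longrightarrow> \<not> E u v" "\<And>u v. u \<in> V3 \<Longrightarrow> v \<in> V3 \<Longrightarrow> \<not> E u v"
    "\<And>u v. u \<in> V4 \<Longrightarrow> v \<in> V4 \<Longrightarrow> \<not> E u v"
    unfolding Vs using V_ind cR by auto
  have VsU: "V0 \<subseteq> U" "V1 \<subseteq> U" "V2 \<subseteq> U" "V3 \<subseteq> U" "V4 \<subseteq> U" and VsR: "V0 \<subseteq> R" "V1 \<subseteq> R" "V2 \<subseteq> R" "V3 \<subseteq> R" "V4 \<subseteq> R"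
    using VR RU unfolding Vs by blast+
  \<comment> \<open>For \<open>r\<close> in \<open>V0\<close> the edges \<open>jr\<close> and
    \<open>cd\<close> would be independent, since a vertex seeing \<open>b\<close> and
    \<open>e\<close> sees neither \<open>c\<close> nor \<open>d\<close>. The other classes follow by
    rotation.\<close>
  have J_R: "\<not> E j r" if jJ: "j \<in> J" and rR: "r \<in> R" for j r
  proof
    assume jr: "E j r"
    have jR: "j \<in> R" using jJ unfolding J_def by auto
    have gen: False
      if "five_cycle a b c d e" "{a, b, c, d, e} \<subseteq> R" "r \<in> V e b" "\<not> E j c" "\<not> E j d" for a b c d e
    proof -
      have *: "E r e" "E r b" using that unfolding V_def by auto
      have "\<not> E r c" using triR[of r b c] * that \<open>r \<in> R\<close> unfolding five_cycle_def by auto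
      moreover have "\<not> E r d" using triR[of r e d] * that \<open>r \<in> R\<close> sym unfolding five_cycle_def by auto
      ultimately show False using twoD[of j r c d] that jr jR \<open>r \<in> R\<close> unfolding five_cycle_def by auto
    qed
    have jc: "\<not> E j a" "\<not> E j b" "\<not> E j c" "\<not> E j d" "\<not> E j e" using jJ unfolding J_def by auto
    consider "r \<in> V0" | "r \<in> V1" | "r \<in> V2" | "r \<in> V3" | "r \<in> V4" | "r \<in> J" using R_eq rR by blast
    then show False
    proof cases
      case 6
      then show False using twoD[of j r a b] jr jc jR cR cyc unfolding J_def five_cycle_def by auto
    qed (use gen[OF cyc cR] gen[OF c1 cR'(1)] gen[OF c2 cR'(2)] gen[OF c3 cR'(3)] gen[OF c4 cR'(4)] jc in \<open>auto simp: Vs\<close>)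
  qed
  \<comment> \<open>If no class is completely joined to both \<open>s\<close> and \<open>t\<close>,
    picking from each class a vertex missed by one of them gives a five-cycle on which
    \<open>s\<close> and \<open>t\<close> have no common neighbour.\<close>
  have full: "(\<forall>v\<in>V0. E s v \<and> E t v) \<or> (\<forall>v\<in>V1. E s v \<and> E t v) \<or> (\<forall>v\<in>V2. E s v \<and> E t v) \<or>
      (\<forall>v\<in>V3. E s v \<and> E t v) \<or> (\<forall>v\<in>V4. E s v \<and> E t v)"
    if st: "s \<in> S" "t \<in> T" "j \<in> J" "E j s" "E j t" for s t j
  proof (rule ccontr)
    assume "\<not> ?thesis"
    then obtain a' b' c' d' e' where t: "a' \<in> V0" "b' \<in> V1" "c' \<in> V2" "d' \<in> V3" "e' \<in> V4"
      and no: "\<forall>v\<in>{a', b', c', d', e'}. \<not> (E s v \<and> E t v)" by auto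
    have cyc': "five_cycle a' b' c' d' e'"
      unfolding five_cycle_def using comp anti2 t by blast
    have tR: "a' \<in> R" "b' \<in> R" "c' \<in> R" "d' \<in> R" "e' \<in> R" using t VsR by blast+
    have stU: "j \<in> U" "s \<in> U" "t \<in> U" using st SU TU RU unfolding J_def by auto
    have "\<exists>v\<in>{a', b', c', d', e'}. E s v \<and> E t v"
    proof (rule common_neighbour_on_cycle[OF crit tri mat cyc', of x y j s t])
      show "\<forall>v\<in>{a', b', c', d', e'}. \<not> E x v \<and> \<not> E y v \<and> \<not> E j v"
        using tR J_R[OF st(3)] sym unfolding R_def by auto
      show "\<not> E s t" using triD[of s t j] st sym stU by blast
      show "{a', b', c', d', e', x, y, j, s, t} \<subseteq> U"
        using tR RU xy stU by auto
      show "\<not> E j x" "\<not> E j y" using st(3) unfolding J_def R_def by simp_all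
      show "E s x" "E t y" using st(1,2) unfolding S_def T_def by simp_all
      show "\<not> E s y" "\<not> E t x" using st(1,2) S_notT T_notS by simp_all
    qed (rule xy(3) st(4,5))+
    then show False using no by blast
  qed
  \<comment> \<open>The asymmetry between complete for \<open>T'\<close> and meeting for
    \<open>S'\<close> makes \<open>S' \<union> T'\<close> stable: a neighbour in \<open>V0\<close>
    of a vertex of \<open>S'\<close> is adjacent to every vertex of \<open>T'\<close>, so an edge
    between the two would lie in a triangle.\<close>
  define T' where "T' = {t \<in> T. \<forall>v\<in>V0. E t v}"
  define S' where "S' = {s \<in> S. \<exists>v\<in>V0. E s v}"
  define h where "h u \<longleftrightarrow> (\<exists>v\<in>V2. E u v)" for u
  \<comment> \<open>A vertex of \<open>S' \<union> T'\<close> has a neighbour in \<open>V0\<close>,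
    hence none in \<open>V1\<close> or \<open>V4\<close>. If it also has one in \<open>V2\<close>,
    it has none in \<open>V3\<close> and takes colour 3 of \<open>V1\<close> and \<open>V3\<close>;
    if not, it takes colour 2 of \<open>V2\<close> and \<open>V4\<close>.\<close>
  define k where "k u = (if u \<in> V0 \<or> u \<in> S - S' then 0 else if u \<in> T - T' then 1
    else if u \<in> V1 \<or> u \<in> V3 \<or> (u \<in> S' \<union> T' \<and> h u) then 3 else (2::nat))" for u
  have excl: "\<not> E u v'" if "u \<in> U" "E u v" "E v v'" "v \<in> U" "v' \<in> U" for u v v'
    using triD[of u v v'] that by blast
  have "\<exists>i<4. \<forall>u\<in>U. E j u \<longrightarrow> k u \<noteq> i" if j: "j \<in> J" for j
  proof (rule ccontr)
    assume "\<not> ?thesis"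
    then have all: "\<exists>u\<in>U. E j u \<and> k u = i" if "i < 4" for i using that by blast
    have nR: "u \<notin> R" if "E j u" for u using J_R j that by blast
    obtain s1 where "s1 \<in> U" "E j s1" "k s1 = 0" using all[of 0] by auto
    then have s1: "s1 \<in> S" "E j s1" "\<And>v. v \<in> V0 \<Longrightarrow> \<not> E s1 v"
      using nR[of s1] VsR unfolding k_def S'_def by (auto split: if_splits)
    obtain t1 where "t1 \<in> U" "E j t1" "k t1 = 1" using all[of 1] by auto
    then have t1: "t1 \<in> T" "E j t1" "\<not> (\<forall>v\<in>V0. E t1 v)"
      using nR[of t1] unfolding k_def T'_def by (auto split: if_splits)
    obtain u where "u \<in> U" "E j u" "k u = 2" using all[of 2] by auto
    then have u: "u \<in> S' \<union> T'" "u \<in> U" "E j u" "\<not> h u"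
      using nR[of u] U_eq unfolding k_def by (auto split: if_splits)
    obtain u' where "u' \<in> U" "E j u'" "k u' = 3" using all[of 3] by auto
    then have u': "u' \<in> S' \<union> T'" "u' \<in> U" "E j u'" "h u'"
      using nR[of u'] VsR U_eq unfolding k_def by (auto split: if_splits)
    have x0: "\<not> E w b \<and> \<not> E w e" if w: "w \<in> S' \<union> T'" for w
    proof -
      have "w \<in> U" using w SU TU unfolding S'_def T'_def by auto
      moreover obtain v where "v \<in> V0" "E w v" using w mem unfolding S'_def T'_def by auto
      ultimately show ?thesis
        using excl[of w v b] excl[of w v e] comp(1)[of v b] comp(5)[of e v] mem VsU sym by blast
    qed
    have x2: "\<not> E w b \<and> \<not> E w d" if "w \<in> U" "v \<in> V2" "E w v" for w v
      using excl[of w v b] excl[of w v d] comp(2)[of b v] comp(3)[of v d] mem VsU sym that by blast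
    have x3: "\<not> E w c \<and> \<not> E w e" if "w \<in> U" "v \<in> V3" "E w v" for w v
      using excl[of w v c] excl[of w v e] comp(3)[of c v] comp(4)[of v e] mem VsU sym that by blast
    note f = full[OF s1(1) t1(1) j s1(2) t1(2)]
    \<comment> \<open>In \<open>full\<close> for \<open>s1\<close> and \<open>w\<close> only
      \<open>V2\<close> and \<open>V3\<close> are possible: \<open>s1\<close> misses
      \<open>V0\<close>, and \<open>w\<close>, having a neighbour in \<open>V0\<close>, misses
      \<open>b\<close> and \<open>e\<close>. The value of \<open>h w\<close> decides which one it
      is. The next fact is the counterpart for \<open>t1\<close>, which is not complete to
      \<open>V0\<close>.\<close>
    have f_s1: "(\<forall>v\<in>V2. E s1 v) \<and> h w \<or> (\<forall>v\<in>V3. E s1 v) \<and> \<not> h w" if "w \<in> T'" "E j w" for w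
      using full[OF s1(1) _ j s1(2) that(2)] that x0[of w] x2[of w] mem s1(3) TU unfolding T'_def h_def by blast
    have f_t1: "(\<forall>v\<in>V2. E t1 v) \<and> h w \<or> (\<forall>v\<in>V3. E t1 v) \<and> \<not> h w" if "w \<in> S'" "E j w" for w
      using full[OF _ t1(1) j that(2) t1(2)] that x0[of w] x2[of w] mem t1(3) SU unfolding S'_def h_def by blast
    have "s1 \<in> U" "t1 \<in> U" using s1 t1 SU TU by auto
    \<comment> \<open>So \<open>u\<close> makes \<open>s1\<close> or \<open>t1\<close> complete to
      \<open>V3\<close>, and \<open>u'\<close> makes one of them complete to \<open>V2\<close>. It
      cannot be the same vertex, as \<open>cd\<close> is an edge; but if it is one each, no class is
      completely joined to both, contrary to \<open>full\<close>.\<close>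
    show False
      using u u' f f_s1[of u] f_s1[of u'] f_t1[of u] f_t1[of u'] x2[OF \<open>s1 \<in> U\<close>, of c] x2[OF \<open>t1 \<in> U\<close>, of c]
        x3[OF \<open>s1 \<in> U\<close>, of d] x3[OF \<open>t1 \<in> U\<close>, of d] s1(3) t1(3) mem
      by blast
  qed
  then obtain kJ where kJ: "\<And>j. j \<in> J \<Longrightarrow> kJ j < 4" "\<And>j u. j \<in> J \<Longrightarrow> u \<in> U \<Longrightarrow> E j u \<Longrightarrow> k u \<noteq> kJ j" by metis
  have proper: "k u \<noteq> k v" if uv: "u \<in> U - J" "v \<in> U - J" "E u v" for u v
  proof
    assume eq: "k u = k v"
    have V0_nbr: "\<exists>v\<in>V0. E w v" if "w \<in> S' \<union> T'" for w
      using that mem unfolding S'_def T'_def by auto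
    have ST'_U: "S' \<union> T' \<subseteq> U" using SU TU unfolding S'_def T'_def by auto
    have V14: "\<not> E w v \<and> \<not> E v w" if w: "w \<in> S' \<union> T'" and v: "v \<in> V1 \<union> V4" for w v
    proof -
      obtain z where "z \<in> V0" "E w z" using V0_nbr[OF w] by blast
      then have "E z v" using comp(1)[of z v] comp(5)[of v z] v sym by blast
      then show ?thesis using excl[of w z v] \<open>z \<in> V0\<close> \<open>E w z\<close> VsU ST'_U v w sym by blast
    qed
    have V3: "\<not> E w v \<and> \<not> E v w" if w: "w \<in> S' \<union> T'" "h w" and v: "v \<in> V3" for w v
      using excl[of w _ v] comp(3)[of _ v] VsU ST'_U w v sym unfolding h_def by blast
    have V2: "\<not> E w v \<and> \<not> E v w" if w: "\<not> h w" and v: "v \<in> V2" for w v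
      using w v sym unfolding h_def by blast
    have S'T': "\<not> E w w'" if w: "w \<in> S' \<union> T'" "w' \<in> S' \<union> T'" for w w'
    proof -
      have *: "\<not> E s t" if st: "s \<in> S'" "t \<in> T'" for s t
      proof
        assume "E s t"
        obtain v where "v \<in> V0" "E s v" using st(1) unfolding S'_def by blast
        moreover from this have "E t v" using st(2) unfolding T'_def by blast
        ultimately show False
          using triD[of s t v] \<open>E s t\<close> st ST'_U VsU by blast
      qed
      show ?thesis using w *[of w w'] *[of w' w] sym S_ind T_ind unfolding S'_def T'_def by blast
    qed
    have V0S: "\<not> E w v \<and> \<not> E v w" if "w \<in> V0" "v \<in> S - S'" for w v
      using that sym unfolding S'_def by blast
    have k_cases: "k w = 0 \<and> (w \<in> V0 \<or> w \<in> S - S') \<or> k w = 1 \<and> w \<in> T - T' \<or>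
        k w = 3 \<and> (w \<in> V1 \<or> w \<in> V3 \<or> w \<in> S' \<union> T' \<and> h w) \<or>
        k w = 2 \<and> (w \<in> V2 \<or> w \<in> V4 \<or> w \<in> S' \<union> T' \<and> \<not> h w)"
      if "w \<in> U - J" for w
      using that U_eq R_eq unfolding k_def by auto
    consider "u \<in> V0 \<or> u \<in> S - S'" "v \<in> V0 \<or> v \<in> S - S'" | "u \<in> T - T'" "v \<in> T - T'"
      | "u \<in> V1 \<or> u \<in> V3 \<or> u \<in> S' \<union> T' \<and> h u" "v \<in> V1 \<or> v \<in> V3 \<or> v \<in> S' \<union> T' \<and> h v"
      | "u \<in> V2 \<or> u \<in> V4 \<or> u \<in> S' \<union> T' \<and> \<not> h u" "v \<in> V2 \<or> v \<in> V4 \<or> v \<in> S' \<union> T' \<and> \<not> h v"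
      using k_cases[OF uv(1)] k_cases[OF uv(2)] eq by auto
    then show False
    proof cases
      case 1
      then show False using anti0(1) V0S S_ind uv(3) by blast
    next
      case 2
      then show False using T_ind uv(3) by blast
    next
      case 3
      then show False
        using anti0(2,4)[of u v] anti2(2)[of u v] anti2(2)[of v u] V14[of u v] V14[of v u] V3[of u v] V3[of v u]
          S'T'[of u v] uv(3) sym[OF uv(3)] by blast
    next
      case 4
      then show False
        using anti0(3,5)[of u v] anti2(3)[of u v] anti2(3)[of v u] V14[of u v] V14[of v u] V2[of u v] V2[of v u]
          S'T'[of u v] uv(3) sym[OF uv(3)] by blast
    qed
  qed
  have "colourable E 4 U"
  proof (rule colourableI[of _ "\<lambda>u. if u \<in> J then kJ u else k u"])
    show "(if u \<in> J then kJ u else k u) < 4" for u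
      using kJ(1) unfolding k_def by auto
    fix u v assume uv: "u \<in> U" "v \<in> U" "E u v"
    show "(if u \<in> J then kJ u else k u) \<noteq> (if v \<in> J then kJ v else k v)"
    proof (cases "u \<in> J"; cases "v \<in> J")
      assume "u \<in> J" "v \<in> J"
      then show ?thesis using J_R[of u v] uv unfolding J_def by auto
    next
      assume "u \<in> J" "v \<notin> J"
      then show ?thesis using kJ(2)[of u v] uv by auto
    next
      assume "u \<notin> J" "v \<in> J"
      then show ?thesis using kJ(2)[of v u] uv sym by auto
    next
      assume "u \<notin> J" "v \<notin> J"
      then show ?thesis using proper uv by auto
    qed
  qed
  then show False using ncol by blast
qed

end

section \<open>Graphs without two independent edges and without complete subgraphs on four vertices\<close>

text \<open>
  Only three of these graphs matter: the wheel with five spokes, the triangle with an isolated vertex and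
  the five-cycle with an isolated vertex. The others serve to exclude them.
\<close>

definition steps_2K2 :: "(pgraph \<times> step) list" where
  "steps_2K2 = map (map_prod graph_of id) [
  ([[], [0], [1], [2], [0,3], [0,1,2,3,4], [1,2,3,4], [0,3,6], [0,2,5,6,7], [1,2,4,7], [0,2,3,8,9]], Colour
  [0,2,3,2,3,1,0,1,2,0,1] (Split 3 (Split 5 (Split 2 (Bad 1 [11,2,3,5]) (Split 4 (Bad 1 [11,3,4,5]) (Col 3)))
  (Split 0 (Split 7 (Split 4 (Split 6 (Bad 1 [11,3,4,6]) (Split 8 (Bad 1 [11,0,7,8]) (Split 2 (Split 10 (Bad 1
  [11,2,3,10]) (Bad 0 [11,4,8,10])) (Bad 0 [11,0,2,6])))) (Bad 0 [11,7,4,5])) (Split 8 (Split 10 (Bad 1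
  [11,0,8,10]) (Col 1)) (Split 4 (Bad 0 [11,4,7,8]) (Split 10 (Bad 0 [11,10,4,5]) (Split 9 (Bad 0 [11,9,5,8])
  (Split 1 (Bad 0 [11,1,7,8]) (Bad 0 [11,3,1,9]))))))) (Split 1 (Split 6 (Bad 0 [11,6,0,5]) (Split 8 (Split 9
  (Bad 0 [11,9,0,5]) (Split 4 (Split 2 (Split 7 (Split 10 (Bad 1 [11,2,3,10]) (Col 0)) (Bad 0 [11,2,0,7]))
  (Split 7 (Bad 0 [11,7,2,5]) (Split 10 (Bad 0 [11,10,6,7]) (Bad 0 [11,4,2,10])))) (Bad 0 [11,8,4,9]))) (Bad 0
  [11,3,0,8]))) (Bad 0 [11,3,0,1])))) (Split 6 (Split 2 (Split 1 (Bad 1 [11,1,2,6]) (Split 8 (Bad 1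
  [11,2,6,8]) (Col 2))) (Split 0 (Bad 0 [11,0,2,3]) (Split 5 (Split 10 (Split 8 (Split 4 (Split 1 (Split 7
  (Bad 1 [11,6,7,8]) (Bad 0 [11,1,3,7])) (Bad 0 [11,4,1,2])) (Bad 0 [11,8,3,4])) (Split 4 (Bad 0 [11,4,2,8])
  (Split 1 (Bad 0 [11,1,3,4]) (Split 7 (Bad 0 [11,7,1,2]) (Split 9 (Bad 0 [11,9,0,8]) (Bad 0 [11,5,7,9]))))))
  (Bad 0 [11,6,0,10])) (Bad 0 [11,6,0,5])))) (Split 0 (Bad 0 [11,0,3,6]) (Split 9 (Bad 0 [11,9,3,6]) (Split 4
  (Split 7 (Split 1 (Split 10 (Split 2 (Col 0) (Split 5 (Split 8 (Col 0) (Bad 0 [11,4,2,8])) (Bad 0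
  [11,7,2,5]))) (Bad 0 [11,1,3,10])) (Split 2 (Split 5 (Split 10 (Bad 0 [11,10,1,6]) (Bad 0 [11,5,9,10])) (Bad
  0 [11,7,1,5])) (Bad 0 [11,4,1,2]))) (Split 1 (Bad 0 [11,1,3,7]) (Split 2 (Bad 0 [11,2,0,7]) (Bad 0
  [11,4,1,2])))) (Split 1 (Bad 0 [11,1,3,4]) (Split 2 (Bad 0 [11,2,0,4]) (Split 7 (Bad 0 [11,7,1,2]) (Split 5
  (Bad 0 [11,5,6,7]) (Col 0)))))))))) [(1,[11,12,3,5]), (1,[11,12,0,8]), (0,[11,12,0,5]), (1,[11,12,1,2]),
  (1,[11,12,7,8]), (0,[11,12,0,5]), (1,[11,12,2,6]), (0,[11,12,3,6]), (0,[11,12,3,6]), (0,[11,12,3,6]),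
  (0,[11,12,2,3]), (0,[11,12,2,3]), (0,[11,12,0,1])]),
  ([[], [0], [1], [2], [0,3], [0,1,2,3,4], [1,2,3,4], [0,3,6], [0,2,5,6,7], [1,2,4,7], [1,3,5,7,8,9]], Colour
  [0,3,0,2,3,1,1,3,2,2,0] (Split 2 (Split 3 (Split 5 (Bad 1 [11,2,3,5]) (Split 6 (Bad 1 [11,2,3,6]) (Col 1)))
  (Split 8 (Split 5 (Bad 1 [11,2,5,8]) (Split 6 (Bad 1 [11,2,6,8]) (Split 4 (Split 0 (Bad 0 [11,0,3,6]) (Split
  7 (Split 1 (Split 10 (Bad 1 [11,7,8,10]) (Split 9 (Bad 0 [11,9,0,5]) (Bad 2 [7,0,5,2,11,8,1,9,10,4,3])))
  (Bad 0 [11,7,1,5])) (Bad 0 [11,2,0,7]))) (Bad 0 [11,8,3,4])))) (Split 10 (Split 9 (Split 5 (Split 1 (Bad 1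
  [11,1,2,5]) (Split 6 (Split 7 (Bad 1 [11,7,9,10]) (Split 0 (Split 4 (Bad 0 [11,4,7,8]) (Col 3)) (Bad 0
  [11,2,0,7]))) (Bad 0 [11,9,3,6]))) (Bad 0 [11,9,3,5])) (Split 5 (Split 1 (Bad 1 [11,1,2,5]) (Split 7 (Split
  6 (Col 2) (Split 0 (Bad 0 [11,0,3,6]) (Split 4 (Bad 2 [7,11,5,1,9,10,2,6,8,4,0]) (Bad 0 [11,2,0,4])))) (Bad
  0 [11,5,7,9]))) (Split 1 (Split 6 (Bad 1 [11,1,2,6]) (Split 7 (Col 2) (Bad 0 [11,1,3,7]))) (Col 2)))) (Split
  7 (Split 0 (Bad 0 [11,0,3,10]) (Split 4 (Bad 0 [11,4,8,10]) (Bad 0 [11,2,0,4]))) (Bad 0 [11,2,7,10])))))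
  (Split 0 (Split 3 (Split 6 (Split 4 (Bad 1 [11,3,4,6]) (Split 7 (Bad 1 [11,3,6,7]) (Split 9 (Split 1 (Split
  5 (Bad 1 [11,0,1,5]) (Split 10 (Bad 1 [11,1,9,10]) (Bad 0 [11,6,5,10]))) (Split 5 (Col 3) (Split 8 (Split 10
  (Col 3) (Bad 0 [11,6,5,10])) (Bad 0 [11,9,5,8])))) (Bad 0 [11,0,2,9])))) (Bad 0 [11,0,2,6])) (Bad 0
  [11,0,2,3])) (Split 10 (Split 4 (Split 1 (Split 5 (Bad 1 [11,1,5,10]) (Split 6 (Bad 0 [11,6,0,5]) (Bad 0
  [11,10,2,6]))) (Bad 0 [11,4,1,2])) (Bad 0 [11,10,0,4])) (Split 1 (Split 5 (Split 8 (Split 3 (Split 4 (Bad 1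
  [11,3,4,5]) (Col 0)) (Col 0)) (Split 3 (Bad 0 [11,3,0,8]) (Split 4 (Bad 0 [11,4,2,8]) (Bad 0 [11,1,3,4]))))
  (Split 9 (Bad 0 [11,9,0,5]) (Split 7 (Bad 0 [11,7,2,5]) (Split 8 (Split 4 (Bad 0 [11,4,7,10]) (Bad 0
  [11,8,4,9])) (Bad 0 [11,1,7,8]))))) (Split 3 (Bad 0 [11,3,0,1]) (Split 7 (Bad 0 [11,7,1,2]) (Split 4 (Bad 0
  [11,4,1,2]) (Col 0)))))))) [(1,[11,12,2,3]), (0,[11,12,3,4]), (1,[11,12,0,5]), (1,[11,12,9,10]),
  (0,[11,12,1,9]), (1,[11,12,7,10]), (0,[11,12,1,9]), (0,[11,12,3,5]), (0,[11,12,3,5]), (0,[11,12,1,5]),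
  (0,[11,12,1,2]), (0,[11,12,1,2]), (0,[11,12,1,2]), (0,[11,12,0,4]), (1,[11,12,1,5]), (0,[11,12,0,4]),
  (0,[11,12,2,3]), (0,[11,12,2,3]), (0,[11,12,0,1])]),
  ([[], [0], [1], [2], [0,3], [0,1,2,3,4], [1,2,3,4], [0,3,6], [0,2,5,6,7], [1,2,4,7]], Dominated 9 6 (Split 3
  (Split 8 (Split 2 (Split 1 (Bad 1 [10,1,2,9]) (Split 5 (Bad 1 [10,2,3,5]) (Split 7 (Bad 0 [10,7,1,5]) (Split
  0 (Split 4 (Bad 3 [1,6,3,10,9,2,4,0,5,7,8]) (Bad 2 [0,10,2,6,7,8,3,4,5,9,1])) (Bad 0 [10,2,0,7]))))) (Split
  0 (Bad 0 [10,0,2,6]) (Split 1 (Split 5 (Split 4 (Bad 1 [10,3,4,5]) (Split 7 (Bad 3 [0,1,2,3,4,5,6,7,8,9,10])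
  (Bad 0 [10,5,6,7]))) (Bad 0 [10,9,0,5])) (Bad 0 [10,3,0,1])))) (Bad 0 [10,9,6,8])) (Bad 0 [10,9,3,6]))),
  ([[], [0], [1], [2], [0,3], [0,1,2,3,4], [1,2,3,4], [0,3,6], [0,2,5,6,7], [0,1,2,3,4,7]], Colour
  [2,3,0,2,0,1,1,0,3,1] (Split 2 (Split 3 (Split 5 (Bad 1 [10,2,3,5]) (Split 6 (Bad 1 [10,2,3,6]) (Split 9
  (Bad 1 [10,2,3,9]) (Col 1)))) (Split 1 (Split 5 (Bad 1 [10,1,2,5]) (Split 6 (Bad 1 [10,1,2,6]) (Split 4
  (Split 9 (Bad 1 [10,1,2,9]) (Split 0 (Bad 0 [10,0,3,6]) (Split 7 (Split 8 (Bad 0 [10,8,3,9]) (Bad 4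
  [0,1,2,3,4,5,6,7,8,10])) (Bad 0 [10,1,3,7])))) (Bad 0 [10,1,3,4])))) (Split 0 (Split 6 (Split 8 (Bad 1
  [10,2,6,8]) (Col 3)) (Bad 0 [10,0,3,6])) (Split 4 (Split 7 (Split 5 (Col 2) (Bad 0 [10,7,1,5])) (Bad 0
  [10,2,0,7])) (Bad 0 [10,2,0,4]))))) (Split 4 (Split 1 (Split 8 (Split 5 (Split 0 (Bad 1 [10,0,1,5]) (Split 3
  (Bad 1 [10,3,4,5]) (Col 2))) (Split 7 (Bad 0 [10,7,2,5]) (Split 3 (Split 6 (Bad 1 [10,3,4,6]) (Split 0 (Bad
  0 [10,0,2,6]) (Split 9 (Bad 1 [10,3,4,9]) (Bad 4 [0,4,3,2,1,9,6,8,7,10])))) (Bad 0 [10,1,3,7])))) (Bad 0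
  [10,4,2,8])) (Bad 0 [10,4,1,2])) (Split 7 (Split 5 (Split 1 (Split 0 (Bad 1 [10,0,1,5]) (Split 3 (Split 9
  (Bad 1 [10,3,7,9]) (Split 8 (Bad 0 [10,8,4,9]) (Bad 0 [10,3,0,8]))) (Bad 0 [10,1,3,4]))) (Bad 0 [10,7,1,2]))
  (Bad 0 [10,7,2,5])) (Split 3 (Split 6 (Split 9 (Split 0 (Split 1 (Bad 1 [10,0,1,9]) (Split 5 (Col 0) (Col
  0))) (Col 0)) (Split 0 (Split 5 (Bad 0 [10,5,7,9]) (Split 8 (Bad 0 [10,8,4,9]) (Col 0))) (Bad 0
  [10,6,0,9]))) (Split 5 (Bad 0 [10,5,6,7]) (Split 0 (Bad 0 [10,0,2,6]) (Split 8 (Split 9 (Col 0) (Bad 0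
  [10,8,4,9])) (Bad 0 [10,3,0,8]))))) (Split 0 (Bad 0 [10,0,2,3]) (Split 8 (Bad 0 [10,8,3,4]) (Split 1 (Bad 0
  [10,1,3,4]) (Split 5 (Col 0) (Col 0))))))))) [(1,[10,11,2,3]), (1,[10,11,2,6]), (0,[10,11,0,1]),
  (1,[10,11,4,5]), (0,[10,11,2,3]), (0,[10,11,1,2]), (0,[10,11,1,2]), (1,[10,11,3,6]), (1,[10,11,3,6]),
  (1,[10,11,3,9]), (0,[10,11,1,2]), (0,[10,11,1,2]), (0,[10,11,1,2]), (1,[10,11,3,6]), (0,[10,11,2,5]),
  (0,[10,11,2,5]), (0,[10,11,1,2]), (0,[10,11,1,2]), (0,[10,11,0,4]), (1,[10,11,3,6]), (0,[10,11,0,4]),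
  (0,[10,11,0,4]), (0,[10,11,0,4]), (0,[10,11,2,5]), (0,[10,11,2,5]), (0,[10,11,2,8]), (0,[10,11,2,5]),
  (0,[10,11,0,4]), (0,[10,11,0,4]), (0,[10,11,0,4]), (0,[10,11,0,1]), (0,[10,11,0,1]), (0,[10,11,0,1])]),
  ([[], [0], [1], [2], [0,3], [0,1,2,3,4], [1,2,3,4], [0,3,6], [0,2,5,6,7]], Dominated 1 8 (Split 7 (Split 0
  (Split 5 (Bad 1 [9,0,1,5]) (Split 2 (Split 6 (Bad 1 [9,1,2,6]) (Split 3 (Split 4 (Bad 5
  [0,4,3,2,1,9,6,8,7,5]) (Bad 0 [9,7,4,5])) (Bad 0 [9,0,3,6]))) (Bad 0 [9,7,2,5]))) (Split 3 (Bad 0 [9,3,0,8])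
  (Split 4 (Split 2 (Split 5 (Bad 1 [9,1,2,5]) (Split 6 (Bad 0 [9,6,0,5]) (Bad 4 [0,1,2,3,4,5,6,7,8,9]))) (Bad
  0 [9,4,2,8])) (Bad 0 [9,1,3,4])))) (Bad 0 [9,1,7,8]))),
  ([[], [0], [1], [2], [0,3], [0,1,2,3,4], [1,2,3,4], [0,3,6], [1,3,5,7]], Colour [2,0,2,0,3,1,1,3,2] (Split 0
  (Split 7 (Split 1 (Split 5 (Bad 1 [9,0,1,5]) (Split 2 (Split 6 (Bad 1 [9,1,2,6]) (Split 3 (Split 8 (Bad 1
  [9,3,7,8]) (Bad 6 [7,6,2,5,8,3,1,0,9])) (Bad 0 [9,0,3,6]))) (Bad 0 [9,7,2,5]))) (Split 5 (Split 2 (Split 3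
  (Bad 1 [9,2,3,5]) (Split 6 (Split 4 (Bad 1 [9,0,4,5]) (Bad 6 [0,1,2,3,4,5,6,7,9])) (Bad 0 [9,0,3,6]))) (Bad
  0 [9,7,1,2])) (Bad 0 [9,7,1,5]))) (Split 3 (Split 4 (Split 5 (Bad 1 [9,0,4,5]) (Split 6 (Bad 1 [9,3,4,6])
  (Split 2 (Split 8 (Split 1 (Col 1) (Col 1)) (Bad 0 [9,2,7,8])) (Bad 0 [9,0,2,6])))) (Split 6 (Col 3) (Split
  5 (Bad 0 [9,5,6,7]) (Split 2 (Split 8 (Bad 0 [9,8,4,6]) (Bad 0 [9,2,7,8])) (Bad 0 [9,0,2,6]))))) (Split 6
  (Split 1 (Bad 0 [9,1,3,7]) (Split 2 (Split 8 (Split 5 (Col 0) (Split 4 (Col 0) (Col 0))) (Bad 0 [9,0,3,8]))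
  (Bad 0 [9,0,2,3]))) (Bad 0 [9,0,3,6])))) (Split 1 (Split 5 (Split 2 (Bad 1 [9,1,2,5]) (Split 8 (Bad 1
  [9,1,5,8]) (Col 2))) (Split 6 (Bad 0 [9,6,0,5]) (Split 2 (Split 4 (Split 7 (Split 3 (Col 1) (Col 1)) (Bad 0
  [9,2,0,7])) (Bad 0 [9,2,0,4])) (Split 7 (Bad 0 [9,7,2,5]) (Col 1))))) (Split 3 (Bad 0 [9,3,0,1]) (Split 5
  (Split 2 (Split 4 (Split 8 (Split 7 (Split 6 (Col 0) (Col 0)) (Bad 0 [9,2,0,7])) (Bad 0 [9,4,1,8])) (Bad 0
  [9,2,0,4])) (Split 4 (Bad 0 [9,4,1,2]) (Split 8 (Bad 0 [9,8,0,4]) (Split 7 (Bad 0 [9,7,1,2]) (Col 0)))))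
  (Split 6 (Bad 0 [9,6,0,5]) (Split 7 (Bad 0 [9,7,1,5]) (Col 0))))))) [(0,[9,10,6,7]), (0,[9,10,6,7]),
  (1,[9,10,1,2]), (1,[9,10,1,2]), (0,[9,10,6,7]), (0,[9,10,1,5]), (1,[9,10,2,3]), (4,[1,6,3,9,10,2,4,0,5,7]),
  (0,[9,10,6,7]), (1,[9,10,3,6]), (0,[9,10,3,7]), (0,[9,10,3,7]), (0,[9,10,3,7]), (1,[9,10,2,5]),
  (1,[9,10,2,5]), (0,[9,10,3,7]), (0,[9,10,3,7]), (0,[9,10,1,5]), (0,[9,10,1,5]), (1,[9,10,2,6]),
  (3,[1,8,10,4,0,5,9,6,2,7,3]), (0,[9,10,3,7]), (0,[9,10,1,5]), (0,[9,10,1,5]), (1,[9,10,2,6]),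
  (2,[6,1,5,10,9,2,8,7,3,0,4]), (0,[9,10,3,4]), (0,[9,10,1,5]), (1,[9,10,1,5]), (0,[9,10,0,5]),
  (0,[9,10,0,5]), (0,[9,10,0,5]), (0,[9,10,0,5]), (0,[9,10,0,5]), (0,[9,10,0,5]), (0,[9,10,0,1]),
  (0,[9,10,0,1]), (0,[9,10,0,1]), (0,[9,10,0,1]), (0,[9,10,0,1]), (0,[9,10,0,1]), (0,[9,10,0,1]),
  (0,[9,10,0,1]), (0,[9,10,0,1]), (0,[9,10,0,1])]),
  ([[], [0], [1], [2], [0,3], [0,1,2,3,4], [1,2,3,4], [0,3,6]], Dominated 7 4 (Split 5 (Split 0 (Split 1 (Bad
  1 [8,0,1,5]) (Split 2 (Split 3 (Bad 1 [8,2,3,5]) (Split 6 (Bad 6 [0,1,2,3,4,5,6,7,8]) (Bad 0 [8,0,3,6])))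
  (Bad 0 [8,7,1,2]))) (Split 2 (Bad 0 [8,2,0,4]) (Split 1 (Split 3 (Split 6 (Bad 1 [8,3,6,7]) (Bad 7
  [7,6,2,5,8,3,1,0,4])) (Bad 0 [8,1,3,4])) (Bad 0 [8,7,1,2])))) (Bad 0 [8,7,4,5]))),
  ([[], [0], [1], [2], [0,3], [0,1,2,3,4], [1,2,3,4], [0,2,4,6]], Colour [3,0,1,0,1,2,2,0] (Split 0 (Split 2
  (Split 1 (Split 5 (Bad 1 [8,0,1,5]) (Split 6 (Bad 1 [8,1,2,6]) (Split 3 (Split 4 (Split 7 (Bad 1 [8,0,4,7])
  (Col 2)) (Col 2)) (Bad 0 [8,0,3,6])))) (Split 6 (Split 7 (Bad 1 [8,2,6,7]) (Split 3 (Bad 1 [8,2,3,6]) (Split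
  4 (Split 5 (Bad 1 [8,0,4,5]) (Col 0)) (Col 0)))) (Split 3 (Split 5 (Bad 1 [8,2,3,5]) (Split 7 (Bad 0
  [8,7,1,5]) (Split 4 (Bad 6 [0,8,3,6,7,4,2,1,5]) (Bad 8 [0,7,6,3,5,4,2,8])))) (Bad 0 [8,0,3,6])))) (Split 3
  (Split 6 (Split 4 (Bad 1 [8,3,4,6]) (Split 7 (Split 5 (Split 1 (Bad 1 [8,0,1,5]) (Col 1)) (Split 1 (Col 1)
  (Bad 0 [8,7,1,5]))) (Split 1 (Bad 0 [8,1,4,7]) (Split 5 (Bad 6 [0,8,3,2,1,5,6,7,4]) (Bad 8
  [0,1,2,3,4,5,6,8]))))) (Bad 0 [8,0,2,6])) (Bad 0 [8,0,2,3]))) (Split 4 (Split 5 (Split 3 (Bad 1 [8,3,4,5])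
  (Split 1 (Split 2 (Bad 1 [8,1,2,5]) (Split 6 (Split 7 (Bad 1 [8,4,6,7]) (Col 3)) (Col 3))) (Split 2 (Split 6
  (Split 7 (Bad 1 [8,2,6,7]) (Col 0)) (Split 7 (Col 3) (Bad 0 [8,5,6,7]))) (Bad 0 [8,4,1,2])))) (Split 6 (Bad
  0 [8,6,0,5]) (Split 1 (Split 2 (Col 2) (Split 3 (Col 2) (Split 7 (Bad 0 [8,7,3,5]) (Col 2)))) (Split 2
  (Split 3 (Bad 0 [8,3,0,1]) (Split 7 (Bad 0 [8,7,1,5]) (Col 2))) (Bad 0 [8,4,1,2]))))) (Split 2 (Bad 0
  [8,2,0,4]) (Split 5 (Split 1 (Split 3 (Split 7 (Split 6 (Col 1) (Col 1)) (Bad 0 [8,1,4,7])) (Bad 0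
  [8,1,3,4])) (Split 3 (Bad 0 [8,3,0,1]) (Split 6 (Split 7 (Col 1) (Col 1)) (Split 7 (Col 1) (Bad 0
  [8,5,6,7]))))) (Split 6 (Bad 0 [8,6,0,5]) (Split 1 (Split 3 (Split 7 (Col 3) (Bad 0 [8,1,4,7])) (Bad 0
  [8,1,3,4])) (Split 3 (Bad 0 [8,3,0,1]) (Split 7 (Bad 0 [8,7,1,5]) (Col 0))))))))) [(0,[8,9,6,7]),
  (1,[8,9,0,1]), (1,[8,9,1,2]), (1,[8,9,3,4]), (0,[8,9,6,7]), (0,[8,9,6,7]), (0,[8,9,4,5]), (1,[8,9,1,2]),
  (6,[4,6,2,8,9,3,1,0,5]), (8,[4,3,2,1,0,5,8,9]), (8,[4,0,1,2,3,5,8,9]), (0,[8,9,1,5]), (1,[8,9,2,6]),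
  (1,[8,9,2,6]), (0,[8,9,1,5]), (0,[8,9,3,4]), (1,[8,9,2,6]), (0,[8,9,3,4]), (0,[8,9,1,2]), (1,[8,9,0,7]),
  (1,[8,9,3,5]), (1,[8,9,3,5]), (0,[8,9,1,2]), (0,[8,9,1,2]), (0,[8,9,1,2]), (0,[8,9,2,5]), (1,[8,9,1,6]),
  (5,[5,9,8,6,2,1,7,4,0,3]), (1,[8,9,6,7]), (8,[5,4,7,8,1,0,6,9]), (8,[5,2,6,8,0,1,7,9]), (0,[8,9,0,7]),
  (0,[8,9,2,3]), (1,[8,9,4,5]), (8,[7,0,5,8,6,4,1,9]), (0,[8,9,2,3]), (0,[8,9,3,6]), (0,[8,9,2,6]),
  (0,[8,9,0,1]), (0,[8,9,0,1]), (0,[8,9,0,1]), (8,[1,0,4,8,2,5,7,9]), (0,[8,9,0,5]), (0,[8,9,0,5]),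
  (0,[8,9,0,5]), (0,[8,9,0,5]), (0,[8,9,0,5]), (0,[8,9,0,5]), (0,[8,9,0,5]), (0,[8,9,0,5]), (0,[8,9,0,5]),
  (0,[8,9,0,1]), (0,[8,9,0,4]), (0,[8,9,0,4]), (0,[8,9,0,4]), (0,[8,9,0,4]), (0,[8,9,0,4]), (0,[8,9,0,4]),
  (0,[8,9,0,4]), (0,[8,9,0,4]), (0,[8,9,0,4]), (0,[8,9,0,1]), (0,[8,9,0,1]), (0,[8,9,0,1]), (0,[8,9,0,1]),
  (0,[8,9,0,1]), (0,[8,9,0,1]), (0,[8,9,0,4]), (0,[8,9,0,1])]),
  ([[], [0], [1], [2], [0,3], [0,1,2,3,4], [1,2,3,4]], Dominated 6 5 (Split 0 (Split 2 (Split 1 (Bad 1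
  [7,1,2,6]) (Split 3 (Bad 1 [7,2,3,6]) (Split 4 (Bad 9 [0,7,6,3,5,4,2,1]) (Bad 8 [0,4,3,2,1,5,6,7])))) (Split
  3 (Split 4 (Bad 1 [7,3,4,6]) (Split 1 (Bad 9 [0,7,6,2,5,1,3,4]) (Bad 8 [0,1,2,3,4,5,6,7]))) (Bad 0
  [7,0,2,3]))) (Bad 0 [7,6,0,5]))),
  ([[], [0], [1], [2], [0,3], [0,1,2,3,4], [0,1,2,3,4], [5]], Dominated 6 5 (Split 7 (Split 0 (Split 1 (Bad 1
  [8,0,1,6]) (Split 2 (Split 3 (Bad 1 [8,2,3,6]) (Split 4 (Bad 1 [8,0,4,6]) (Bad 0 [8,7,3,4]))) (Bad 0
  [8,7,1,2]))) (Split 1 (Split 2 (Bad 1 [8,1,2,6]) (Split 3 (Split 4 (Bad 1 [8,3,4,6]) (Bad 0 [8,7,0,4])) (Bad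
  0 [8,7,2,3]))) (Bad 0 [8,7,0,1]))) (Bad 0 [8,6,5,7]))),
  ([[], [0], [1], [2], [0,3], [0,1,2,3,4], [0,1,2,3,4]], Dominated 5 6 (Split 0 (Split 1 (Bad 1 [7,0,1,5])
  (Split 4 (Bad 1 [7,0,4,5]) (Split 2 (Split 3 (Bad 1 [7,2,3,5]) (Bad 10 [7,0,4,3,2,5,6])) (Split 3 (Bad 10
  [7,0,1,2,3,5,6]) (Bad 0 [7,0,2,3]))))) (Split 1 (Split 2 (Bad 1 [7,1,2,5]) (Split 3 (Split 4 (Bad 1
  [7,3,4,5]) (Bad 10 [7,1,0,4,3,5,6])) (Split 4 (Bad 10 [7,1,2,3,4,5,6]) (Bad 0 [7,1,3,4])))) (Split 3 (Bad 0
  [7,3,0,1]) (Split 2 (Split 4 (Bad 10 [7,2,1,0,4,5,6]) (Bad 0 [7,2,0,4])) (Split 4 (Bad 0 [7,4,1,2]) (Bad 11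
  [0,1,2,3,4,5,6,7]))))))),
  ([[], [0], [1], [2], [0,3], [0,1,2,3,4], [1,4,5], [0,2,4]], Colour [2,0,2,3,0,1,2,3] (Split 1 (Split 0
  (Split 5 (Bad 1 [8,0,1,5]) (Split 2 (Split 3 (Split 4 (Bad 12 [0,1,2,3,4,8,5]) (Bad 10 [4,0,1,2,3,5,8]))
  (Split 4 (Bad 10 [3,2,1,0,4,5,8]) (Bad 0 [8,1,3,4]))) (Split 3 (Split 4 (Bad 10 [2,1,0,4,3,5,8]) (Split 7
  (Split 6 (Bad 10 [7,8,1,5,4,0,6]) (Bad 0 [8,7,5,6])) (Bad 0 [8,1,4,7]))) (Bad 0 [8,0,2,3])))) (Split 5
  (Split 2 (Bad 1 [8,1,2,5]) (Split 6 (Bad 1 [8,1,5,6]) (Col 2))) (Split 2 (Split 4 (Split 3 (Bad 10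
  [0,1,2,3,4,5,8]) (Col 1)) (Bad 0 [8,2,0,4])) (Split 3 (Split 7 (Split 6 (Split 4 (Bad 7 [7,8,6,5,0,4,1,2,3])
  (Col 1)) (Bad 0 [8,7,5,6])) (Bad 0 [8,3,0,7])) (Col 1))))) (Split 2 (Split 7 (Split 5 (Split 3 (Bad 1
  [8,2,3,5]) (Split 6 (Split 4 (Bad 1 [8,4,5,6]) (Split 0 (Bad 10 [3,2,8,0,4,5,7]) (Bad 0 [8,2,0,4]))) (Bad 0
  [8,7,1,6]))) (Bad 0 [8,7,1,5])) (Split 3 (Split 5 (Bad 1 [8,2,3,5]) (Split 0 (Split 4 (Bad 10
  [1,0,4,3,2,5,8]) (Split 6 (Col 0) (Bad 0 [8,2,4,6]))) (Bad 0 [8,3,0,1]))) (Split 5 (Split 0 (Split 4 (Bad 1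
  [8,0,4,5]) (Col 0)) (Split 4 (Split 6 (Bad 0 [8,6,0,7]) (Col 3)) (Bad 0 [8,2,0,4]))) (Split 0 (Split 6
  (Split 4 (Col 1) (Col 1)) (Col 3)) (Col 1))))) (Split 4 (Bad 0 [8,4,1,2]) (Split 5 (Split 0 (Split 3 (Col 0)
  (Bad 0 [8,0,2,3])) (Split 3 (Bad 0 [8,3,0,1]) (Split 6 (Bad 0 [8,6,2,3]) (Split 7 (Bad 0 [8,7,1,6]) (Col
  0))))) (Split 7 (Bad 0 [8,7,1,5]) (Col 0)))))) [(1,[8,9,1,5]), (0,[8,9,0,5]), (0,[8,9,0,5]), (0,[8,9,0,5]),
  (0,[8,9,3,5]), (0,[8,9,3,5]), (0,[8,9,0,5]), (0,[8,9,0,4]), (0,[8,9,0,5]), (8,[8,1,5,4,9,6,0,7]),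
  (0,[8,9,4,5]), (0,[8,9,0,5]), (0,[8,9,0,5]), (0,[8,9,3,5]), (0,[8,9,3,5]), (0,[8,9,0,5]), (0,[8,9,1,5]),
  (0,[8,9,4,7]), (10,[1,0,9,3,2,5,8]), (0,[8,9,4,7]), (0,[8,9,1,5]), (0,[8,9,3,4]), (1,[8,9,0,5]),
  (0,[8,9,3,4]), (0,[8,9,4,7]), (0,[8,9,0,1]), (0,[8,9,1,6]), (0,[8,9,1,5]), (0,[8,9,1,5]), (0,[8,9,1,5]),
  (0,[8,9,1,5]), (0,[8,9,1,5]), (0,[8,9,1,5]), (0,[8,9,0,1]), (0,[8,9,1,2]), (0,[8,9,1,2]), (0,[8,9,1,2]),
  (0,[8,9,0,1]), (0,[8,9,1,2]), (0,[8,9,1,2])]),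
  ([[], [0], [1], [2], [0,3], [0,1,2,3,4], [1,4,5]], Dominated 0 6 (Split 2 (Split 4 (Split 5 (Bad 1
  [7,0,4,5]) (Split 1 (Split 3 (Bad 10 [6,1,2,3,4,5,7]) (Bad 10 [3,2,1,0,4,5,7])) (Split 3 (Bad 0 [7,3,1,6])
  (Bad 13 [0,1,2,3,4,5,6,7])))) (Bad 0 [7,2,4,6])) (Split 3 (Split 1 (Split 5 (Bad 1 [7,0,1,5]) (Split 4 (Bad
  10 [2,1,0,4,3,5,7]) (Bad 13 [0,4,3,2,1,5,6,7]))) (Bad 0 [7,3,1,6])) (Bad 0 [7,0,2,3])))),
  ([[], [0], [1], [2], [0,3], [0,1,2,3,4], [0,2,4]], Colour [1,2,0,2,0,3,2] (Split 0 (Split 5 (Split 1 (Bad 1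
  [7,0,1,5]) (Split 4 (Bad 1 [7,0,4,5]) (Split 2 (Split 3 (Bad 1 [7,2,3,5]) (Bad 14 [7,0,4,3,2,5,1])) (Split 3
  (Bad 14 [7,0,1,2,3,5,4]) (Bad 0 [7,0,2,3]))))) (Split 3 (Split 4 (Split 6 (Bad 1 [7,0,4,6]) (Split 2 (Split
  1 (Bad 12 [0,1,2,3,4,7,5]) (Bad 10 [1,0,4,3,2,5,7])) (Split 1 (Bad 10 [2,1,0,4,3,5,7]) (Bad 0 [7,4,1,2]))))
  (Split 1 (Col 3) (Split 6 (Bad 0 [7,6,1,5]) (Split 2 (Col 3) (Col 0))))) (Split 2 (Split 6 (Bad 0 [7,6,3,5])
  (Split 1 (Split 4 (Bad 10 [3,2,1,0,4,5,7]) (Bad 0 [7,1,3,4])) (Col 2))) (Bad 0 [7,0,2,3])))) (Split 4 (Split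
  5 (Split 3 (Bad 1 [7,3,4,5]) (Split 1 (Split 2 (Bad 1 [7,1,2,5]) (Bad 14 [7,1,2,3,4,5,0])) (Split 2 (Bad 14
  [7,2,1,0,4,5,3]) (Bad 0 [7,4,1,2])))) (Col 1)) (Split 2 (Bad 0 [7,2,0,4]) (Split 5 (Split 1 (Split 3 (Bad 14
  [7,1,0,4,3,5,2]) (Bad 0 [7,1,3,4])) (Col 0)) (Col 0))))) [(0,[7,8,4,5]), (0,[7,8,4,5]), (0,[7,8,1,5]),
  (0,[7,8,1,2]), (0,[7,8,1,2]), (0,[7,8,2,5]), (0,[7,8,1,5]), (0,[7,8,0,5]), (0,[7,8,0,1]), (0,[7,8,0,4]),
  (0,[7,8,0,4])]),
  ([[], [0], [1], [2], [0,3], [0,1,2,3,4], [1,4]], Dominated 6 0 (Split 5 (Split 2 (Split 1 (Bad 1 [7,1,2,5])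
  (Split 4 (Bad 15 [7,2,1,0,4,5,6]) (Bad 0 [7,2,0,4]))) (Split 3 (Split 1 (Split 4 (Bad 1 [7,3,4,5]) (Bad 13
  [7,3,4,0,1,5,2,6])) (Bad 0 [7,3,0,1])) (Bad 0 [7,6,2,3]))) (Bad 0 [7,6,0,5]))),
  ([[], [0], [1], [2], [0,3], [0,1,2,3,4], [5]], Dominated 6 0 (Split 1 (Split 4 (Split 2 (Split 5 (Bad 1
  [7,1,2,5]) (Split 3 (Bad 10 [0,1,2,3,4,5,7]) (Bad 15 [1,0,4,3,2,5,7]))) (Split 3 (Split 5 (Bad 1 [7,3,4,5])
  (Bad 15 [3,2,1,0,4,5,7])) (Bad 0 [7,6,2,3]))) (Bad 0 [7,6,0,4])) (Bad 0 [7,6,0,1]))),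
  ([[], [0], [1], [2], [0,3], [0,1,2,3,4]], Extend [1,2,1,2,3,0] (Split 0 (Split 1 (Split 5 (Bad 1 [6,0,1,5])
  (Split 2 (Split 3 (Split 4 (Bad 12 [0,1,2,3,4,6,5]) (Bad 10 [4,0,1,2,3,5,6])) (Split 4 (Bad 10
  [3,2,1,0,4,5,6]) (Bad 0 [6,1,3,4]))) (Split 3 (Split 4 (Bad 10 [2,1,0,4,3,5,6]) (Bad 15 [0,4,3,2,1,5,6]))
  (Bad 0 [6,0,2,3])))) (Split 2 (Split 5 (Split 3 (Bad 1 [6,2,3,5]) (Split 4 (Bad 1 [6,0,4,5]) (Bad 14
  [6,0,4,3,2,5,1]))) (Split 3 (Split 4 (Bad 10 [1,0,4,3,2,5,6]) (Bad 15 [2,1,0,4,3,5,6])) (Split 4 (Bad 15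
  [0,1,2,3,4,5,6]) (Bad 16 [1,0,4,3,2,5,6])))) (Split 3 (Split 4 (Bad 0 [6,4,1,2]) (Split 5 (Bad 14
  [6,0,1,2,3,5,4]) (Bad 16 [4,0,1,2,3,5,6]))) (Bad 0 [6,0,2,3])))) (Split 1 (Split 2 (Split 5 (Bad 1
  [6,1,2,5]) (Split 4 (Split 3 (Bad 10 [0,1,2,3,4,5,6]) (Bad 15 [1,0,4,3,2,5,6])) (Bad 0 [6,2,0,4]))) (Split 3
  (Split 5 (Split 4 (Bad 1 [6,3,4,5]) (Bad 14 [6,1,0,4,3,5,2])) (Split 4 (Bad 15 [3,2,1,0,4,5,6]) (Bad 16
  [2,1,0,4,3,5,6]))) (Split 4 (Split 5 (Bad 14 [6,1,2,3,4,5,0]) (Bad 16 [0,1,2,3,4,5,6])) (Bad 0 [6,1,3,4]))))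
  (Split 3 (Bad 0 [6,3,0,1]) (Split 2 (Split 4 (Split 5 (Bad 14 [6,2,1,0,4,5,3]) (Bad 16 [3,2,1,0,4,5,6]))
  (Bad 0 [6,2,0,4])) (Split 4 (Bad 0 [6,4,1,2]) (Split 5 (Bad 17 [0,1,2,3,4,5,6]) (Isolated)))))))),
  ([[], [0], [0,1], [], [0,2,3], [0,1,3], [1,2,3]], Colour [2,0,1,3,0,1,2] (Split 1 (Split 0 (Split 2 (Bad 1
  [7,0,1,2]) (Split 5 (Bad 1 [7,0,1,5]) (Col 1))) (Split 2 (Split 6 (Bad 1 [7,1,2,6]) (Col 2)) (Split 3 (Bad 0
  [7,3,0,2]) (Split 4 (Split 5 (Split 6 (Bad 15 [0,5,7,6,2,1,4]) (Bad 0 [7,5,2,6])) (Split 6 (Bad 0 [7,6,0,5])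
  (Col 3))) (Bad 0 [7,1,3,4]))))) (Split 3 (Split 0 (Split 2 (Split 4 (Bad 1 [7,0,2,4]) (Split 5 (Split 6 (Bad
  10 [3,5,0,2,6,7,1]) (Col 0)) (Split 6 (Col 0) (Col 0)))) (Bad 0 [7,3,1,2])) (Bad 0 [7,3,0,1])) (Split 4
  (Split 5 (Split 6 (Split 0 (Split 2 (Bad 1 [7,0,2,4]) (Bad 15 [2,4,7,5,1,0,6])) (Split 2 (Bad 15
  [0,4,7,6,1,2,5]) (Col 3))) (Bad 0 [7,4,1,6])) (Bad 0 [7,4,1,5])) (Split 0 (Split 6 (Split 2 (Col 0) (Split 5
  (Bad 0 [7,5,2,4]) (Col 3))) (Bad 0 [7,0,3,6])) (Split 6 (Bad 0 [7,6,0,4]) (Split 2 (Col 3) (Split 5 (Bad 0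
  [7,5,2,4]) (Col 0)))))))) [(1,[7,8,0,1]), (1,[7,8,1,2]), (0,[7,8,0,2]), (0,[7,8,0,2]), (0,[7,8,3,5]),
  (0,[7,8,3,6]), (0,[7,8,1,6]), (1,[7,8,0,2]), (0,[7,8,1,6]), (1,[7,8,0,2]), (0,[7,8,1,6]), (0,[7,8,1,5]),
  (0,[7,8,1,5]), (1,[7,8,0,2]), (0,[7,8,1,5]), (0,[7,8,1,5]), (1,[7,8,0,2]), (0,[7,8,1,5]), (0,[7,8,0,1]),
  (0,[7,8,1,2]), (0,[7,8,0,1]), (0,[7,8,3,4]), (0,[7,8,3,4]), (0,[7,8,1,2]), (0,[7,8,3,4]), (0,[7,8,0,1]),
  (0,[7,8,0,1])]),
  ([[], [0], [0,1], [], [0,2,3], [0,1,3], [1,2,3,4]], Colour [0,1,2,3,1,2,0] (Split 0 (Split 1 (Split 2 (Bad 1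
  [7,0,1,2]) (Split 5 (Bad 1 [7,0,1,5]) (Col 2))) (Split 4 (Split 2 (Bad 1 [7,0,2,4]) (Split 5 (Bad 18
  [7,4,2,1,5,0]) (Bad 0 [7,4,1,5]))) (Split 6 (Split 2 (Split 3 (Split 5 (Bad 10 [3,5,0,2,6,7,1]) (Col 1))
  (Col 1)) (Split 3 (Bad 0 [7,3,1,2]) (Split 5 (Bad 0 [7,5,2,4]) (Col 1)))) (Split 3 (Split 2 (Split 5 (Bad 0
  [7,5,4,6]) (Bad 19 [0,1,2,3,7,5,6])) (Bad 0 [7,3,1,2])) (Bad 0 [7,0,3,6]))))) (Split 6 (Split 5 (Split 1
  (Split 2 (Bad 1 [7,1,2,6]) (Bad 18 [7,5,0,2,6,1])) (Split 3 (Bad 0 [7,3,0,1]) (Col 3))) (Bad 0 [7,6,0,5]))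
  (Split 1 (Split 4 (Split 2 (Split 3 (Split 5 (Bad 10 [3,4,2,1,5,7,0]) (Col 0)) (Col 0)) (Split 3 (Bad 0
  [7,3,0,2]) (Split 5 (Bad 0 [7,5,2,6]) (Col 0)))) (Split 3 (Split 2 (Split 5 (Bad 0 [7,5,4,6]) (Bad 19
  [1,0,2,3,7,5,4])) (Bad 0 [7,3,0,2])) (Bad 0 [7,1,3,4]))) (Split 3 (Bad 0 [7,3,0,1]) (Split 2 (Split 5 (Split
  4 (Bad 19 [2,6,4,5,7,1,3]) (Bad 0 [7,5,4,6])) (Bad 0 [7,2,3,5])) (Split 5 (Bad 0 [7,5,2,6]) (Col 0)))))))
  [(1,[7,8,0,1]), (0,[7,8,1,5]), (1,[7,8,0,2]), (0,[7,8,1,5]), (0,[7,8,3,4]), (0,[7,8,3,4]), (0,[7,8,1,2]),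
  (0,[7,8,0,1]), (0,[7,8,0,5]), (1,[7,8,1,2]), (0,[7,8,0,5]), (0,[7,8,0,5]), (0,[7,8,3,6]), (0,[7,8,3,6]),
  (0,[7,8,3,6]), (0,[7,8,0,2]), (0,[7,8,0,2]), (0,[7,8,0,1])]),
  ([[], [0], [0,1], [], [0,2,3], [0,1,3]], Dominated 3 0 (Split 1 (Split 2 (Split 4 (Split 5 (Bad 10
  [3,4,2,1,5,6,0]) (Bad 20 [6,4,2,5,1,3,0])) (Split 5 (Bad 20 [6,5,1,4,2,3,0]) (Bad 19 [1,0,2,3,6,5,4]))) (Bad
  0 [6,3,0,2])) (Bad 0 [6,3,0,1]))),
  ([[], [0], [0,1], [], [0,2,3], [0,1,3,4]], Dominated 1 4 (Split 3 (Split 0 (Split 2 (Bad 1 [6,0,1,2]) (Bad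
  21 [0,2,1,3,6,4])) (Split 5 (Bad 18 [6,1,0,4,3,5]) (Bad 21 [5,4,0,6,1,3]))) (Bad 0 [6,1,3,4]))),
  ([[], [0], [0,1], [], [0,2,3]], Dominated 3 2 (Split 0 (Split 1 (Split 4 (Bad 22 [0,2,1,3,5,4]) (Bad 21
  [0,2,1,3,5,4])) (Bad 0 [5,3,1,2])) (Bad 0 [5,3,0,2]))),
  ([[], [0], [0,1], []], Dominated 3 1 (Split 0 (Split 2 (Bad 23 [0,1,2,3,4]) (Bad 0 [4,3,1,2])) (Bad 0
  [4,3,0,1]))),
  ([[], [0], [1], [2], [0,3], [], [0,2,3,5]], Colour [2,1,0,2,3,3,1] (Split 1 (Split 3 (Split 2 (Split 6 (Bad
  1 [7,2,3,6]) (Split 0 (Split 4 (Bad 15 [2,1,0,4,3,7,6]) (Bad 21 [7,1,2,4,3,0])) (Bad 21 [2,7,3,0,6,1])))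
  (Split 6 (Split 0 (Split 4 (Bad 21 [7,0,4,2,3,1]) (Split 5 (Bad 23 [7,5,6,4,0]) (Bad 23 [7,1,0,5,6])))
  (Split 4 (Split 5 (Col 0) (Bad 23 [7,4,3,5,6])) (Col 0))) (Split 4 (Bad 0 [7,4,2,6]) (Split 5 (Col 0) (Bad 0
  [7,1,5,6]))))) (Split 0 (Bad 24 [7,0,1,3]) (Split 4 (Split 6 (Split 2 (Col 2) (Split 5 (Bad 0 [7,5,2,3])
  (Col 2))) (Bad 0 [7,1,3,6])) (Bad 0 [7,1,3,4])))) (Split 2 (Split 0 (Split 6 (Split 3 (Bad 1 [7,2,3,6])
  (Split 4 (Split 5 (Bad 23 [7,5,6,1,0]) (Bad 23 [7,4,0,5,6])) (Bad 21 [6,7,2,4,3,0]))) (Split 3 (Split 4 (Bad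
  21 [7,3,4,1,0,2]) (Split 5 (Col 1) (Bad 23 [2,7,3,5,6]))) (Split 4 (Split 5 (Col 1) (Bad 0 [7,4,5,6])) (Col
  1)))) (Split 3 (Bad 0 [7,3,0,1]) (Split 4 (Split 5 (Bad 0 [7,5,0,1]) (Col 2)) (Bad 0 [7,2,0,4])))) (Split 4
  (Bad 0 [7,4,1,2]) (Split 5 (Bad 0 [7,5,1,2]) (Col 3))))) [(1,[7,8,3,4]), (1,[7,8,3,6]), (21,[7,8,5,2,6,1]),
  (0,[7,8,0,4]), (23,[7,1,8,4,3]), (0,[7,8,2,6]), (1,[7,8,1,2]), (21,[7,8,1,3,2,4]), (21,[7,8,2,0,1,4]),
  (0,[7,8,2,3]), (24,[7,8,4,5]), (1,[7,8,2,3]), (23,[7,5,8,1,0]), (21,[7,8,2,4,3,0]), (0,[7,8,3,6]),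
  (0,[7,8,3,6]), (0,[7,8,3,4]), (0,[7,8,0,1]), (0,[7,8,1,2])]),
  ([[], [0], [1], [2], [0,3], []], Dominated 5 1 (Split 0 (Split 2 (Split 3 (Split 4 (Bad 21 [6,3,4,1,0,2])
  (Bad 25 [0,1,2,3,4,5,6])) (Split 4 (Bad 25 [2,1,0,4,3,5,6]) (Bad 0 [6,5,3,4]))) (Bad 0 [6,5,1,2])) (Bad 0
  [6,5,0,1])))]"

lemma steps_2K2_ok: "steps_ok 4 [two_K2, K4] steps_2K2"
  by code_simp

lemma steps_2K2_mem: "graph_of [[], [0], [1], [2], [0,3], [0,1,2,3,4]] \<in> fst ` set steps_2K2"
  "graph_of [[], [0], [0,1], []] \<in> fst ` set steps_2K2"
  "graph_of [[], [0], [1], [2], [0,3], []] \<in> fst ` set steps_2K2"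
  by (simp_all add: steps_2K2_def)

context sgraph
begin

text \<open>In a critical counterexample both the neighbours and the non-neighbours of any vertex
  \<open>x\<close> are bipartite. A triangle or five-cycle among the former extends by
  \<open>x\<close> to \<open>K4\<close> or the wheel, and among the latter to a graph with an
  isolated vertex; all four are excluded.\<close>

lemma colourable_2K2_K4:
  assumes fin: "finite W" and m: "\<not> occurs W two_K2" and k: "\<not> occurs W K4"
  shows "colourable E 4 W"
proof (rule ccontr)
  assume "\<not> colourable E 4 W"
  then obtain U where U: "U \<subseteq> W" and crit: "critical 4 U" using ex_critical[OF fin] by blast
  have finU: "finite U" and m: "\<not> occurs U two_K2" and k: "\<not> occurs U K4"
    using fin m k occurs_subset U finite_subset by blast+
  have ncol: "\<not> colourable E 4 U" using crit unfolding critical_def by blast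
  have "\<not> occurs U F" if "F \<in> set [two_K2, K4]" for F
    using that m k by auto
  note closed = steps_ok_sound[OF steps_2K2_ok crit this]
  obtain x where x: "x \<in> U" using ncol colourableI[of U "\<lambda>_. 0" 4 E] by auto
  define N where "N = {u \<in> U. E u x}"
  define M where "M = {u \<in> U. \<not> E u x}"
  have sub: "N \<subseteq> U" "M \<subseteq> U" "U = N \<union> M" unfolding N_def M_def by auto
  have ext: "occurs U (graph_of (Ns @ [[0..<length Ns]]))" if oc: "occurs N (graph_of Ns)" for Ns
  proof -
    obtain f where f: "realizes N f (graph_of Ns)" using oc unfolding occurs_def by blast
    then have fN: "\<And>i. i < length Ns \<Longrightarrow> f i \<in> N" unfolding realizes_def by auto
    have "realizes U (f(length Ns := x)) (graph_of (Ns @ [[0..<length Ns]]))"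
    proof (rule realizesI)
      show "(f(length Ns := x)) i \<in> U" if "i < length (graph_of (Ns @ [[0..<length Ns]]))" for i
        using that fN sub(1) x by (auto simp: less_Suc_eq)
      show "inj_on (f(length Ns := x)) {..<length (graph_of (Ns @ [[0..<length Ns]]))}"
        using f fN irrefl unfolding realizes_def N_def by (auto simp: lessThan_Suc inj_on_def)
      show "E ((f(length Ns := x)) i) ((f(length Ns := x)) j) = b"
        if "i < length (graph_of (Ns @ [[0..<length Ns]]))" "j < i" "look (graph_of (Ns @ [[0..<length Ns]])) i j = Some b" for i j b
      proof (cases "i = length Ns")
        case True
        then show ?thesis using that fN[of j] sym by (auto simp: look_graph_of N_def)
      next
        case False
        then have "look (graph_of Ns) i j = Some b" "i < length Ns"
          using that by (auto simp: look_graph_of nth_append)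
        then show ?thesis using that f False unfolding realizes_def by auto
      qed
    qed
    then show ?thesis unfolding occurs_def by blast
  qed
  \<comment> \<open>Since \<open>x\<close> itself belongs to \<open>M\<close>, the copy has to avoid
    it. The assumption that no vertex of the copy is isolated achieves this, because
    \<open>x\<close> has no neighbour in \<open>M\<close>.\<close>
  have ext': "occurs U (graph_of (Ns @ [[]]))"
    if oc: "occurs M (graph_of Ns)" and nb: "\<And>i. i < length Ns \<Longrightarrow> (\<exists>j<i. j \<in> set (Ns ! i)) \<or> (\<exists>j<length Ns. i < j \<and> i \<in> set (Ns ! j))" for Ns
  proof -
    obtain f where f: "realizes M f (graph_of Ns)" using oc unfolding occurs_def by blast
    then have fM: "\<And>i. i < length Ns \<Longrightarrow> f i \<in> M" unfolding realizes_def by auto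
    have fE: "E (f i) (f j) \<longleftrightarrow> j \<in> set (Ns ! i)" if "i < length Ns" "j < i" for i j
      using f that look_graph_of[OF that(2,1)] unfolding realizes_def by (metis less_trans length_graph_of)
    have fx: "f i \<noteq> x" if i: "i < length Ns" for i
    proof
      assume "f i = x"
      from nb[OF i] obtain j where "j < length Ns" "E (f i) (f j)"
        using fE i sym by (metis less_trans)
      then show False using fM[of j] \<open>f i = x\<close> sym unfolding M_def by auto
    qed
    have "realizes U (f(length Ns := x)) (graph_of (Ns @ [[]]))"
    proof (rule realizesI)
      show "(f(length Ns := x)) i \<in> U" if "i < length (graph_of (Ns @ [[]]))" for i
        using that fM sub(2) x by (auto simp: less_Suc_eq)
      show "inj_on (f(length Ns := x)) {..<length (graph_of (Ns @ [[]]))}"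
        using f fx unfolding realizes_def by (auto simp: lessThan_Suc inj_on_def)
      show "E ((f(length Ns := x)) i) ((f(length Ns := x)) j) = b"
        if "i < length (graph_of (Ns @ [[]]))" "j < i" "look (graph_of (Ns @ [[]])) i j = Some b" for i j b
      proof (cases "i = length Ns")
        case True
        then show ?thesis using that fM[of j] sym by (auto simp: look_graph_of M_def)
      next
        case False
        then have "look (graph_of Ns) i j = Some b" "i < length Ns"
          using that by (auto simp: look_graph_of nth_append)
        then show ?thesis using that f False unfolding realizes_def by auto
      qed
    qed
    then show ?thesis unfolding occurs_def by blast
  qed
  have "colourable E 2 N"
  proof (rule bipartite)
    show "finite N" "\<not> occurs N two_K2" using finU m sub occurs_subset finite_subset by blast+
    show "\<not> occurs N triangle"
    proof
      assume "occurs N triangle"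
      from ext[OF this[unfolded triangle_def]] show False using k by (simp add: K4_def numeral_eq_Suc)
    qed
    show "\<not> occurs N C5"
    proof
      assume "occurs N C5"
      from ext[OF this[unfolded C5_def]] show False using closed[OF _ steps_2K2_mem(1)] by (simp add: numeral_eq_Suc)
    qed
  qed
  moreover have "colourable E 2 M"
  proof (rule bipartite)
    show "finite M" "\<not> occurs M two_K2" using finU m sub occurs_subset finite_subset by blast+
    show "\<not> occurs M triangle"
    proof
      assume "occurs M triangle"
      let ?Ns = "[[], [0], [0,1]] :: nat list list"
      have "(\<exists>j<i. j \<in> set (?Ns ! i)) \<or> (\<exists>j<length ?Ns. i < j \<and> i \<in> set (?Ns ! j))" if "i < length ?Ns" for i
      proof -
        have "i = 0 \<or> i = 1 \<or> i = 2" using that by auto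
        then show ?thesis by (elim disjE) (auto intro: exI[of _ 0] exI[of _ 1])
      qed
      from ext'[OF \<open>occurs M triangle\<close>[unfolded triangle_def] this]
      show False using closed[OF _ steps_2K2_mem(2)] by simp
    qed
    show "\<not> occurs M C5"
    proof
      assume "occurs M C5"
      let ?Ns = "[[], [0], [1], [2], [0,3]] :: nat list list"
      have "(\<exists>j<i. j \<in> set (?Ns ! i)) \<or> (\<exists>j<length ?Ns. i < j \<and> i \<in> set (?Ns ! j))" if "i < length ?Ns" for i
      proof -
        have "i = 0 \<or> i = 1 \<or> i = 2 \<or> i = 3 \<or> i = 4" using that by auto
        then show ?thesis by (elim disjE) (auto intro: exI[of _ 0] exI[of _ 1] exI[of _ 2])
      qed
      from ext'[OF \<open>occurs M C5\<close>[unfolded C5_def] this]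
      show False using closed[OF _ steps_2K2_mem(3)] by simp
    qed
  qed
  ultimately have "colourable E (2 + 2) (N \<union> M)" by (intro colourable_Un)
  then show False using ncol sub(3) by simp
qed

end

section \<open>Cliques, induced matchings and graphs without induced paths on four vertices\<close>

context sgraph
begin

definition is_clique :: "'a set \<Rightarrow> bool" where
  "is_clique K \<longleftrightarrow> (\<forall>u\<in>K. \<forall>v\<in>K. u \<noteq> v \<longrightarrow> E u v)"

definition clique_le :: "nat \<Rightarrow> 'a set \<Rightarrow> bool" where
  "clique_le m W \<longleftrightarrow> (\<forall>K\<subseteq>W. finite K \<longrightarrow> is_clique K \<longrightarrow> card K \<le> m)"

text \<open>An induced copy of \<open>pK2\<close>. The vertices of different edges are distinct
  automatically: \<open>a i = a j\<close>, for instance, would make \<open>a i\<close> adjacent to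
  \<open>b j\<close>. The missing pair \<open>b i\<close>, \<open>a j\<close> is covered by
  exchanging \<open>i\<close> and \<open>j\<close>.\<close>

definition matching :: "nat \<Rightarrow> 'a set \<Rightarrow> bool" where
  "matching p W \<longleftrightarrow> (\<exists>a b :: nat \<Rightarrow> 'a. (\<forall>i<p. a i \<in> W \<and> b i \<in> W \<and> E (a i) (b i)) \<and>
     (\<forall>i<p. \<forall>j<p. i \<noteq> j \<longrightarrow> \<not> E (a i) (a j) \<and> \<not> E (a i) (b j) \<and> \<not> E (b i) (b j)))"

definition path4 :: "'a \<Rightarrow> 'a \<Rightarrow> 'a \<Rightarrow> 'a \<Rightarrow> bool" where
  "path4 a b c d \<longleftrightarrow> E a b \<and> E b c \<and> E c d \<and> \<not> E a c \<and> \<not> E a d \<and> \<not> E b d"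

definition P4_free :: "'a set \<Rightarrow> bool" where
  "P4_free W \<longleftrightarrow> (\<forall>a\<in>W. \<forall>b\<in>W. \<forall>c\<in>W. \<forall>d\<in>W. \<not> path4 a b c d)"

text \<open>The gem is the join of one vertex, here \<open>x\<close>, and a path on four
  vertices.\<close>

definition gem_free :: "'a set \<Rightarrow> bool" where
  "gem_free W \<longleftrightarrow> (\<forall>x\<in>W. P4_free {w \<in> W. E w x})"

definition K2_P4_free :: "'a set \<Rightarrow> bool" where
  "K2_P4_free W \<longleftrightarrow> (\<forall>x\<in>W. \<forall>y\<in>W. E x y \<longrightarrow> P4_free {w \<in> W. E w x \<and> E w y})"

lemma clique_le_subset: "clique_le m W \<Longrightarrow> W' \<subseteq> W \<Longrightarrow> clique_le m W'"
  unfolding clique_le_def by (meson order_trans)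

lemma matching_subset:
  assumes "matching p W'" "W' \<subseteq> W"
  shows "matching p W"
proof -
  obtain a b where "\<forall>i<p. a i \<in> W' \<and> b i \<in> W' \<and> E (a i) (b i)"
    "\<forall>i<p. \<forall>j<p. i \<noteq> j \<longrightarrow> \<not> E (a i) (a j) \<and> \<not> E (a i) (b j) \<and> \<not> E (b i) (b j)"
    using assms(1) unfolding matching_def by (elim exE conjE)
  then show ?thesis unfolding matching_def using assms(2) by (intro exI[of _ a] exI[of _ b]) auto
qed

lemma P4_free_subset: "P4_free W \<Longrightarrow> W' \<subseteq> W \<Longrightarrow> P4_free W'"
  unfolding P4_free_def by (meson subsetD)

lemma gem_free_subset:
  assumes "gem_free W" "W' \<subseteq> W"
  shows "gem_free W'"
  unfolding gem_free_def
proof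
  fix x assume "x \<in> W'"
  then have "P4_free {w \<in> W. E w x}" using assms unfolding gem_free_def by blast
  then show "P4_free {w \<in> W'. E w x}" by (rule P4_free_subset) (use assms in auto)
qed

lemma K2_P4_free_subset:
  assumes "K2_P4_free W" "W' \<subseteq> W"
  shows "K2_P4_free W'"
  unfolding K2_P4_free_def
proof (intro ballI impI)
  fix x y assume "x \<in> W'" "y \<in> W'" "E x y"
  then have "P4_free {w \<in> W. E w x \<and> E w y}" using assms unfolding K2_P4_free_def by blast
  then show "P4_free {w \<in> W'. E w x \<and> E w y}" by (rule P4_free_subset) (use assms in auto)
qed

lemma clique_leD: "clique_le m W \<Longrightarrow> K \<subseteq> W \<Longrightarrow> finite K \<Longrightarrow> is_clique K \<Longrightarrow> card K \<le> m"
  unfolding clique_le_def by simp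

lemma clique_le_0:
  assumes "clique_le 0 W"
  shows "W = {}"
proof (rule ccontr)
  assume "W \<noteq> {}"
  then obtain w where "w \<in> W" by blast
  then have "card {w} \<le> 0" using clique_leD[OF assms, of "{w}"] by (simp add: is_clique_def)
  then show False by simp
qed

lemma clique_le_neighbours:
  assumes "clique_le (Suc m) W" "x \<in> W" "\<And>a. a \<in> A \<Longrightarrow> a \<in> W \<and> E a x"
  shows "clique_le m A"
  unfolding clique_le_def
proof (intro allI impI)
  fix K assume K: "K \<subseteq> A" "finite K" "is_clique K"
  have "x \<notin> K" using K assms(3) irrefl by blast
  moreover have "is_clique (insert x K)"
    using K assms(3) sym unfolding is_clique_def by blast
  moreover have "insert x K \<subseteq> W" using K assms by blast
  ultimately have "card (insert x K) \<le> Suc m" using assms(1) K unfolding clique_le_def by blast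
  then show "card K \<le> m" using K \<open>x \<notin> K\<close> by simp
qed

lemma matching_Suc:
  assumes "matching p A" "A \<subseteq> W" "x \<in> W" "y \<in> W" "E x y" "\<And>a. a \<in> A \<Longrightarrow> \<not> E a x \<and> \<not> E a y"
  shows "matching (Suc p) W"
proof -
  obtain a b where ab: "\<forall>i<p. a i \<in> A \<and> b i \<in> A \<and> E (a i) (b i)"
    "\<forall>i<p. \<forall>j<p. i \<noteq> j \<longrightarrow> \<not> E (a i) (a j) \<and> \<not> E (a i) (b j) \<and> \<not> E (b i) (b j)"
    using assms(1) unfolding matching_def by (elim exE conjE)
  have no: "\<not> E (a i) x" "\<not> E (a i) y" "\<not> E (b i) x" "\<not> E (b i) y" "\<not> E x (a i)" "\<not> E y (a i)" "\<not> E x (b i)" "\<not> E y (b i)"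
    if "i < p" for i using ab(1) assms(6) that sym by blast+
  show ?thesis
    unfolding matching_def
    by (rule exI[of _ "a(p := x)"], rule exI[of _ "b(p := y)"])
      (use ab no assms(2-5) in \<open>auto simp: less_Suc_eq\<close>)
qed

text \<open>Replaces the upper bound \<open>m\<close> by the true clique number, so that a clique of
  that size is at hand.\<close>

lemma clique_le_exact:
  assumes "finite W" "clique_le m W"
  obtains K where "K \<subseteq> W" "is_clique K" "card K \<le> m" "clique_le (card K) W"
proof -
  let ?C = "{K. K \<subseteq> W \<and> is_clique K}"
  have fin: "finite ?C" using assms(1) by simp
  have "{} \<in> ?C" by (simp add: is_clique_def)
  then have "Max (card ` ?C) \<in> card ` ?C" using fin by (intro Max_in) auto
  then obtain K where K: "K \<in> ?C" "Max (card ` ?C) = card K" by auto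
  show ?thesis
  proof (rule that)
    show "K \<subseteq> W" "is_clique K" using K by auto
    then show "card K \<le> m" using assms finite_subset[of K W] unfolding clique_le_def by simp
    show "clique_le (card K) W"
      unfolding clique_le_def
    proof (intro allI impI)
      fix L assume "L \<subseteq> W" "is_clique L"
      then have "card L \<in> card ` ?C" by auto
      from Max_ge[OF finite_imageI[OF fin] this] show "card L \<le> card K" using K(2) by simp
    qed
  qed
qed

text \<open>A maximal stable set \<open>S\<close> meets every clique of size \<open>m + 1\<close>,
  so giving it one colour lowers the clique number of the rest.\<close>

lemma colourable_P4_free:
  assumes "finite W" "P4_free W" "clique_le m W"
  shows "colourable E m W"
  using assms
proof (induction m arbitrary: W)
  case 0
  then have "W = {}" using clique_le_0 by blast
  then show ?case by (simp add: colourable_def)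
next
  case (Suc m)
  let ?I = "{S. S \<subseteq> W \<and> (\<forall>u\<in>S. \<forall>v\<in>S. \<not> E u v)}"
  have "finite ?I" "{} \<in> ?I" using Suc.prems(1) by auto
  then obtain S where S: "S \<in> ?I" "\<And>S'. S' \<in> ?I \<Longrightarrow> S \<subseteq> S' \<Longrightarrow> S = S'"
    using finite_has_maximal2[of ?I "{}"] by auto
  have dom: "\<exists>s\<in>S. E s q" if q: "q \<in> W - S" for q
  proof (rule ccontr)
    assume "\<not> ?thesis"
    then have "insert q S \<in> ?I" using S(1) q irrefl sym by auto
    then show False using S(2)[of "insert q S"] q by blast
  qed
  have "clique_le m (W - S)"
    unfolding clique_le_def
  proof (intro allI impI, rule ccontr)
    fix K assume K: "K \<subseteq> W - S" "finite K" "is_clique K" "\<not> card K \<le> m"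
    then obtain q0 where q0: "q0 \<in> K" by fastforce
    have finS: "finite S" using S(1) Suc.prems(1) finite_subset by blast
    have "S \<noteq> {}" using dom q0 K by blast
    define deg where "deg s = card {q \<in> K. E s q}" for s
    have "Max (deg ` S) \<in> deg ` S" using finS \<open>S \<noteq> {}\<close> by simp
    then obtain s where s: "s \<in> S" "deg s = Max (deg ` S)" by auto
    then have smax: "deg s' \<le> deg s" if "s' \<in> S" for s' using finS that by simp
    \<comment> \<open>The vertex \<open>s\<close> of \<open>S\<close> has the most neighbours in
      \<open>K\<close>. If it missed \<open>q\<close>, maximality of \<open>S\<close> gives
      \<open>s'\<close> in \<open>S\<close> seeing \<open>q\<close>, and the choice of
      \<open>s\<close> gives \<open>q'\<close> in \<open>K\<close> seen by \<open>s\<close> but not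
      by \<open>s'\<close>; then \<open>s, q', q, s'\<close> is an induced path.\<close>
    have "E s q" if q: "q \<in> K" for q
    proof (rule ccontr)
      assume nsq: "\<not> E s q"
      obtain s' where s': "s' \<in> S" "E s' q" using dom q K by blast
      have "\<exists>q'\<in>K. E s q' \<and> \<not> E s' q'"
      proof (rule ccontr)
        assume "\<not> ?thesis"
        then have "{q \<in> K. E s q} \<subset> {q \<in> K. E s' q}" using nsq s' q by blast
        then have "deg s < deg s'" unfolding deg_def using K(2) by (intro psubset_card_mono) auto
        then show False using smax[OF s'(1)] by simp
      qed
      then obtain q' where q': "q' \<in> K" "E s q'" "\<not> E s' q'" by blast
      have "q' \<noteq> q" using q' nsq by auto
      then have "E q' q" using K(3) q q' unfolding is_clique_def by blast
      moreover have "\<not> E s s'" using S(1) s s' by blast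
      ultimately have "path4 s q' q s'" unfolding path4_def using q' nsq s' sym by blast
      then show False using Suc.prems(2) S(1) s s' q q' K unfolding P4_free_def by blast
    qed
    then have "is_clique (insert s K)" using K(3) sym unfolding is_clique_def by blast
    moreover have "insert s K \<subseteq> W" "s \<notin> K" using S(1) s K by auto
    ultimately have "card (insert s K) \<le> Suc m" using Suc.prems(3) K(2) unfolding clique_le_def by blast
    then show False using K \<open>s \<notin> K\<close> by simp
  qed
  then have "colourable E m (W - S)"
    using Suc.IH[of "W - S"] Suc.prems P4_free_subset[of W "W - S"] by blast
  moreover have "colourable E 1 S" using S(1) by (intro colourableI[of _ "\<lambda>_. 0"]) auto
  ultimately have "colourable E (m + 1) ((W - S) \<union> S)" by (rule colourable_Un)
  moreover have "(W - S) \<union> S = W" using S(1) by auto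
  ultimately show ?case by simp
qed

lemma colourable_edgeless:
  assumes "clique_le 1 W"
  shows "colourable E 1 W"
proof (rule colourableI[of _ "\<lambda>_. 0"])
  fix u v assume uv: "u \<in> W" "v \<in> W" "E u v"
  have "u \<noteq> v" using uv irrefl by auto
  moreover have "is_clique {u, v}" using uv sym[OF uv(3)] unfolding is_clique_def by auto
  ultimately have "card {u, v} \<le> 1" using clique_leD[OF assms, of "{u, v}"] uv by simp
  then show "0 \<noteq> (0 :: nat)" using \<open>u \<noteq> v\<close> by simp
qed simp

end

section \<open>Colouring along a maximum clique\<close>

locale max_clique = sgraph +
  fixes W K :: "'a set" and m :: nat
  assumes fin: "finite W" and KW: "K \<subseteq> W" and clK: "is_clique K" and cardK: "card K = m"
    and cl: "clique_le m W" and m2: "\<not> matching 2 W"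
begin

definition non :: "'a \<Rightarrow> 'a set" where
  "non v = {x \<in> K. \<not> E v x}"

lemma finK: "finite K"
  using fin KW finite_subset by blast

lemma non_sub: "non v \<subseteq> K"
  unfolding non_def by auto

lemma fin_non: "finite (non v)"
  using finK non_sub finite_subset by blast

lemma non_K: "v \<in> K \<Longrightarrow> non v = {v}"
  using clK irrefl unfolding non_def is_clique_def by auto

lemma no_2K2:
  assumes "a \<in> W" "b \<in> W" "c \<in> W" "d \<in> W" "E a b" "E c d" "\<not> E a c" "\<not> E a d" "\<not> E b c" "\<not> E b d"
  shows False
proof -
  have "matching 0 {}" by (simp add: matching_def)
  then have "matching 1 {c, d}" using matching_Suc[of 0 "{}" "{c, d}" c d] assms by simp
  moreover have "\<not> E x a \<and> \<not> E x b" if "x \<in> {c, d}" for x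
    using assms that sym by auto
  ultimately have "matching 2 W"
    using matching_Suc[of 1 "{c, d}" W a b] assms by (simp add: numeral_2_eq_2)
  then show False using m2 by blast
qed

lemma non_nonempty:
  assumes "v \<in> W"
  shows "non v \<noteq> {}"
proof
  assume n: "non v = {}"
  then have "v \<notin> K" using non_K by auto
  moreover have "is_clique (insert v K)"
    using n clK sym unfolding non_def is_clique_def by auto
  ultimately show False
    using clique_leD[OF cl, of "insert v K"] assms KW finK cardK by simp
qed

text \<open>Two common non-neighbours of \<open>v\<close> and \<open>w\<close> would form an edge of
  \<open>K\<close> independent of \<open>vw\<close>.\<close>

lemma non_inter:
  assumes "v \<in> W" "w \<in> W" "E v w" "b \<in> non v" "b \<in> non w" "c \<in> non v" "c \<in> non w"
  shows "b = c"
proof (rule ccontr)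
  assume "b \<noteq> c"
  then have "E b c" using assms non_sub clK unfolding is_clique_def by blast
  then show False
    using no_2K2[of v w b c] assms KW unfolding non_def by auto
qed

text \<open>Exchanging \<open>c\<close> for both \<open>v\<close> and \<open>w\<close> would enlarge
  the maximum clique.\<close>

lemma non_singletons:
  assumes "v \<in> W" "w \<in> W" "E v w" "non v = {c}" "non w = {c}"
  shows False
proof -
  have c: "c \<in> K" "\<not> E v c" "\<not> E w c" using assms unfolding non_def by auto
  have adj: "E v x" "E w x" if "x \<in> K - {c}" for x using assms that unfolding non_def by auto
  have vw: "v \<notin> K" "w \<notin> K" "v \<noteq> w"
    using assms non_K[of v] non_K[of w] c sym irrefl by auto
  let ?L = "insert v (insert w (K - {c}))"
  have "is_clique ?L"
    using adj clK assms(3) sym unfolding is_clique_def by auto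
  moreover have "card ?L = Suc m"
    using vw finK c cardK by (simp add: card_Suc_Diff1 del: card_Diff_insert)
  ultimately show False
    using clique_leD[OF cl, of ?L] assms KW finK by auto
qed

text \<open>Since \<open>c\<close> is the only common non-neighbour, \<open>w\<close> sees
  \<open>b\<close>, which makes \<open>v, w, b, c\<close> an induced path. A vertex of
  \<open>K\<close> seen by both \<open>v\<close> and \<open>w\<close> also sees \<open>b\<close> and
  \<open>c\<close>, as these lie in the clique.\<close>

lemma hub:
  assumes "v \<in> W" "w \<in> W" "E v w" "c \<in> non v" "c \<in> non w" "b \<in> non v" "b \<noteq> c"
  shows "path4 v w b c" "\<And>x. x \<in> K \<Longrightarrow> x \<notin> non v \<Longrightarrow> x \<notin> non w \<Longrightarrow> E v x \<and> E w x \<and> E b x \<and> E c x"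
    "b \<in> W" "c \<in> W"
proof -
  have "b \<notin> non w" using non_inter[of v w b c] assms by blast
  then have "E w b" "b \<in> K" "c \<in> K" using assms non_sub unfolding non_def by auto
  moreover from this have "E b c" using clK assms unfolding is_clique_def by blast
  ultimately show "path4 v w b c" "b \<in> W" "c \<in> W"
    unfolding path4_def using assms KW unfolding non_def by auto
  show "E v x \<and> E w x \<and> E b x \<and> E c x" if "x \<in> K" "x \<notin> non v" "x \<notin> non w" for x
  proof -
    have "x \<noteq> b" "x \<noteq> c" using that assms by auto
    then show ?thesis
      using that clK \<open>b \<in> K\<close> \<open>c \<in> K\<close> unfolding is_clique_def non_def by auto
  qed
qed

text \<open>Any further vertex of \<open>K\<close> would be the centre of a gem over the path of
  \<open>hub\<close>.\<close>

lemma hub_gem: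
  assumes "gem_free W" "v \<in> W" "w \<in> W" "E v w" "c \<in> non v" "c \<in> non w" "b \<in> non v" "b \<noteq> c"
  shows "non v \<union> non w = K"
proof (rule ccontr)
  note h = hub[OF assms(2-8)]
  assume "non v \<union> non w \<noteq> K"
  then obtain x where "x \<in> K" "x \<notin> non v" "x \<notin> non w" using non_sub by blast
  then show False
    using h(1) h(2)[of x] h(3,4) assms(1-3) KW unfolding gem_free_def P4_free_def by blast
qed

text \<open>Two vertices of \<open>K\<close> seen by both \<open>v\<close> and \<open>w\<close> are
  adjacent and form a \<open>K2 + P4\<close> with the path of \<open>hub\<close>.\<close>

lemma hub_K2_P4:
  assumes "K2_P4_free W" "v \<in> W" "w \<in> W" "E v w" "c \<in> non v" "c \<in> non w" "b \<in> non v" "b \<noteq> c"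
    and "x \<in> K" "y \<in> K" "x \<noteq> y" "x \<notin> non v" "x \<notin> non w" "y \<notin> non v" "y \<notin> non w"
  shows False
proof -
  note h = hub[OF assms(2-8)]
  have "E x y" using clK assms unfolding is_clique_def by blast
  then have "P4_free {u \<in> W. E u x \<and> E u y}" using assms(1,9,10) KW unfolding K2_P4_free_def by blast
  then show False
    using h(1) h(2)[of x] h(2)[of y] h(3,4) assms unfolding P4_free_def by blast
qed

text \<open>
  Colouring \<open>v\<close> by a non-neighbour \<open>r v\<close> in \<open>K\<close>: in a conflict the two vertices share exactly one
  non-neighbour, so they start an induced path through \<open>K\<close> all of whose vertices are adjacent to every
  common neighbour in \<open>K\<close>.
\<close>

lemma colourable_by_representatives:
  assumes r: "\<And>v. v \<in> W \<Longrightarrow> \<not> X v \<Longrightarrow> r v \<in> non v"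
    and conf: "\<And>v w b. \<lbrakk>v \<in> W; w \<in> W; \<not> X v; \<not> X w; E v w; r v = r w; b \<in> non v; b \<noteq> r v\<rbrakk> \<Longrightarrow> False"
    and X: "colourable E n {v \<in> W. X v}"
  shows "colourable E (m + n) W"
proof -
  obtain f where f: "bij_betw f K {0..<m}"
    using ex_bij_betw_finite_nat[OF finK] cardK by auto
  have "colourable E m {v \<in> W. \<not> X v}"
  proof (rule colourableI[of _ "\<lambda>v. f (r v)"])
    show "f (r u) < m" if "u \<in> {v \<in> W. \<not> X v}" for u
    proof -
      have "r u \<in> K" using r[of u] that non_sub by blast
      then show ?thesis using f unfolding bij_betw_def by auto
    qed
    show "f (r u) \<noteq> f (r v)" if uv: "u \<in> {v \<in> W. \<not> X v}" "v \<in> {v \<in> W. \<not> X v}" "E u v" for u v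
    proof
      assume "f (r u) = f (r v)"
      moreover have ru: "r u \<in> non u" "r v \<in> non v" using r uv by auto
      moreover have "r u \<in> K" "r v \<in> K" using ru non_sub by blast+
      ultimately have eq: "r u = r v" using f unfolding bij_betw_def inj_on_def by auto
      have "non u = {r u}" using conf[of u v] uv eq ru by auto
      moreover have "non v = {r u}" using conf[of v u] uv eq ru sym[of u v] by auto
      ultimately show False using non_singletons[of u v "r u"] uv by auto
    qed
  qed
  then have "colourable E (m + n) ({v \<in> W. \<not> X v} \<union> {v \<in> W. X v})" using X by (rule colourable_Un)
  moreover have "{v \<in> W. \<not> X v} \<union> {v \<in> W. X v} = W" by auto
  ultimately show ?thesis by simp
qed

lemma common_non_colourable:
  assumes "b \<noteq> c"
  shows "colourable E 1 {v \<in> W. b \<in> non v \<and> c \<in> non v}"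
proof (rule colourableI[of _ "\<lambda>_. 0"])
  fix u v
  assume "u \<in> {v \<in> W. b \<in> non v \<and> c \<in> non v}" "v \<in> {v \<in> W. b \<in> non v \<and> c \<in> non v}" "E u v"
  then show "0 \<noteq> (0 :: nat)" using non_inter[of u v b c] assms by simp
qed simp

text \<open>Vertices missing both ends of the edge \<open>K\<close> are stable and take a third
  colour. Every other vertex misses exactly one end, so its representative is forced and no conflict
  arises.\<close>

lemma colourable_triangle_free:
  assumes "m = 2"
  shows "colourable E 3 W"
proof -
  obtain b c where bc: "b \<noteq> c" "K = {b, c}" using assms cardK by (auto simp: card_2_iff)
  have "colourable E (m + 1) W"
  proof (rule colourable_by_representatives[where X = "\<lambda>v. b \<in> non v \<and> c \<in> non v" and r = "\<lambda>v. SOME x. x \<in> non v"])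
    show r: "(SOME x. x \<in> non v) \<in> non v" if "v \<in> W" for v
      using non_nonempty[OF that] by (simp add: some_in_eq)
    show False if "v \<in> W" "\<not> (b \<in> non v \<and> c \<in> non v)" "x \<in> non v" "x \<noteq> (SOME x. x \<in> non v)" for v x
    proof -
      have "x \<in> {b, c}" "(SOME x. x \<in> non v) \<in> {b, c}" using r[OF that(1)] that(3) non_sub[of v] bc(2) by blast+
      then show False using r[OF that(1)] that(2-4) by (metis empty_iff insert_iff)
    qed
  qed (rule common_non_colourable[OF bc(1)])
  then show ?thesis using assms by simp
qed

text \<open>Vertices missing \<open>x1, x2\<close> or missing \<open>x3, x4\<close> form two stable
  sets, which account for the two extra colours.\<close>

lemma colourable_K2_P4_free:
  assumes "m \<ge> 4" "K2_P4_free W"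
  shows "colourable E (m + 2) W"
proof -
  obtain L where "L \<subseteq> K" "card L = 4" using assms cardK by (metis obtain_subset_with_card_n)
  then obtain xs where xs: "set xs = L" "distinct xs" "length xs = 4"
    using finite_distinct_list[of L] finite_subset[OF _ finK] distinct_card by metis
  then obtain x1 x2 x3 x4 where "xs = [x1, x2, x3, x4]"
    by (auto simp: numeral_eq_Suc length_Suc_conv)
  then have x: "x1 \<in> K" "x2 \<in> K" "x3 \<in> K" "x4 \<in> K" and d: "distinct [x1, x2, x3, x4]"
    using xs \<open>L \<subseteq> K\<close> by auto
  define X where "X v \<longleftrightarrow> x1 \<in> non v \<and> x2 \<in> non v \<or> x3 \<in> non v \<and> x4 \<in> non v" for v
  \<comment> \<open>The priorities ensure that the value \<open>r v\<close> of a vertex outside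
    \<open>X\<close> determines two of \<open>x1, x2, x3, x4\<close> that \<open>v\<close> sees:
    \<open>x2, x4\<close> for the value \<open>x1\<close>; \<open>x1, x3\<close> for
    \<open>x2\<close>; \<open>x1, x4\<close> for \<open>x3\<close>; \<open>x2, x3\<close> for
    \<open>x4\<close>; and all four for any other value. Two vertices in conflict therefore have two
    common neighbours in \<open>K\<close>, which \<open>hub_K2_P4\<close> forbids.\<close>
  define r where "r v = (if x1 \<in> non v then (if x4 \<in> non v then x4 else x1)
    else if x2 \<in> non v then (if x3 \<in> non v then x3 else x2)
    else if x3 \<in> non v then x3 else if x4 \<in> non v then x4 else (SOME x. x \<in> non v))" for v
  have some: "(SOME x. x \<in> non v) \<in> non v" if "v \<in> W" for v
    using non_nonempty[OF that] by (simp add: some_in_eq)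
  have r_non: "r v \<in> non v" if "v \<in> W" for v using some[OF that] unfolding r_def by auto
  show ?thesis
  proof (rule colourable_by_representatives[where X = X and r = r])
    show "r v \<in> non v" if "v \<in> W" for v by (rule r_non[OF that])
    have "colourable E (1 + 1) ({v \<in> W. x1 \<in> non v \<and> x2 \<in> non v} \<union> {v \<in> W. x3 \<in> non v \<and> x4 \<in> non v})"
      by (intro colourable_Un common_non_colourable) (use d in auto)
    then show "colourable E 2 {v \<in> W. X v}"
      by (rule colourable_subset[OF colourable_mono]) (auto simp: X_def)
    show False
      if v: "v \<in> W" "w \<in> W" "\<not> X v" "\<not> X w" "E v w" "r v = r w" "b \<in> non v" "b \<noteq> r v" for v w b
    proof -
      have rv: "r v \<in> non v" "r v \<in> non w" using r_non[of v] r_non[of w] v by simp_all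
      note h = hub_K2_P4[OF assms(2) v(1,2,5) rv v(7,8)]
      consider "r v = x1" | "r v = x2" | "r v = x3" | "r v = x4" | "r v \<notin> {x1, x2, x3, x4}" by blast
      then show False
      proof cases
        case 1
        then have "\<forall>u\<in>{v, w}. x2 \<notin> non u \<and> x4 \<notin> non u"
          using v d some unfolding r_def X_def by (auto split: if_splits)
        then show False using h[of x2 x4] x d by auto
      next
        case 2
        then have "\<forall>u\<in>{v, w}. x1 \<notin> non u \<and> x3 \<notin> non u"
          using v d some unfolding r_def X_def by (auto split: if_splits)
        then show False using h[of x1 x3] x d by auto
      next
        case 3
        then have "\<forall>u\<in>{v, w}. x1 \<notin> non u \<and> x4 \<notin> non u"
          using v d some unfolding r_def X_def by (auto split: if_splits)
        then show False using h[of x1 x4] x d by auto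
      next
        case 4
        then have "\<forall>u\<in>{v, w}. x2 \<notin> non u \<and> x3 \<notin> non u"
          using v d some unfolding r_def X_def by (auto split: if_splits)
        then show False using h[of x2 x3] x d by auto
      next
        case 5
        then have "\<forall>u\<in>{v, w}. x1 \<notin> non u \<and> x2 \<notin> non u"
          using v d some unfolding r_def X_def by (auto split: if_splits)
        then show False using h[of x1 x2] x d by auto
      qed
    qed
  qed
qed

text \<open>Otherwise each non-neighbour \<open>c\<close> of \<open>v\<close> in \<open>K\<close> is
  shared with a neighbour \<open>g c\<close> of \<open>v\<close>. It turns out that \<open>v\<close>
  misses all of \<open>K\<close> and that the vertices \<open>g c\<close> together with
  \<open>v\<close> form a clique of size \<open>m + 1\<close>.\<close>

lemma ex_free_non_neighbour:
  assumes "gem_free W" "v \<in> W" "card (non v) \<ge> 3"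
  shows "\<exists>c\<in>non v. \<forall>w\<in>W. E v w \<longrightarrow> c \<notin> non w"
proof (rule ccontr)
  assume "\<not> ?thesis"
  then have "\<forall>c\<in>non v. \<exists>w. w \<in> W \<and> E v w \<and> c \<in> non w" by blast
  then obtain g where g: "\<And>c. c \<in> non v \<Longrightarrow> g c \<in> W" "\<And>c. c \<in> non v \<Longrightarrow> E v (g c)" "\<And>c. c \<in> non v \<Longrightarrow> c \<in> non (g c)"
    by metis
  have inter: "c' \<notin> non (g c)" if "c \<in> non v" "c' \<in> non v" "c \<noteq> c'" for c c'
    using non_inter[of v "g c" c c'] that g assms(2) by blast
  have third: "\<exists>c''\<in>non v. c'' \<noteq> c \<and> c'' \<noteq> c'" for c c'
  proof (rule ccontr)
    assume "\<not> ?thesis"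
    then have "non v \<subseteq> {c, c'}" by blast
    then have "card (non v) \<le> card {c, c'}" by (intro card_mono) auto
    also have "\<dots> \<le> 2" by (simp add: card_insert_if)
    finally show False using assms(3) by simp
  qed
  have union: "non v \<union> non (g c) = K" if c: "c \<in> non v" for c
  proof -
    obtain b where "b \<in> non v" "b \<noteq> c" using third[of c c] by blast
    then show ?thesis using hub_gem[OF assms(1,2) g(1)[OF c] g(2)[OF c] c g(3)[OF c]] by blast
  qed
  \<comment> \<open>If not, \<open>g c, c', c, g c'\<close> is an induced path, and a third
    non-neighbour \<open>d\<close> of \<open>v\<close> sees all of it. This is where at least three
    non-neighbours are used.\<close>
  have adj: "E (g c) (g c')" if cc: "c \<in> non v" "c' \<in> non v" "c \<noteq> c'" for c c'
  proof (rule ccontr)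
    assume nadj: "\<not> E (g c) (g c')"
    obtain d where d: "d \<in> non v" "d \<noteq> c" "d \<noteq> c'" using third by blast
    have K: "c \<in> K" "c' \<in> K" "d \<in> K" using cc d non_sub by blast+
    have n: "c' \<notin> non (g c)" "d \<notin> non (g c)" "c \<notin> non (g c')" "d \<notin> non (g c')"
      using inter cc d by auto
    have e: "E (g c) c'" "E (g c) d" "E (g c') c" "E (g c') d" using n K unfolding non_def by auto
    have e': "E c c'" "E c' c" "E c d" "E c' d" using clK K cc d unfolding is_clique_def by auto
    have "path4 (g c) c' c (g c')"
      using e e' nadj g(3)[OF cc(1)] g(3)[OF cc(2)] sym unfolding path4_def non_def by auto
    then show False
      using assms(1) K KW e e' g(1)[OF cc(1)] g(1)[OF cc(2)] unfolding gem_free_def P4_free_def by blast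
  qed
  \<comment> \<open>A vertex \<open>l\<close> of \<open>K\<close> seen by \<open>v\<close> is missed
    by both \<open>g c\<close> and \<open>g c'\<close>. By \<open>hub_gem\<close> these two would
    then miss all of \<open>K\<close> between them, yet both see \<open>d\<close>.\<close>
  have "non v = K"
  proof (rule ccontr)
    assume "non v \<noteq> K"
    then obtain l where l: "l \<in> K" "l \<notin> non v" using non_sub by blast
    obtain c where c: "c \<in> non v" using third by blast
    obtain c' where c': "c' \<in> non v" "c' \<noteq> c" using third by blast
    obtain d where d: "d \<in> non v" "d \<noteq> c" "d \<noteq> c'" using third by blast
    have "l \<in> non (g c)" "l \<in> non (g c')" using union[OF c] union[OF c'(1)] l by blast+
    moreover have "c \<noteq> l" using c l by blast
    ultimately have "non (g c) \<union> non (g c') = K"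
      using hub_gem[OF assms(1) g(1)[OF c] g(1)[OF c'(1)] adj[OF c c'(1)] _ _ g(3)[OF c]] c'(2) by blast
    then have "d \<in> non (g c) \<union> non (g c')" using d(1) non_sub by blast
    then show False using inter c c' d by blast
  qed
  have "v \<notin> K" using \<open>non v = K\<close> non_K[of v] third[of v v] by auto
  have inj: "inj_on g K"
  proof (rule inj_onI)
    fix c c' assume "c \<in> K" "c' \<in> K" "g c = g c'"
    then show "c = c'" using inter[of c c'] g(3)[of c'] \<open>non v = K\<close> by auto
  qed
  have "v \<notin> g ` K" using g(2) irrefl \<open>non v = K\<close> by force
  then have "card (insert v (g ` K)) = Suc m" using finK card_image[OF inj] cardK by simp
  moreover have "is_clique (insert v (g ` K))"
    unfolding is_clique_def
  proof (intro ballI impI)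
    fix a b assume "a \<in> insert v (g ` K)" "b \<in> insert v (g ` K)" "a \<noteq> b"
    then show "E a b" using g(2) adj sym \<open>non v = K\<close> by auto
  qed
  moreover have "insert v (g ` K) \<subseteq> W" using g(1) assms(2) \<open>non v = K\<close> by auto
  ultimately show False using clique_leD[OF cl, of "insert v (g ` K)"] finK by simp
qed

text \<open>A vertex with at least three non-neighbours in \<open>K\<close> takes one shared with no
  neighbour, hence is in no conflict. Two conflicting vertices have non-neighbourhoods that cover
  \<open>K\<close> and share one vertex, so the sizes add up to \<open>m + 1\<close>; being at most
  2 each, this leaves only \<open>m = 3\<close>.\<close>

lemma colourable_gem_free:
  assumes "m \<ge> 3" "gem_free W"
  shows "colourable E m W"
proof -
  obtain L where "L \<subseteq> K" "card L = 3" using assms cardK by (metis obtain_subset_with_card_n)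
  then obtain x1 x2 x3 where x: "x1 \<in> K" "x2 \<in> K" "x3 \<in> K" "x1 \<noteq> x2" "x1 \<noteq> x3" "x2 \<noteq> x3"
    by (auto simp: card_3_iff)
  have K3: "K = {x1, x2, x3}" if "m = 3"
  proof (rule card_subset_eq[symmetric, OF finK])
    show "card {x1, x2, x3} = card K" using x cardK that by simp
  qed (use x in auto)
  define free where "free v c \<longleftrightarrow> c \<in> non v \<and> (\<forall>w\<in>W. E v w \<longrightarrow> c \<notin> non w)" for v c
  \<comment> \<open>The cyclic choice matters for \<open>m = 3\<close>: the three pairs in
    \<open>K\<close> receive different representatives, so equal representatives mean equal pairs,
    whereas the non-neighbourhoods of conflicting vertices share only one vertex.\<close>
  define r where "r v = (if card (non v) \<ge> 3 then (SOME c. free v c)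
    else if non v = {x1, x2} then x1 else if non v = {x2, x3} then x2 else if non v = {x1, x3} then x3
    else (SOME c. c \<in> non v))" for v
  have some: "(SOME x. x \<in> non v) \<in> non v" if "v \<in> W" for v
    using non_nonempty[OF that] by (simp add: some_in_eq)
  have r_free: "free v (r v)" if "v \<in> W" "card (non v) \<ge> 3" for v
  proof -
    have "\<exists>c. free v c" using ex_free_non_neighbour[OF assms(2) that] unfolding free_def by blast
    then show ?thesis using that someI_ex[of "free v"] unfolding r_def by simp
  qed
  have r_non: "r v \<in> non v" if "v \<in> W" for v
  proof (cases "card (non v) \<ge> 3")
    case True
    then show ?thesis using r_free that unfolding free_def by blast
  next
    case False
    then show ?thesis using some[OF that] unfolding r_def by simp
  qed
  have "colourable E (m + 0) W"
  proof (rule colourable_by_representatives[where X = "\<lambda>_. False" and r = r])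
    show "r v \<in> non v" if "v \<in> W" for v by (rule r_non[OF that])
    show "colourable E 0 {v \<in> W. False}" by (simp add: colourable_def)
    show False if v: "v \<in> W" "w \<in> W" "E v w" "r v = r w" "b \<in> non v" "b \<noteq> r v" for v w b
    proof -
      have rr: "r v \<in> non v" "r v \<in> non w" using r_non[of v] r_non[of w] v by simp_all
      have un: "non v \<union> non w = K" using hub_gem[OF assms(2) v(1-3) rr v(5,6)] .
      have int: "non v \<inter> non w = {r v}" using non_inter[of v w "r v"] v rr by blast
      have small: "card (non v) < 3" "card (non w) < 3"
        using r_free[of v] r_free[of w] v rr sym unfolding free_def by fastforce+
      have "card (non v) + card (non w) = m + 1"
        using card_Un_Int[OF fin_non fin_non, of v w] un int cardK by simp
      then have "m = 3" and two: "card (non v) = 2" "card (non w) = 2" using small assms(1) by auto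
      note K = K3[OF \<open>m = 3\<close>]
      have pairs: "non u = {x1, x2} \<or> non u = {x2, x3} \<or> non u = {x1, x3}" if u: "card (non u) = 2" for u
      proof -
        obtain y z where "non u = {y, z}" "y \<noteq> z" using u by (auto simp: card_2_iff)
        moreover from this have "y \<in> {x1, x2, x3}" "z \<in> {x1, x2, x3}" using non_sub[of u] K by auto
        ultimately show ?thesis by auto
      qed
      have "r v = (if non v = {x1, x2} then x1 else if non v = {x2, x3} then x2 else x3)"
        "r w = (if non w = {x1, x2} then x1 else if non w = {x2, x3} then x2 else x3)"
        using pairs[OF two(1)] pairs[OF two(2)] two unfolding r_def by auto
      then have "non v = non w" using pairs[OF two(1)] pairs[OF two(2)] v(4) x(4-6) by (auto split: if_splits)
      then show False using int two by simp
    qed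
  qed
  then show ?thesis by simp
qed

end

section \<open>The recursive bounds\<close>

text \<open>In this form monotonicity in \<open>m\<close> is visible, including the passage from the
  exceptional value at \<open>m = 2\<close> to \<open>m = 3\<close>.\<close>

lemma g_bound_closed: "p \<ge> 2 \<Longrightarrow> m \<ge> 3 \<Longrightarrow> g_bound p m = m + (p - 2) * (2 * m - 2)"
proof (induction p rule: dec_induct)
  case base
  then show ?case by (simp add: g_bound_equations)
next
  case (step p)
  obtain q where "p = Suc (Suc q)" using step(1) by (metis add_2_eq_Suc le_Suc_ex)
  then show ?case using step g_bound_equations(5)[of "Suc p" m] by simp
qed

lemma g_bound_0 [simp]: "g_bound p 0 = 0" and f_bound_0 [simp]: "f_bound p 0 = 0"
  by (subst g_bound.simps f_bound.simps; simp)+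

lemma g_bound_two: "p \<ge> 2 \<Longrightarrow> g_bound p 2 = (if p = 2 then 3 else 2 * p - 2)"
  using g_bound_equations(2,4) by auto

lemma f_bound_two: "p \<ge> 2 \<Longrightarrow> f_bound p 2 = (if p = 2 then 3 else 2 * p - 2)"
  using f_bound_equations(2,5) by auto

text \<open>The closed form at \<open>m = 3\<close> solves the general recursion with start value 4.
  The case \<open>p = 3\<close> is separate because \<open>g_bound 2 2\<close> is 3, not the value 2
  that \<open>2 * p - 2\<close> would give.\<close>

lemma f_bound_step:
  assumes "p \<ge> 3" "m \<ge> 3"
  shows "f_bound p m = f_bound (p - 1) m + 2 * g_bound (p - 1) (m - 1) + (3 * m - 6)"
proof (cases "m = 3")
  case True
  show ?thesis
  proof (cases "p = 3")
    case True
    have "int (f_bound 3 3) = 13" using f_bound_equations(6)[of 3] by simp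
    then show ?thesis using True \<open>m = 3\<close> f_bound_equations(3) g_bound_equations(2) by simp
  next
    case False
    then obtain q where q: "p = Suc q" "q \<ge> 3" using assms by (cases p) auto
    have "int (f_bound (Suc q) 3) = int (f_bound q 3) + 2 * int (g_bound q 2) + 3"
      using f_bound_equations(6)[of "Suc q"] f_bound_equations(6)[of q] g_bound_equations(4)[of q] q(2)
      by (simp add: of_nat_diff power2_eq_square algebra_simps)
    then have "f_bound (Suc q) 3 = f_bound q 3 + 2 * g_bound q 2 + 3" by linarith
    then show ?thesis using True q by simp
  qed
next
  case False
  then show ?thesis using f_bound_equations(7)[of p m] assms by simp
qed

lemma g_bound_Suc:
  assumes "p \<ge> 2"
  shows "g_bound p m \<le> g_bound p (Suc m)"
proof -
  consider "m = 0" | "m = 1" | "m = 2" | "m \<ge> 3" by linarith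
  then show ?thesis
  proof cases
    case 2
    have "g_bound p 1 \<le> g_bound p 2" using g_bound_two[OF assms] g_bound_equations(1)[OF assms] assms by auto
    then show ?thesis using 2 by (simp add: numeral_2_eq_2)
  next
    case 3
    have "2 * p - 2 \<le> 3 + (p - 2) * 4" "p = 2 \<or> p \<ge> 3" using assms by auto
    then show ?thesis using 3 g_bound_two[OF assms] g_bound_closed[OF assms, of 3] by auto
  next
    case 4
    have "(p - 2) * (2 * m - 2) \<le> (p - 2) * (2 * Suc m - 2)" by (rule mult_le_mono2) simp
    then show ?thesis using 4 g_bound_closed[OF assms, of m] g_bound_closed[OF assms, of "Suc m"] by linarith
  qed simp
qed

lemma g_bound_mono: "p \<ge> 2 \<Longrightarrow> m \<le> n \<Longrightarrow> g_bound p m \<le> g_bound p n"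
  using lift_Suc_mono_le[of "g_bound p"] g_bound_Suc by blast

lemma f_bound_Suc:
  assumes "p \<ge> 2"
  shows "f_bound p m \<le> f_bound p (Suc m)"
  using assms
proof (induction p arbitrary: m rule: dec_induct)
  case base
  have "m = 0 \<or> m = 1 \<or> m = 2 \<or> m = 3 \<or> m \<ge> 4" by linarith
  then show ?case
    using f_bound_equations(1)[of 2] f_bound_equations(2-4) by (auto simp: numeral_2_eq_2 numeral_3_eq_3)
next
  case (step p)
  consider "m = 0" | "m = 1" | "m = 2" | "m \<ge> 3" by linarith
  then show ?case
  proof cases
    case 2
    have "f_bound (Suc p) 1 \<le> f_bound (Suc p) 2"
      using f_bound_two[of "Suc p"] f_bound_equations(1)[of "Suc p"] step(1) by auto
    then show ?thesis using 2 by (simp add: numeral_2_eq_2)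
  next
    case 3
    have "f_bound p 2 \<le> f_bound p 3" using step.IH[of 2] by simp
    then show ?thesis
      using 3 f_bound_step[of "Suc p" 3] f_bound_two[of p] f_bound_two[of "Suc p"] g_bound_two[of p] step
      by (auto split: if_splits)
  next
    case 4
    have "g_bound p (m - 1) \<le> g_bound p m" using g_bound_mono[of p "m - 1" m] step by simp
    moreover have "f_bound p m \<le> f_bound p (Suc m)" by (rule step.IH)
    ultimately show ?thesis
      using 4 step(1) f_bound_step[of "Suc p" m] f_bound_step[of "Suc p" "Suc m"] by simp
  qed simp
qed

lemma f_bound_mono: "p \<ge> 2 \<Longrightarrow> m \<le> n \<Longrightarrow> f_bound p m \<le> f_bound p n"
  using lift_Suc_mono_le[of "f_bound p"] f_bound_Suc by blast

section \<open>Induction on the number of independent edges\<close>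

context sgraph
begin

lemma not_occurs_two_K2:
  assumes "\<not> matching 2 W"
  shows "\<not> occurs W two_K2"
proof
  assume "occurs W two_K2"
  let ?Ns = "[[], [0], [], [2]] :: nat list list"
  obtain f where f: "\<And>i. i < length ?Ns \<Longrightarrow> f i \<in> W" "inj_on f {..<length ?Ns}"
    "\<And>i j. i < length ?Ns \<Longrightarrow> j < i \<Longrightarrow> E (f i) (f j) \<longleftrightarrow> j \<in> set (?Ns ! i)"
    by (rule occursD[OF \<open>occurs W two_K2\<close>[unfolded two_K2_def]]) (rule that)
  have fW: "f 0 \<in> W" "f 1 \<in> W" "f 2 \<in> W" "f 3 \<in> W" using f(1) by simp_all
  have fE: "E (f 1) (f 0)" "\<not> E (f 2) (f 0)" "\<not> E (f 2) (f 1)" "E (f 3) (f 2)" "\<not> E (f 3) (f 0)" "\<not> E (f 3) (f 1)"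
    using f(3)[of 1 0] f(3)[of 2 0] f(3)[of 2 1] f(3)[of 3 2] f(3)[of 3 0] f(3)[of 3 1] by simp_all
  have "matching 0 {}" by (simp add: matching_def)
  then have "matching (Suc 0) {f 2, f 3}" by (rule matching_Suc[of _ _ _ "f 3" "f 2"]) (use fE in auto)
  then have "matching (Suc (Suc 0)) W" by (rule matching_Suc[of _ _ _ "f 1" "f 0"]) (use fE fW in auto)
  then show False using assms by (simp add: numeral_2_eq_2)
qed

lemma not_occurs_three_K2:
  assumes "\<not> matching 3 W"
  shows "\<not> occurs W three_K2"
proof
  assume "occurs W three_K2"
  let ?Ns = "[[], [0], [], [2], [], [4]] :: nat list list"
  obtain f where f: "\<And>i. i < length ?Ns \<Longrightarrow> f i \<in> W" "inj_on f {..<length ?Ns}"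
    "\<And>i j. i < length ?Ns \<Longrightarrow> j < i \<Longrightarrow> E (f i) (f j) \<longleftrightarrow> j \<in> set (?Ns ! i)"
    by (rule occursD[OF \<open>occurs W three_K2\<close>[unfolded three_K2_def]]) (rule that)
  have fW: "f 0 \<in> W" "f 1 \<in> W" "f 2 \<in> W" "f 3 \<in> W" "f 4 \<in> W" "f 5 \<in> W" using f(1) by simp_all
  have fE: "E (f 1) (f 0)" "E (f 3) (f 2)" "E (f 5) (f 4)"
    "\<not> E (f 2) (f 0)" "\<not> E (f 2) (f 1)" "\<not> E (f 3) (f 0)" "\<not> E (f 3) (f 1)" "\<not> E (f 4) (f 0)" "\<not> E (f 4) (f 1)"
    "\<not> E (f 5) (f 0)" "\<not> E (f 5) (f 1)" "\<not> E (f 4) (f 2)" "\<not> E (f 4) (f 3)" "\<not> E (f 5) (f 2)" "\<not> E (f 5) (f 3)"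
    using f(3)[of 1 0] f(3)[of 3 2] f(3)[of 5 4] f(3)[of 2 0] f(3)[of 2 1] f(3)[of 3 0] f(3)[of 3 1] f(3)[of 4 0]
      f(3)[of 4 1] f(3)[of 5 0] f(3)[of 5 1] f(3)[of 4 2] f(3)[of 4 3] f(3)[of 5 2] f(3)[of 5 3] by simp_all
  have "matching 0 {}" by (simp add: matching_def)
  then have "matching (Suc 0) {f 4, f 5}" by (rule matching_Suc[of _ _ _ "f 5" "f 4"]) (use fE in auto)
  then have "matching (Suc (Suc 0)) {f 2, f 3, f 4, f 5}" by (rule matching_Suc[of _ _ _ "f 3" "f 2"]) (use fE in auto)
  then have "matching (Suc (Suc (Suc 0))) W" by (rule matching_Suc[of _ _ _ "f 1" "f 0"]) (use fE fW in auto)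
  then show False using assms by (simp add: numeral_3_eq_3)
qed

lemma not_occurs_complete:
  assumes "clique_le m W" "length Ns = Suc m" "\<And>i. i < length Ns \<Longrightarrow> Ns ! i = [0..<i]"
  shows "\<not> occurs W (graph_of Ns)"
proof
  assume "occurs W (graph_of Ns)"
  then obtain f where f: "\<And>i. i < length Ns \<Longrightarrow> f i \<in> W" "inj_on f {..<length Ns}"
    "\<And>i j. i < length Ns \<Longrightarrow> j < i \<Longrightarrow> E (f i) (f j) \<longleftrightarrow> j \<in> set (Ns ! i)"
    by (rule occursD) (rule that)
  have adj: "E (f i) (f j)" if "i < length Ns" "j < i" for i j
    using that f(3)[OF that] assms(3)[OF that(1)] by simp
  have "is_clique (f ` {..<length Ns})"
    unfolding is_clique_def
  proof (intro ballI impI)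
    fix u v assume "u \<in> f ` {..<length Ns}" "v \<in> f ` {..<length Ns}" "u \<noteq> v"
    then obtain i j where "i < length Ns" "j < length Ns" "u = f i" "v = f j" "i \<noteq> j" by blast
    then show "E u v" using adj[of i j] adj[of j i] sym[of v u] by (metis linorder_neqE_nat)
  qed
  moreover have "card (f ` {..<length Ns}) = Suc m" using card_image[OF f(2)] assms(2) by simp
  moreover have "f ` {..<length Ns} \<subseteq> W" using f(1) by blast
  ultimately show False using clique_leD[OF assms(1), of "f ` {..<length Ns}"] by simp
qed

lemma not_occurs_triangle: "clique_le 2 W \<Longrightarrow> \<not> occurs W triangle"
  unfolding triangle_def by (rule not_occurs_complete) (auto simp: less_Suc_eq numeral_eq_Suc)

lemma not_occurs_K4: "clique_le 3 W \<Longrightarrow> \<not> occurs W K4"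
  unfolding K4_def by (rule not_occurs_complete) (auto simp: less_Suc_eq numeral_eq_Suc)

lemma matching_reduce:
  assumes "\<not> matching p W" "p \<ge> 1" "x \<in> W" "y \<in> W" "E x y"
  shows "\<not> matching (p - 1) {w \<in> W. \<not> E w x \<and> \<not> E w y}"
proof
  assume "matching (p - 1) {w \<in> W. \<not> E w x \<and> \<not> E w y}"
  then have "matching (Suc (p - 1)) W"
    by (rule matching_Suc[of _ _ _ x y]) (use assms(3-5) in auto)
  then show False using assms(1,2) by simp
qed

lemma clique_le_nbrs:
  assumes "clique_le m W" "m \<ge> 1" "x \<in> W" "A \<subseteq> {w \<in> W. E w x}"
  shows "clique_le (m - 1) A"
  by (rule clique_le_neighbours[of _ W x]) (use assms in auto)

lemma clique_edge:
  assumes "is_clique K" "card K \<ge> 2"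
  obtains x y where "x \<in> K" "y \<in> K" "E x y"
proof -
  obtain L where "L \<subseteq> K" "card L = 2" using assms(2) by (metis obtain_subset_with_card_n)
  then obtain x y where "x \<in> K" "y \<in> K" "x \<noteq> y" by (auto simp: card_2_iff)
  then show ?thesis using that assms(1) unfolding is_clique_def by blast
qed

lemma colourable_small:
  assumes "finite W" "clique_le m W" "m \<le> 1"
  shows "colourable E m W"
proof (cases "m = 0")
  case True
  then have "W = {}" using clique_le_0 assms(2) by blast
  then show ?thesis by (simp add: colourable_def)
next
  case False
  then show ?thesis using colourable_edgeless assms by (simp add: le_Suc_eq)
qed

lemma colourable_clique_le_2:
  assumes "p \<ge> 2" "finite W" "\<not> matching p W" "clique_le 2 W"
  shows "colourable E (if p = 2 then 3 else 2 * p - 2) W"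
  using assms
proof (induction p arbitrary: W rule: dec_induct)
  case base
  obtain K where K: "K \<subseteq> W" "is_clique K" "card K \<le> 2" "clique_le (card K) W"
    using clique_le_exact[OF base(1,3)] .
  show ?case
  proof (cases "card K = 2")
    case True
    interpret max_clique E W K 2
      by unfold_locales (use K True base in auto)
    show ?thesis using colourable_triangle_free by simp
  next
    case False
    then show ?thesis using colourable_mono[OF colourable_small[OF base(1) K(4)], of 3] K(3) by simp
  qed
next
  case (step p)
  show ?case
  proof (cases "p = 2")
    \<comment> \<open>For three independent edges the general step would add 2 to the 3 colours of
      the base case; the direct proof saves one colour, and all later values
      \<open>2 * p - 2\<close> profit from it.\<close>
    case True
    then have "colourable E 4 W"
      using colourable_3K2[OF step.prems(1)] not_occurs_triangle[OF step.prems(3)] not_occurs_three_K2 step.prems(2)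
      by simp
    then show ?thesis using True by simp
  next
    case False
    obtain K where K: "K \<subseteq> W" "is_clique K" "card K \<le> 2" "clique_le (card K) W"
      using clique_le_exact[OF step.prems(1,3)] .
    show ?thesis
    proof (cases "card K = 2")
      case True
      then obtain x y where xy: "x \<in> W" "y \<in> W" "E x y" using clique_edge[OF K(2)] K(1) by (metis le_refl subsetD)
      let ?A = "{w \<in> W. E w x}" and ?B = "{w \<in> W. E w y}" and ?R = "{w \<in> W. \<not> E w x \<and> \<not> E w y}"
      have "clique_le 1 ?A" "clique_le 1 ?B"
        using clique_le_nbrs[OF step.prems(3) _ xy(1), of ?A] clique_le_nbrs[OF step.prems(3) _ xy(2), of ?B] by simp_all
      then have "colourable E 1 ?A" "colourable E 1 ?B" using colourable_edgeless by auto
      moreover have "colourable E (2 * p - 2) ?R"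
        using step.IH[of ?R] False matching_reduce[OF step.prems(2) _ xy] step.prems clique_le_subset[of 2 W ?R] by simp
      ultimately have "colourable E (1 + 1 + (2 * p - 2)) (?A \<union> ?B \<union> ?R)" by (intro colourable_Un)
      moreover have "?A \<union> ?B \<union> ?R = W" by auto
      moreover have "1 + 1 + (2 * p - 2) = 2 * Suc p - 2" "Suc p \<noteq> 2" using step(1) by auto
      ultimately show ?thesis by simp
    next
      case False
      then have "colourable E (2 * Suc p - 2) W"
        using colourable_mono[OF colourable_small[OF step.prems(1) K(4)]] K(3) step by simp
      then show ?thesis using step by simp
    qed
  qed
qed

lemma colourable_gem:
  assumes "p \<ge> 2" "finite W" "\<not> matching p W" "gem_free W" "clique_le m W"
  shows "colourable E (g_bound p m) W"
  using assms
proof (induction p arbitrary: W m rule: dec_induct)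
  case base
  obtain K where K: "K \<subseteq> W" "is_clique K" "card K \<le> m" "clique_le (card K) W"
    using clique_le_exact[OF base(1,4)] .
  have "colourable E (g_bound 2 (card K)) W"
  proof -
    consider "card K \<le> 1" | "card K = 2" | "card K \<ge> 3" by linarith
    then show ?thesis
    proof cases
      case 1
      then have "g_bound 2 (card K) = card K" using g_bound_equations(1)[of 2] by (auto simp: le_Suc_eq)
      then show ?thesis using colourable_small[OF base(1) K(4) 1] by simp
    next
      case 2
      then show ?thesis using colourable_clique_le_2[of 2 W] base K by (simp add: g_bound_two)
    next
      case 3
      interpret max_clique E W K "card K"
        by unfold_locales (use K base in auto)
      show ?thesis using colourable_gem_free[OF 3 base(3)] g_bound_equations(3)[OF 3] by simp
    qed
  qed
  then show ?case by (rule colourable_mono) (simp add: g_bound_mono K)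
next
  case (step p)
  obtain K where K: "K \<subseteq> W" "is_clique K" "card K \<le> m" "clique_le (card K) W"
    using clique_le_exact[OF step.prems(1,4)] .
  let ?m = "card K"
  have "colourable E (g_bound (Suc p) ?m) W"
  proof -
    consider "?m \<le> 1" | "?m = 2" | "?m \<ge> 3" by linarith
    then show ?thesis
    proof cases
      case 1
      then have "g_bound (Suc p) ?m = ?m" using g_bound_equations(1)[of "Suc p"] step by (auto simp: le_Suc_eq)
      then show ?thesis using colourable_small[OF step.prems(1) K(4) 1] by simp
    next
      case 2
      then show ?thesis using colourable_clique_le_2[of "Suc p" W] step K by (simp add: g_bound_two)
    next
      case 3
      then obtain x y where "x \<in> K" "y \<in> K" and E: "E x y"
        by (metis K(2) clique_edge Suc_le_eq less_imp_le numeral_3_eq_3 numeral_2_eq_2)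
      then have xy: "x \<in> W" "y \<in> W" "E x y" using K(1) by auto
      let ?A = "{w \<in> W. E w x}" and ?B = "{w \<in> W. E w y}" and ?R = "{w \<in> W. \<not> E w x \<and> \<not> E w y}"
      have "clique_le (?m - 1) ?A" "clique_le (?m - 1) ?B"
        using clique_le_nbrs[OF K(4) _ xy(1), of ?A] clique_le_nbrs[OF K(4) _ xy(2), of ?B] 3 by simp_all
      moreover have "P4_free ?A" "P4_free ?B" using step.prems(3) xy unfolding gem_free_def by auto
      ultimately have "colourable E (?m - 1) ?A" "colourable E (?m - 1) ?B"
        using colourable_P4_free step.prems(1) by auto
      moreover have "colourable E (g_bound p ?m) ?R"
        using step.IH[of ?R ?m] matching_reduce[OF step.prems(2) _ xy] step.prems
          clique_le_subset[OF K(4), of ?R] gem_free_subset[of W ?R] by simp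
      ultimately have "colourable E ((?m - 1) + (?m - 1) + g_bound p ?m) (?A \<union> ?B \<union> ?R)" by (intro colourable_Un)
      moreover have "?A \<union> ?B \<union> ?R = W" by auto
      moreover have "g_bound (Suc p) ?m = (?m - 1) + (?m - 1) + g_bound p ?m"
        using g_bound_equations(5)[of "Suc p" ?m] step 3 by simp
      ultimately show ?thesis by simp
    qed
  qed
  then show ?case by (rule colourable_mono) (use g_bound_mono[of "Suc p"] step K in simp)
qed

lemma colourable_K2_P4:
  assumes "p \<ge> 2" "finite W" "\<not> matching p W" "K2_P4_free W" "clique_le m W"
  shows "colourable E (f_bound p m) W"
  using assms
proof (induction p arbitrary: W m rule: dec_induct)
  case base
  obtain K where K: "K \<subseteq> W" "is_clique K" "card K \<le> m" "clique_le (card K) W"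
    using clique_le_exact[OF base(1,4)] .
  have "colourable E (f_bound 2 (card K)) W"
  proof -
    consider "card K \<le> 1" | "card K = 2" | "card K = 3" | "card K \<ge> 4" by linarith
    then show ?thesis
    proof cases
      case 1
      then have "f_bound 2 (card K) = card K" using f_bound_equations(1)[of 2] by (auto simp: le_Suc_eq)
      then show ?thesis using colourable_small[OF base(1) K(4) 1] by simp
    next
      case 2
      then show ?thesis using colourable_clique_le_2[of 2 W] base K by (simp add: f_bound_two)
    next
      case 3
      then show ?thesis
        using colourable_2K2_K4[OF base(1) not_occurs_two_K2[OF base(2)] not_occurs_K4] K(4) f_bound_equations(3) by simp
    next
      case 4
      interpret max_clique E W K "card K"
        by unfold_locales (use K base in auto)
      show ?thesis using colourable_K2_P4_free[OF 4 base(3)] f_bound_equations(4)[OF 4] by simp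
    qed
  qed
  then show ?case by (rule colourable_mono) (simp add: f_bound_mono K)
next
  case (step p)
  obtain K where K: "K \<subseteq> W" "is_clique K" "card K \<le> m" "clique_le (card K) W"
    using clique_le_exact[OF step.prems(1,4)] .
  let ?m = "card K"
  have "colourable E (f_bound (Suc p) ?m) W"
  proof -
    consider "?m \<le> 1" | "?m = 2" | "?m \<ge> 3" by linarith
    then show ?thesis
    proof cases
      case 1
      then have "f_bound (Suc p) ?m = ?m" using f_bound_equations(1)[of "Suc p"] step by (auto simp: le_Suc_eq)
      then show ?thesis using colourable_small[OF step.prems(1) K(4) 1] by simp
    next
      case 2
      then show ?thesis using colourable_clique_le_2[of "Suc p" W] step K by (simp add: f_bound_two)
    next
      case 3
      then obtain L where "L \<subseteq> K" "card L = 3" by (metis obtain_subset_with_card_n)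
      then obtain x y z where "x \<in> K" "y \<in> K" "z \<in> K" "x \<noteq> y" "x \<noteq> z" "y \<noteq> z"
        by (auto simp: card_3_iff)
      then have xyz: "x \<in> W" "y \<in> W" "z \<in> W" "E x y" "E x z" "E y z"
        using K(1,2) unfolding is_clique_def by auto
      let ?C = "\<lambda>u v. {w \<in> W. E w u \<and> E w v}"
      let ?X = "{w \<in> W. E w x \<and> \<not> E w y \<and> \<not> E w z}" and ?Y = "{w \<in> W. E w y \<and> \<not> E w x \<and> \<not> E w z}"
      \<comment> \<open>Only \<open>x\<close> and \<open>y\<close> are excluded here, so the
        vertices adjacent to \<open>z\<close> alone belong to \<open>?R\<close>, and two sets of
        private neighbours suffice.\<close>
      let ?R = "{w \<in> W. \<not> E w x \<and> \<not> E w y}"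
      have C: "colourable E (?m - 2) (?C u v)" if uv: "u \<in> W" "v \<in> W" "E u v" for u v
      proof (rule colourable_P4_free)
        have "clique_le (?m - 1) {w \<in> W. E w u}"
          using clique_le_nbrs[OF K(4) _ uv(1), of "{w \<in> W. E w u}"] 3 by simp
        then have "clique_le (?m - 1 - 1) (?C u v)"
          by (rule clique_le_nbrs[of _ _ v]) (use uv 3 sym in auto)
        then show "clique_le (?m - 2) (?C u v)" by (simp add: numeral_2_eq_2)
      qed (use step.prems uv in \<open>auto simp: K2_P4_free_def\<close>)
      \<comment> \<open>Used for \<open>x\<close> against \<open>yz\<close> and for \<open>y\<close>
        against \<open>xz\<close>: the edge \<open>vt\<close> is independent of everything in the
        set, and the common neighbours of \<open>u\<close> and a vertex \<open>s\<close> of the set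
        contain no induced path on four vertices.\<close>
      have G: "colourable E (g_bound p (?m - 1)) {w \<in> W. E w u \<and> \<not> E w v \<and> \<not> E w t}"
        if u: "u \<in> W" "v \<in> W" "t \<in> W" "E v t" for u v t
      proof (rule colourable_gem)
        let ?U = "{w \<in> W. E w u \<and> \<not> E w v \<and> \<not> E w t}"
        show "\<not> matching p ?U"
          using matching_reduce[OF step.prems(2) _ u(2-4)] matching_subset[of p ?U "{w \<in> W. \<not> E w v \<and> \<not> E w t}"] by auto
        show "clique_le (?m - 1) ?U"
          using clique_le_nbrs[OF K(4) _ u(1), of ?U] 3 by auto
        show "gem_free ?U"
          unfolding gem_free_def
        proof
          fix s assume "s \<in> ?U"
          then have "P4_free (?C s u)" using step.prems(3) u unfolding K2_P4_free_def by auto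
          then show "P4_free {w \<in> ?U. E w s}" by (rule P4_free_subset) auto
        qed
      qed (use step in auto)
      have R: "colourable E (f_bound p ?m) ?R"
        using step.IH[of ?R ?m] matching_reduce[OF step.prems(2) _ xyz(1,2,4)] step.prems
          clique_le_subset[OF K(4), of ?R] K2_P4_free_subset[of W ?R] by simp
      have "colourable E ((?m - 2) + (?m - 2) + (?m - 2) + g_bound p (?m - 1) + g_bound p (?m - 1) + f_bound p ?m)
        (?C x y \<union> ?C x z \<union> ?C y z \<union> ?X \<union> ?Y \<union> ?R)"
        by (intro colourable_Un C G R xyz)
      moreover have "?C x y \<union> ?C x z \<union> ?C y z \<union> ?X \<union> ?Y \<union> ?R = W" by auto
      moreover have "f_bound (Suc p) ?m = (?m - 2) + (?m - 2) + (?m - 2) + g_bound p (?m - 1) + g_bound p (?m - 1) + f_bound p ?m"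
        using f_bound_step[of "Suc p" ?m] step 3 by simp
      ultimately show ?thesis by simp
    qed
  qed
  then show ?case by (rule colourable_mono) (use f_bound_mono[of "Suc p"] step K in simp)
qed

end

section \<open>From graphs as records to the adjacency predicate\<close>

lemma induced_freeD:
  assumes "induced_free H G" "inj_on f (verts H)" "f ` verts H \<subseteq> verts G"
    "\<And>u v. u \<in> verts H \<Longrightarrow> v \<in> verts H \<Longrightarrow> {u, v} \<in> edges H \<longleftrightarrow> {f u, f v} \<in> edges G"
  shows False
proof -
  let ?S = "f ` verts H" and ?g = "the_inv_into (verts H) f"
  have "bij_betw ?g ?S (verts H)"
    using assms(2) by (simp add: bij_betw_the_inv_into inj_on_imp_bij_betw)
  moreover have "{u, v} \<in> edges (induced_on G ?S) \<longleftrightarrow> {?g u, ?g v} \<in> edges H" if "u \<in> ?S" "v \<in> ?S" for u v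
    using that assms(4) by (auto simp: induced_on_def the_inv_into_f_f[OF assms(2)])
  ultimately have "graph_isomorphic (induced_on G ?S) H"
    unfolding graph_isomorphic_def by (intro exI[of _ ?g]) (simp add: induced_on_def)
  then show False using assms(1,3) unfolding induced_free_def by blast
qed

lemma pair_nsets_2: "{u, v} \<in> [A]\<^bsup>2\<^esup> \<longleftrightarrow> u \<in> A \<and> v \<in> A \<and> u \<noteq> v"
  by (auto simp: nsets_def card_insert_if)

theorem theorem3p5:
  fixes p :: nat and G :: "'a ugraph"
  assumes "p \<ge> 2"
    and "finite_simple_graph G"
    and "induced_free (graph_copies p (complete_graph 2)) G"
    and "induced_free (graph_join (complete_graph 2) (path_graph 4)) G"
  shows "chromatic_number G \<le> f_bound p (clique_number G)"
proof -
  define E where "E u v \<longleftrightarrow> {u, v} \<in> edges G" for u v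
  let ?V = "verts G"
  have fin: "finite ?V" and edg: "edges G \<subseteq> [?V]\<^bsup>2\<^esup>"
    using assms(2) unfolding finite_simple_graph_def by auto
  have EV: "u \<in> ?V \<and> v \<in> ?V \<and> u \<noteq> v" if "E u v" for u v
    using that edg pair_nsets_2[of u v ?V] unfolding E_def by blast
  interpret sgraph E
  proof
    show "E v u" if "E u v" for u v using that unfolding E_def by (simp add: insert_commute)
    show "\<not> E u u" for u using EV by blast
  qed
  have "\<not> matching p ?V"
  proof
    assume "matching p ?V"
    then obtain a b where ab: "\<forall>i<p. a i \<in> ?V \<and> b i \<in> ?V \<and> E (a i) (b i)"
      "\<forall>i<p. \<forall>j<p. i \<noteq> j \<longrightarrow> \<not> E (a i) (a j) \<and> \<not> E (a i) (b j) \<and> \<not> E (b i) (b j)"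
      unfolding matching_def by (elim exE conjE)
    let ?H = "graph_copies p (complete_graph 2)"
    let ?f = "\<lambda>(i, k). if k = (0::nat) then a i else b i"
    have vH: "verts ?H = {..<p} \<times> {..<2}" by (simp add: graph_copies_def complete_graph_def)
    have eH: "{(i, k), (j, l)} \<in> edges ?H \<longleftrightarrow> i = j \<and> k \<noteq> l"
      if "i < p" "j < p" "k < 2" "l < 2" for i j k l
    proof
      assume "{(i, k), (j, l)} \<in> edges ?H"
      then obtain i' e where e: "i' < p" "e \<in> [{..<2}]\<^bsup>2\<^esup>" "{(i, k), (j, l)} = Pair i' ` e"
        by (auto simp: graph_copies_def complete_graph_def)
      have "(i, k) \<in> Pair i' ` e" "(j, l) \<in> Pair i' ` e" unfolding e(3)[symmetric] by auto
      then have "i = i'" "j = i'" by auto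
      have "e = snd ` (Pair i' ` e)" by (simp add: image_image)
      also have "\<dots> = {k, l}" unfolding e(3)[symmetric] by simp
      finally show "i = j \<and> k \<noteq> l" using e(2) \<open>i = i'\<close> \<open>j = i'\<close> pair_nsets_2[of k l "{..<2}"] by auto
    next
      assume "i = j \<and> k \<noteq> l"
      then have "{(i, k), (j, l)} = Pair i ` {k, l}" "{k, l} \<in> [{..<2}]\<^bsup>2\<^esup>"
        using that pair_nsets_2[of k l "{..<2}"] by auto
      then show "{(i, k), (j, l)} \<in> edges ?H"
        using that by (auto simp: graph_copies_def complete_graph_def)
    qed
    have E_f: "E (?f u) (?f v) \<longleftrightarrow> {u, v} \<in> edges ?H" if uv: "u \<in> verts ?H" "v \<in> verts ?H" for u v
    proof -
      obtain i k j l where u: "u = (i, k)" "i < p" "k < 2" and v: "v = (j, l)" "j < p" "l < 2"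
        using uv vH by auto
      have "k = 0 \<or> k = 1" "l = 0 \<or> l = 1" using u v by auto
      moreover have "E (a i) (b i)" "E (b i) (a i)" using ab(1) u(2) sym by blast+
      moreover have "\<not> E (a i) (a j) \<and> \<not> E (a i) (b j) \<and> \<not> E (b i) (a j) \<and> \<not> E (b i) (b j)" if "i \<noteq> j"
        using ab(2) u(2) v(2) that sym by metis
      ultimately show ?thesis
        using u(1) v(1) eH[OF u(2) v(2) u(3) v(3)] irrefl[of "a i"] irrefl[of "b i"] by (cases "i = j") auto
    qed
    show False
    proof (rule induced_freeD[OF assms(3)])
      show "inj_on ?f (verts ?H)"
      proof (rule inj_onI)
        fix u v assume uv: "u \<in> verts ?H" "v \<in> verts ?H" "?f u = ?f v"
        obtain i k where u: "u = (i, k)" "i < p" "k < 2" using uv vH by auto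
        obtain j l where v: "v = (j, l)" "j < p" "l < 2" using uv vH by auto
        \<comment> \<open>The partner of \<open>u\<close> in its edge, its only neighbour in
          \<open>pK2\<close>. If \<open>u\<close> and \<open>v\<close> had the same image,
          \<open>v\<close> would be adjacent to it as well.\<close>
        let ?w = "(i, 1 - k)"
        have w: "?w \<in> verts ?H" using u vH by auto
        have "k \<noteq> 1 - k" using u(3) by presburger
        then have "{u, ?w} \<in> edges ?H" using eH[of i i k "1 - k"] u by simp
        then have "{v, ?w} \<in> edges ?H" using E_f[OF uv(1) w] E_f[OF uv(2) w] uv(3) by simp
        then have "j = i" "l \<noteq> 1 - k" using eH[of j i l "1 - k"] u v by simp_all
        moreover from this have "l = k" using u(3) v(3) by presburger
        ultimately show "u = v" using u v by simp
      qed
      show "?f ` verts ?H \<subseteq> ?V" using ab vH by auto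
      show "{u, v} \<in> edges ?H \<longleftrightarrow> {?f u, ?f v} \<in> edges G" if "u \<in> verts ?H" "v \<in> verts ?H" for u v
        using E_f[OF that] unfolding E_def by simp
    qed
  qed
  moreover have "K2_P4_free ?V"
    unfolding K2_P4_free_def P4_free_def
  proof (intro ballI impI notI)
    fix x y a b c d
    assume "x \<in> ?V" "y \<in> ?V" and xy: "E x y"
      and "a \<in> {w \<in> ?V. E w x \<and> E w y}" "b \<in> {w \<in> ?V. E w x \<and> E w y}" "c \<in> {w \<in> ?V. E w x \<and> E w y}"
        "d \<in> {w \<in> ?V. E w x \<and> E w y}" and path: "path4 a b c d"
    then have V: "x \<in> ?V" "y \<in> ?V" "a \<in> ?V" "b \<in> ?V" "c \<in> ?V" "d \<in> ?V"
      and h: "E a x" "E a y" "E b x" "E b y" "E c x" "E c y" "E d x" "E d y" by auto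
    note h' = h[THEN sym] xy sym[OF xy]
    have p: "E a b" "E b c" "E c d" "\<not> E a c" "\<not> E a d" "\<not> E b d" "E b a" "E c b" "E d c" "\<not> E c a" "\<not> E d a" "\<not> E d b"
      using path sym unfolding path4_def by blast+
    let ?H = "graph_join (complete_graph 2) (path_graph 4)"
    let ?f = "case_sum (\<lambda>i. if i = (0::nat) then x else y)
      (\<lambda>i. if i = (0::nat) then a else if i = 1 then b else if i = 2 then c else d)"
    have vH: "verts ?H = {Inl 0, Inl 1, Inr 0, Inr 1, Inr 2, Inr 3}"
      by (auto simp: graph_join_def complete_graph_def path_graph_def Plus_def less_Suc_eq numeral_eq_Suc)
    \<comment> \<open>The edge set of the join is a union of three kinds of pairs. This fact reduces
      a pair inside one part to an edge of that part, and \<open>other\<close> rules out the two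
      remaining kinds.\<close>
    have img: "{h i, h j} \<in> image h ` S \<longleftrightarrow> {i, j} \<in> S" if "inj h" for h :: "nat \<Rightarrow> nat + nat" and i j S
    proof -
      have "{h i, h j} = h ` e \<longleftrightarrow> {i, j} = e" for e
        using inj_image_eq_iff[OF that, of "{i, j}" e] by simp
      then show ?thesis by (auto simp: image_iff)
    qed
    have other: "{Inl i, Inl j} \<notin> image Inr ` S" "{Inr i, Inr j} \<notin> image Inl ` S"
      "{Inl i, Inl j} \<notin> {{Inl u, Inr v} | u v. P u v}" "{Inr i, Inr j} \<notin> {{Inl u, Inr v} | u v. P u v}"
      for i j :: nat and S and P :: "nat \<Rightarrow> nat \<Rightarrow> bool"
      by (auto simp: doubleton_eq_iff)
    have ll: "{Inl i, Inl j} \<in> edges ?H \<longleftrightarrow> {i, j} \<in> [{..<2}]\<^bsup>2\<^esup>" for i j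
      by (simp only: graph_join_def complete_graph_def ugraph.simps Un_iff img[OF inj_Inl] other simp_thms)
    have rr: "{Inr i, Inr j} \<in> edges ?H \<longleftrightarrow> {i, j} \<in> {{i, Suc i} | i. Suc i < 4}" for i j
      by (simp only: graph_join_def path_graph_def ugraph.simps Un_iff img[OF inj_Inr] other simp_thms)
    have lr: "{Inl i, Inr j} \<in> edges ?H" "{Inr j, Inl i} \<in> edges ?H" if "i < 2" "j < 4" for i j
      using that by (auto simp: graph_join_def complete_graph_def path_graph_def insert_commute)
    have rr': "{Inr i, Inr j} \<in> edges ?H \<longleftrightarrow> j = Suc i \<or> i = Suc j" if "i < 4" "j < 4" for i j
      unfolding rr using that by (auto simp: doubleton_eq_iff)
    have E_f: "E (?f u) (?f v) \<longleftrightarrow> {u, v} \<in> edges ?H" if uv: "u \<in> verts ?H" "v \<in> verts ?H" for u v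
      using uv[unfolded vH] h h' p irrefl by (elim insertE emptyE)
        (simp_all only: ll pair_nsets_2 rr' lr, simp_all add: ll pair_nsets_2 rr' lr)
    show False
    proof (rule induced_freeD[OF assms(4)])
      show "inj_on ?f (verts ?H)"
        using h h' p irrefl by (auto simp: vH inj_on_def)
      show "?f ` verts ?H \<subseteq> ?V" using V by (auto simp: vH)
      show "{u, v} \<in> edges ?H \<longleftrightarrow> {?f u, ?f v} \<in> edges G" if "u \<in> verts ?H" "v \<in> verts ?H" for u v
        using E_f[OF that] unfolding E_def by simp
    qed
  qed
  moreover have "clique_le (clique_number G) ?V"
    unfolding clique_le_def
  proof (intro allI impI)
    fix K assume "K \<subseteq> ?V" "is_clique K"
    then have "clique K (edges G)" unfolding clique_def is_clique_def E_def by blast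
    then have "card K \<in> card ` {K. K \<subseteq> ?V \<and> clique K (edges G)}" using \<open>K \<subseteq> ?V\<close> by blast
    then show "card K \<le> clique_number G" unfolding clique_number_def using fin by (intro Max_ge) auto
  qed
  ultimately have "colourable E (f_bound p (clique_number G)) ?V"
    using colourable_K2_P4[OF assms(1) fin] by blast
  then obtain c where c: "\<forall>u\<in>?V. c u < f_bound p (clique_number G)" "\<forall>u\<in>?V. \<forall>v\<in>?V. E u v \<longrightarrow> c u \<noteq> c v"
    unfolding colourable_def by blast
  have "proper_colouring G (f_bound p (clique_number G)) c"
    unfolding proper_colouring_def using c EV unfolding E_def by blast
  then show ?thesis unfolding chromatic_number_def by (intro Least_le) blast
qed

end
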